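(* Let $f(\mathbf{X},\mathbf{y})=g(\mathcal{A}\mathbf{X}+\mathbf{y})+\langle\mathbf{C},\mathbf{X}\rangle+\langle\mathbf{c},\mathbf{y}\rangle$, where $g:\mathbb{R}^p\to\mathbb{R}$ is $\alpha_g$-strongly convex and $\beta_g$-smooth, $\mathcal{A}:\mathbb{S}^n\to\mathbb{R}^p$ is a linear map, $\mathbf{C}\in\mathbb{S}^n$, $\mathbf{c}\in\mathbb{R}^p$, and let $\mathcal{K}\subset\mathbb{R}^p$ be convex and compact with Euclidean diameter $D_{\mathcal{K}}$. Let $f^*=\min_{\mathbf{X}\in\mathcal{S}_n,\mathbf{y}\in\mathcal{K}}f(\mathbf{X},\mathbf{y})$, let $\{(\mathbf{X}_t,\mathbf{y}_t)\}_{t\ge1}$ (with associated unit vectors $\{\mathbf{v}_t\}_{t\ge 1}$) be a sequence produced by the algorithm described in the context, and denote $h_t:=f(\mathbf{X}_t,\mathbf{y}_t)-f^*$ for all $t\ge1$. Then, for all $t\ge1$, $$h_t=O\left(\frac{\beta_g(\Vert\mathcal{A}\Vert^2+D_{\mathcal{K}}^2)}{t}\right).$$ Moreover, suppose that every minimizer $(\mathbf{X}^*,\mathbf{y}^* )$ of $f$ over $\mathcal{S}_n\times\mathcal{K}$ satisfies $\lambda_{n-1}(\nabla_{\mathbf{X}}f(\mathbf{X}^*,\mathbf{y}^* ))-\lambda_n(\nabla_{\mathbf{X}}f(\mathbf{X}^*,\mathbf{y}^* ))=\delta>0$. Then there exists $T_0=O\left(\frac{\Vert\mathcal{A}\Vert^2\beta_g^3(\Vert\mathcal{A}\Vert^2+D_{\mathcal{K}}^2)}{\alpha_g\delta^2}\right)$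 such that for all $t\ge T_0$, $$h_{t+1}\le h_t\left(1-\min\left\{\frac16,\ \frac{\alpha_g\delta^2}{4\beta_g\left(10\alpha_g\delta\Vert\mathcal{A}\Vert^2+4\delta^2+64\Vert\mathcal{A}\Vert^4\beta_g^2\right)},\ \frac{\delta}{72\beta_g\Vert\mathcal{A}\Vert^2}\right\}\right).$$ Finally, under the same eigen-gap assumption, it also holds for all $t\ge1$ that $$\Vert\mathbf{v}_t\mathbf{v}_t^\top-\mathbf{X}^*\Vert_F^2=O\left(\frac{\beta_g^2\Vert\mathcal{A}\Vert^2}{\alpha_g\delta^2}\,h_t\right),$$ where $(\mathbf{X}^*,\mathbf{y}^* )$ is the minimizer of $f$ over $\mathcal{S}_n\times\mathcal{K}$ (which is unique under the eigen-gap assumption).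
   Context: $\mathbb{S}^n$ is the space of real symmetric $n\times n$ matrices with the trace inner product $\langle\cdot,\cdot\rangle$ and Frobenius norm $\Vert\cdot\Vert_F$. $\mathcal{S}_n=\{\mathbf{X}\in\mathbb{S}^n : \mathbf{X}\succeq 0,\ \mathrm{Tr}(\mathbf{X})=1\}$. Eigenvalues of a symmetric matrix are ordered $\lambda_1\ge\dots\ge\lambda_n$. $\beta_g$-smooth means differentiable with $\beta_g$-Lipschitz gradient; smoothness and strong convexity are with respect to the Euclidean norm. $\nabla_{\mathbf{X}}f$ and $\nabla_{\mathbf{y}}f$ denote the partial gradients with respect to the blocks $\mathbf{X}$ and $\mathbf{y}$. $\Vert\mathcal{A}\Vert=\max_{\mathbf{x}\in\mathbb{R}^p,\Vert\mathbf{x}\Vert_2=1}\Vert\mathcal{A}^\top\mathbf{x}\Vert_F$, where $\mathcal{A}^\top$ is the adjoint. $\Pi_{\mathcal{K}}$ is the Euclidean projection onto $\mathcal{K}$. The notation $O(\cdot)$ hides absolute numerical constants. Algorithm, with input $\beta_g$: $(\mathbf{X}_1,\mathbf{y}_1)$ is an arbitrary point of $\mathcal{S}_n\times\mathcal{K}$. For $t=1,2,\dots$: set $\mathbf{y}_{t+1}=\Pi_{\mathcal{K}}[\mathbf{y}_t-\frac{1}{2\beta_g}\nabla_{\mathbf{y}}f(\mathbf{X}_t,\mathbf{y}_t)]$; let $\mathbf{v}_t$ be a unit eigenvector of $-\nabla_{\mathbf{X}}f(\mathbf{X}_t,\mathbf{y}_t)$ associated with its largest eigenvalue (computed exactly);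 let $\eta_t\in\arg\min_{\eta\in[0,1]}f((1-\eta)\mathbf{X}_t+\eta\mathbf{v}_t\mathbf{v}_t^\top,\mathbf{y}_{t+1})$; set $\mathbf{X}_{t+1}=(1-\eta_t)\mathbf{X}_t+\eta_t\mathbf{v}_t\mathbf{v}_t^\top$.
   Formalization: The first bound on h_t is stated for all t≥2 instead of t≥1: at t=1 it fails for an arbitrary starting point, e.g. n=2, p=1, A=0, g(x)=x²/2, K={0}, c=0, C=X_1=diag(1,0), where h_1=1 but the right-hand side is 0. *)

theory Defs
  imports
    "HOL-Analysis.L2_Norm"
    "HOL-Analysis.Abstract_Metric_Spaces"
    "Jordan_Normal_Form.Char_Poly"
begin

text \<open>
  Dimensions are natural numbers and not types, so that the absolute constants hidden in
  the O-notation can be quantified before \<open>n\<close> and \<open>p\<close>: the space \<open>R^p\<close> is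
  \<^term>\<open>carrier_vec p :: real Matrix.vec set\<close>, and symmetric matrices live in
  \<^term>\<open>carrier_mat n n :: real Matrix.mat set\<close>. Maps are total functions of which only
  the values on these carriers matter.
\<close>

subsection \<open>Euclidean structure on \<open>R^p\<close>\<close>

definition vnorm :: "real Matrix.vec \<Rightarrow> real" where
  "vnorm x = sqrt (scalar_prod x x)"

text \<open>On \<open>carrier_vec p\<close> this is \<open>vnorm (x - y)\<close>; it is written with an explicit index set
  because \<^const>\<open>Metric_space\<close> asks for a symmetric distance on the whole type.\<close>

definition vdist :: "nat \<Rightarrow> real Matrix.vec \<Rightarrow> real Matrix.vec \<Rightarrow> real" where
  "vdist p x y = L2_set (\<lambda>i. vec_index x i - vec_index y i) {..<p}"

lemma Metric_space_vdist: "Metric_space (carrier_vec p) (vdist p)"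
proof
  show "0 \<le> vdist p x y" for x y
    by (simp add: vdist_def)
  show "vdist p x y = vdist p y x" for x y
    by (simp add: vdist_def L2_set_def power2_commute)
  show "vdist p x y = 0 \<longleftrightarrow> x = y" if "x \<in> carrier_vec p" "y \<in> carrier_vec p" for x y
    using that by (auto simp: vdist_def L2_set_eq_0_iff intro!: eq_vecI)
  show "vdist p x z \<le> vdist p x y + vdist p y z" for x y z
    using L2_set_triangle_ineq
      [of "\<lambda>i. vec_index x i - vec_index y i" "\<lambda>i. vec_index y i - vec_index z i" "{..<p}"]
    by (simp add: vdist_def)
qed

lemma vdist_eq_vnorm:
  assumes "x \<in> carrier_vec p" "y \<in> carrier_vec p"
  shows "vdist p x y = vnorm (x - y)"
  using assms
  by (auto simp: vdist_def vnorm_def L2_set_def scalar_prod_def power2_eq_square lessThan_atLeast0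
      intro!: sum.cong)

definition vcompact :: "nat \<Rightarrow> real Matrix.vec set \<Rightarrow> bool" where
  "vcompact p K \<longleftrightarrow> compactin (Metric_space.mtopology (carrier_vec p) (vdist p)) K"

definition vconvex :: "real Matrix.vec set \<Rightarrow> bool" where
  "vconvex K \<longleftrightarrow>
    (\<forall>x\<in>K. \<forall>y\<in>K. \<forall>u. 0 \<le> u \<and> u \<le> 1 \<longrightarrow> (1 - u) \<cdot>\<^sub>v x + u \<cdot>\<^sub>v y \<in> K)"

definition vdiameter :: "nat \<Rightarrow> real Matrix.vec set \<Rightarrow> real" where
  "vdiameter p K = (SUP (x, y) \<in> K \<times> K. vdist p x y)"

definition vproj :: "nat \<Rightarrow> real Matrix.vec set \<Rightarrow> real Matrix.vec \<Rightarrow> real Matrix.vec" where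
  "vproj p K z = arg_min_on (\<lambda>u. vdist p z u) K"

subsection \<open>Symmetric matrices\<close>

definition sym_mats :: "nat \<Rightarrow> real Matrix.mat set" where
  "sym_mats n = {X \<in> carrier_mat n n. transpose_mat X = X}"

definition mtrace :: "real Matrix.mat \<Rightarrow> real" where
  "mtrace X = (\<Sum>i<dim_row X. index_mat X (i, i))"

definition trace_inner :: "real Matrix.mat \<Rightarrow> real Matrix.mat \<Rightarrow> real" where
  "trace_inner X Y = mtrace (transpose_mat X * Y)"

definition fnorm :: "real Matrix.mat \<Rightarrow> real" where
  "fnorm X = sqrt (trace_inner X X)"

definition psd :: "real Matrix.mat \<Rightarrow> bool" where
  "psd X \<longleftrightarrow> (\<forall>v \<in> carrier_vec (dim_row X). 0 \<le> scalar_prod v (X *\<^sub>v v))"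

definition spectrahedron :: "nat \<Rightarrow> real Matrix.mat set" where
  "spectrahedron n = {X \<in> sym_mats n. psd X \<and> mtrace X = 1}"

definition outer :: "real Matrix.vec \<Rightarrow> real Matrix.mat" where
  "outer v = Matrix.mat (dim_vec v) (dim_vec v) (\<lambda>(i, j). vec_index v i * vec_index v j)"

text \<open>The \<open>k\<close>-th largest eigenvalue counted with multiplicity, for \<open>1 \<le> k \<le> n\<close>
  (so the index starts at 1); \<open>X\<close> is meant to be symmetric, so that all \<open>n\<close> roots of its
  characteristic polynomial are real.\<close>

definition eigval :: "real Matrix.mat \<Rightarrow> nat \<Rightarrow> real" where
  "eigval X k = rev (sorted_list_of_multiset (proots (char_poly X))) ! (k - 1)"

subsection \<open>Gradients\<close>

text \<open>Frechet gradient on a finite-dimensional space \<open>V\<close> with inner product \<open>ip\<close>;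
  used for \<open>V = carrier_vec p\<close> and for \<open>V = sym_mats n\<close>. On the latter, the gradient is by
  definition symmetric.\<close>

definition has_gradient ::
    "'a::plus set \<Rightarrow> ('a \<Rightarrow> 'a \<Rightarrow> real) \<Rightarrow> ('a \<Rightarrow> real) \<Rightarrow> 'a \<Rightarrow> 'a \<Rightarrow> bool" where
  "has_gradient V ip F G x \<longleftrightarrow> G \<in> V \<and>
    (\<forall>e>0. \<exists>d>0. \<forall>h\<in>V. sqrt (ip h h) < d \<longrightarrow>
        \<bar>F (x + h) - F x - ip G h\<bar> \<le> e * sqrt (ip h h))"

definition vgrad ::
    "nat \<Rightarrow> (real Matrix.vec \<Rightarrow> real) \<Rightarrow> real Matrix.vec \<Rightarrow> real Matrix.vec" where
  "vgrad p F x = (THE G. has_gradient (carrier_vec p) scalar_prod F G x)"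

definition mgrad ::
    "nat \<Rightarrow> (real Matrix.mat \<Rightarrow> real) \<Rightarrow> real Matrix.mat \<Rightarrow> real Matrix.mat" where
  "mgrad n F X = (THE G. has_gradient (sym_mats n) trace_inner F G X)"

abbreviation grad_X ::
    "nat \<Rightarrow> (real Matrix.mat \<Rightarrow> real Matrix.vec \<Rightarrow> real) \<Rightarrow> real Matrix.mat \<Rightarrow> real Matrix.vec
      \<Rightarrow> real Matrix.mat" where
  "grad_X n f X y \<equiv> mgrad n (\<lambda>Z. f Z y) X"

abbreviation grad_y ::
    "nat \<Rightarrow> (real Matrix.mat \<Rightarrow> real Matrix.vec \<Rightarrow> real) \<Rightarrow> real Matrix.mat \<Rightarrow> real Matrix.vec
      \<Rightarrow> real Matrix.vec" where
  "grad_y p f X y \<equiv> vgrad p (\<lambda>z. f X z) y"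

definition smooth :: "nat \<Rightarrow> real \<Rightarrow> (real Matrix.vec \<Rightarrow> real) \<Rightarrow> bool" where
  "smooth p \<beta> g \<longleftrightarrow>
    (\<forall>x \<in> carrier_vec p. \<exists>G. has_gradient (carrier_vec p) scalar_prod g G x) \<and>
    (\<forall>x \<in> carrier_vec p. \<forall>y \<in> carrier_vec p.
        vdist p (vgrad p g x) (vgrad p g y) \<le> \<beta> * vdist p x y)"

definition strongly_convex :: "nat \<Rightarrow> real \<Rightarrow> (real Matrix.vec \<Rightarrow> real) \<Rightarrow> bool" where
  "strongly_convex p \<alpha> g \<longleftrightarrow>
    (\<forall>x \<in> carrier_vec p. \<forall>y \<in> carrier_vec p. \<forall>u. 0 \<le> u \<and> u \<le> 1 \<longrightarrow>
        g ((1 - u) \<cdot>\<^sub>v x + u \<cdot>\<^sub>v y)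
          \<le> (1 - u) * g x + u * g y - \<alpha> / 2 * u * (1 - u) * (vdist p x y)\<^sup>2)"

subsection \<open>Linear maps from symmetric matrices to \<open>R^p\<close>\<close>

definition sym_linear :: "nat \<Rightarrow> nat \<Rightarrow> (real Matrix.mat \<Rightarrow> real Matrix.vec) \<Rightarrow> bool" where
  "sym_linear n p A \<longleftrightarrow>
    (\<forall>X \<in> sym_mats n. A X \<in> carrier_vec p) \<and>
    (\<forall>X \<in> sym_mats n. \<forall>Y \<in> sym_mats n. A (X + Y) = A X + A Y) \<and>
    (\<forall>X \<in> sym_mats n. \<forall>r. A (r \<cdot>\<^sub>m X) = r \<cdot>\<^sub>v A X)"

definition adj :: "nat \<Rightarrow> (real Matrix.mat \<Rightarrow> real Matrix.vec) \<Rightarrow> real Matrix.vec \<Rightarrow> real Matrix.mat"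
  where
  "adj n A x = (THE S. S \<in> sym_mats n \<and>
    (\<forall>X \<in> sym_mats n. trace_inner S X = scalar_prod x (A X)))"

definition op_norm :: "nat \<Rightarrow> nat \<Rightarrow> (real Matrix.mat \<Rightarrow> real Matrix.vec) \<Rightarrow> real" where
  "op_norm n p A = (SUP x \<in> {x \<in> carrier_vec p. vnorm x = 1}. fnorm (adj n A x))"

subsection \<open>The optimization problem and the algorithm\<close>

definition objective ::
    "(real Matrix.vec \<Rightarrow> real) \<Rightarrow> (real Matrix.mat \<Rightarrow> real Matrix.vec) \<Rightarrow> real Matrix.mat
      \<Rightarrow> real Matrix.vec \<Rightarrow> real Matrix.mat \<Rightarrow> real Matrix.vec \<Rightarrow> real" where
  "objective g A C c X y = g (A X + y) + trace_inner C X + scalar_prod c y"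

definition minimizer ::
    "nat \<Rightarrow> real Matrix.vec set \<Rightarrow> (real Matrix.mat \<Rightarrow> real Matrix.vec \<Rightarrow> real)
      \<Rightarrow> real Matrix.mat \<Rightarrow> real Matrix.vec \<Rightarrow> bool" where
  "minimizer n K f X y \<longleftrightarrow>
    is_arg_min (\<lambda>(X, y). f X y) (\<lambda>(X, y). X \<in> spectrahedron n \<and> y \<in> K) (X, y)"

definition opt_value ::
    "nat \<Rightarrow> real Matrix.vec set \<Rightarrow> (real Matrix.mat \<Rightarrow> real Matrix.vec \<Rightarrow> real) \<Rightarrow> real" where
  "opt_value n K f = (INF (X, y) \<in> spectrahedron n \<times> K. f X y)"

definition problem_data ::
    "nat \<Rightarrow> nat \<Rightarrow> real \<Rightarrow> real \<Rightarrow> (real Matrix.vec \<Rightarrow> real) \<Rightarrow> (real Matrix.mat \<Rightarrow> real Matrix.vec)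
      \<Rightarrow> real Matrix.mat \<Rightarrow> real Matrix.vec \<Rightarrow> real Matrix.vec set \<Rightarrow> bool" where
  "problem_data n p \<alpha> \<beta> g A C c K \<longleftrightarrow>
    0 < n \<and> 0 < p \<and> 0 < \<alpha> \<and> 0 < \<beta> \<and>
    strongly_convex p \<alpha> g \<and> smooth p \<beta> g \<and> sym_linear n p A \<and>
    C \<in> sym_mats n \<and> c \<in> carrier_vec p \<and>
    K \<subseteq> carrier_vec p \<and> vconvex K \<and> vcompact p K"

text \<open>Iterates are indexed from 1; the values at index 0 are irrelevant.\<close>

definition fw_run ::
    "nat \<Rightarrow> nat \<Rightarrow> real \<Rightarrow> real Matrix.vec set \<Rightarrow> (real Matrix.mat \<Rightarrow> real Matrix.vec \<Rightarrow> real)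
      \<Rightarrow> (nat \<Rightarrow> real Matrix.mat) \<Rightarrow> (nat \<Rightarrow> real Matrix.vec) \<Rightarrow> (nat \<Rightarrow> real Matrix.vec)
      \<Rightarrow> (nat \<Rightarrow> real) \<Rightarrow> bool" where
  "fw_run n p \<beta> K f X y v \<eta> \<longleftrightarrow>
    X 1 \<in> spectrahedron n \<and> y 1 \<in> K \<and>
    (\<forall>t\<ge>1.
      y (Suc t) = vproj p K (y t - (1 / (2 * \<beta>)) \<cdot>\<^sub>v grad_y p f (X t) (y t)) \<and>
      v t \<in> carrier_vec n \<and> vnorm (v t) = 1 \<and>
      eigenvector (- grad_X n f (X t) (y t)) (v t) (eigval (- grad_X n f (X t) (y t)) 1) \<and>
      is_arg_min (\<lambda>e. f ((1 - e) \<cdot>\<^sub>m X t + e \<cdot>\<^sub>m outer (v t)) (y (Suc t)))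
        (\<lambda>e. 0 \<le> e \<and> e \<le> 1) (\<eta> t) \<and>
      X (Suc t) = (1 - \<eta> t) \<cdot>\<^sub>m X t + \<eta> t \<cdot>\<^sub>m outer (v t))"

text \<open>The decrease factor in terms of \<open>N\<close>, the norm of the linear map. If \<open>N = 0\<close>, the term
  \<open>\<delta> / (72 * \<beta> * N\<^sup>2)\<close> stands for \<open>+\<infinity>\<close> and drops out of the minimum (whereas HOL would
  evaluate it to 0).\<close>

definition fw_rate :: "real \<Rightarrow> real \<Rightarrow> real \<Rightarrow> real \<Rightarrow> real" where
  "fw_rate \<alpha> \<beta> \<delta> N =
    (let a = 1 / 6;
         b = \<alpha> * \<delta>\<^sup>2 / (4 * \<beta> * (10 * \<alpha> * \<delta> * N\<^sup>2 + 4 * \<delta>\<^sup>2 + 64 * N ^ 4 * \<beta>\<^sup>2))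
     in if N = 0 then min a b else min (min a b) (\<delta> / (72 * \<beta> * N\<^sup>2)))"

end

theory Submission
  imports Defs
begin

text \<open>
  The step satisfies, for every feasible \<open>(U, u)\<close> and every \<open>e \<in> [0, 1]\<close>,
  \<open>f\<^sub>t\<^sub>+\<^sub>1 \<le> (1 - e) f\<^sub>t + e f(U, u) + e\<^sup>2 \<beta> (N\<^sup>2 |V\<^sub>t - X\<^sub>t|\<^sup>2 + |u - y\<^sub>t|\<^sup>2)\<close>, where \<open>V\<^sub>t\<close> is the outer
  square of \<open>v\<^sub>t\<close>. Bounding the last bracket by the diameters gives the sublinear rate. Under the
  eigengap, \<open>X\<^sup>*\<close> is the rank-one projection on the bottom eigenvector of the optimal gradient,
  and the gap \<open>\<delta>\<close> makes that gradient grow quadratically around \<open>X\<^sup>*\<close>; hence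
  \<open>\<delta>/2 |X - X\<^sup>*|\<^sup>2 + \<alpha>/2 |z - z\<^sup>*|\<^sup>2 \<le> h\<close> with \<open>z = A X + y\<close>. Comparing the gradients at
  \<open>z\<^sub>t\<close> and \<open>z\<^sup>*\<close> bounds \<open>|V\<^sub>t - X\<^sup>*|\<close> by a multiple of \<open>|z\<^sub>t - z\<^sup>*|\<close>. So the bracket above is at
  most a multiple of \<open>h\<^sub>t\<close>, already at the first step, and the linear rate holds with \<open>T\<^sub>0 = 0\<close>.
\<close>

subsection \<open>Inner products on carriers\<close>

text \<open>Strong convexity of \<open>g\<close> controls only the residual \<open>A X + y\<close>,
  hence neither block by itself. The eigengap supplies the missing control of \<open>X\<close>, and
  \<open>y\<close> is then recovered as the residual minus \<open>A X\<close>. The blocks are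
  coupled through that residual. Splitting its square at the price of a factor 2 makes the
  smoothness bound separable, and this factor explains the step size
  \<open>1 / (2 * \<beta>)\<close>: the projection then minimizes its block of the bound exactly.
  The eigenvector minimizes only the linear part of the other block, which is why the quadratic term
  retains the algorithm's own direction there instead of \<open>U\<close>. The algorithm never sees
  \<open>(U, u)\<close> and \<open>e\<close>, so both are free in the analysis; the two rates differ
  in the choice of \<open>e\<close>. Since dimensions are numbers, all linear algebra and analysis
  lives on carrier sets, and vectors and symmetric matrices share one abstract inner
  product.\<close>

locale inner_carrier =
  fixes V :: "'a::{plus,minus} set" and sm :: "real \<Rightarrow> 'a \<Rightarrow> 'a" and ip :: "'a \<Rightarrow> 'a \<Rightarrow> real"
  assumes add_closed: "\<And>x y. x \<in> V \<Longrightarrow> y \<in> V \<Longrightarrow> x + y \<in> V"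
    and diff_closed: "\<And>x y. x \<in> V \<Longrightarrow> y \<in> V \<Longrightarrow> x - y \<in> V"
    and sm_closed: "\<And>r x. x \<in> V \<Longrightarrow> sm r x \<in> V"
    and ip_commute: "\<And>x y. x \<in> V \<Longrightarrow> y \<in> V \<Longrightarrow> ip x y = ip y x"
    and ip_add_left: "\<And>x y z. x \<in> V \<Longrightarrow> y \<in> V \<Longrightarrow> z \<in> V \<Longrightarrow> ip (x + y) z = ip x z + ip y z"
    and ip_diff_left: "\<And>x y z. x \<in> V \<Longrightarrow> y \<in> V \<Longrightarrow> z \<in> V \<Longrightarrow> ip (x - y) z = ip x z - ip y z"
    and ip_sm_left: "\<And>r x z. x \<in> V \<Longrightarrow> z \<in> V \<Longrightarrow> ip (sm r x) z = r * ip x z"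
    and ip_ge0: "\<And>x. x \<in> V \<Longrightarrow> 0 \<le> ip x x"
    and ip_diff_eq0: "\<And>x y. x \<in> V \<Longrightarrow> y \<in> V \<Longrightarrow> ip (x - y) (x - y) = 0 \<Longrightarrow> x = y"
begin

abbreviation nrm :: "'a \<Rightarrow> real" where "nrm x \<equiv> sqrt (ip x x)"

lemma ip_add_right: "x \<in> V \<Longrightarrow> y \<in> V \<Longrightarrow> z \<in> V \<Longrightarrow> ip z (x + y) = ip z x + ip z y"
  using ip_add_left[of x y z] ip_commute add_closed by metis

lemma ip_diff_right: "x \<in> V \<Longrightarrow> y \<in> V \<Longrightarrow> z \<in> V \<Longrightarrow> ip z (x - y) = ip z x - ip z y"
  using ip_diff_left[of x y z] ip_commute diff_closed by metis

lemma ip_sm_right: "x \<in> V \<Longrightarrow> z \<in> V \<Longrightarrow> ip z (sm r x) = r * ip z x"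
  using ip_sm_left[of x z r] ip_commute sm_closed by metis

lemmas closed = add_closed diff_closed sm_closed
lemmas ip_simps = ip_add_left ip_diff_left ip_sm_left ip_add_right ip_diff_right ip_sm_right

lemma nrm_square: "x \<in> V \<Longrightarrow> (nrm x)\<^sup>2 = ip x x"
  by (simp add: ip_ge0)

lemma nrm_sm: "x \<in> V \<Longrightarrow> nrm (sm r x) = \<bar>r\<bar> * nrm x"
  by (simp add: ip_simps closed real_sqrt_mult mult.assoc[symmetric])

lemma Cauchy_Schwarz_square:
  assumes "x \<in> V" "y \<in> V"
  shows "(ip x y)\<^sup>2 \<le> ip x x * ip y y"
proof (cases "ip y y = 0")
  case True
  \<comment> \<open>With \<open>ip y y = 0\<close> the square of \<open>x - sm t y\<close> is affine
    in \<open>t\<close>; this \<open>t\<close> would bring it down to -1.\<close>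
  define t where "t = (ip x x + 1) / (2 * ip x y)"
  have "ip x y = 0"
  proof (rule ccontr)
    assume ne: "ip x y \<noteq> 0"
    have "0 \<le> ip (x - sm t y) (x - sm t y)"
      using assms by (simp add: ip_ge0 closed)
    also have "\<dots> = ip x x - 2 * t * ip x y"
      using assms True by (simp add: ip_simps closed ip_commute[of y x])
    also have "\<dots> = -1" using ne by (simp add: t_def field_simps)
    finally show False by simp
  qed
  then show ?thesis using True by simp
next
  case False
  let ?a = "ip y y" and ?b = "ip x y"
  have a: "0 < ?a" using False ip_ge0[OF assms(2)] by simp
  \<comment> \<open>The component of \<open>x\<close> orthogonal to \<open>y\<close>, scaled by
    \<open>?a\<close> to avoid a division.\<close>
  have "0 \<le> ip (sm ?a x - sm ?b y) (sm ?a x - sm ?b y)"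
    using assms by (simp add: ip_ge0 closed)
  also have "\<dots> = ?a * (ip x x * ?a - ?b\<^sup>2)"
    using assms by (simp add: ip_simps closed ip_commute[of y x] power2_eq_square algebra_simps)
  finally show ?thesis using a by (simp add: zero_le_mult_iff)
qed

lemma Cauchy_Schwarz:
  assumes "x \<in> V" "y \<in> V"
  shows "\<bar>ip x y\<bar> \<le> nrm x * nrm y"
  using Cauchy_Schwarz_square[OF assms] real_sqrt_le_mono
  by (fastforce simp: real_sqrt_mult)

text \<open>Parallelogram law: the two sides differ by the square of \<open>?w\<close>.\<close>

lemma ip_diff_self_le:
  assumes "x \<in> V" "y \<in> V" "u \<in> V"
  shows "ip (x - y) (x - y) \<le> 2 * ip (x - u) (x - u) + 2 * ip (u - y) (u - y)"
proof -
  let ?w = "(x - u) - (u - y)"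
  have "0 \<le> ip ?w ?w" using assms by (simp add: ip_ge0 closed)
  then show ?thesis using assms
    by (simp add: ip_simps closed ip_commute[of y x] ip_commute[of u x] ip_commute[of y u])
qed

lemma ip_add_self_le:
  assumes "x \<in> V" "y \<in> V"
  shows "ip (x + y) (x + y) \<le> 2 * ip x x + 2 * ip y y"
proof -
  have "0 \<le> ip (x - y) (x - y)" using assms by (simp add: ip_ge0 closed)
  then show ?thesis using assms by (simp add: ip_simps closed ip_commute[of y x])
qed

text \<open>Restriction to lines turns gradients into one-variable calculus. The premise
  \<open>zero\<close> stands for the law that \<open>sm 0 d\<close> adds nothing, which the locale
  does not contain.\<close>

lemma has_gradient_deriv:
  assumes G: "has_gradient V ip F G x" and d: "d \<in> V"
    and zero: "F (x + sm 0 d) = F x"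
  shows "((\<lambda>t. F (x + sm t d)) has_real_derivative ip G d) (at 0)"
proof -
  have GV: "G \<in> V" using G by (simp add: has_gradient_def)
  have "((\<lambda>t. (F (x + sm t d) - F x) / t) \<longlongrightarrow> ip G d) (at 0)"
    unfolding LIM_eq
  proof (intro allI impI)
    fix r :: real assume r: "0 < r"
    obtain m where m: "nrm d = m" by blast
    have m0: "0 \<le> m" using ip_ge0[OF d] m by auto
    \<comment> \<open>Adding 1 covers a direction of norm 0; the factor 2 makes the final inequality
      strict.\<close>
    define e where "e = r / (2 * (m + 1))"
    have e: "0 < e" using r m0 by (simp add: e_def)
    obtain s where s: "0 < s"
      and bound: "\<And>h. h \<in> V \<Longrightarrow> nrm h < s \<Longrightarrow> \<bar>F (x + h) - F x - ip G h\<bar> \<le> e * nrm h"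
      using G e unfolding has_gradient_def by blast
    show "\<exists>s>0. \<forall>t. t \<noteq> 0 \<and> norm (t - 0) < s \<longrightarrow>
        norm ((F (x + sm t d) - F x) / t - ip G d) < r"
    proof (intro exI[of _ "s / (m + 1)"] conjI allI impI)
      show "0 < s / (m + 1)" using s m0 by simp
      fix t :: real assume t: "t \<noteq> 0 \<and> norm (t - 0) < s / (m + 1)"
      have "\<bar>t\<bar> * m \<le> \<bar>t\<bar> * (m + 1)" by (simp add: mult_left_mono)
      also have "\<dots> < s" using t m0 by (simp add: field_simps)
      finally have small: "\<bar>t\<bar> * m < s" .
      have nt: "nrm (sm t d) = \<bar>t\<bar> * m" using nrm_sm[OF d] m by simp
      have "\<bar>F (x + sm t d) - F x - ip G (sm t d)\<bar> \<le> e * nrm (sm t d)"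
        using small d by (intro bound) (simp_all only: nt closed)
      then have "\<bar>F (x + sm t d) - F x - t * ip G d\<bar> \<le> e * (\<bar>t\<bar> * m)"
        unfolding nt ip_sm_right[OF d GV] .
      then have "\<bar>F (x + sm t d) - F x - t * ip G d\<bar> / \<bar>t\<bar> \<le> e * m"
        using t by (simp add: field_simps)
      also have "\<bar>F (x + sm t d) - F x - t * ip G d\<bar> / \<bar>t\<bar>
          = \<bar>(F (x + sm t d) - F x) / t - ip G d\<bar>"
        using t by (simp add: abs_divide[symmetric] diff_divide_distrib)
      also have "e * m < r"
      proof -
        have "e * m \<le> e * (m + 1)" using e by (simp add: mult_left_mono)
        also have "\<dots> = r / 2" using m0 by (simp add: e_def field_simps)
        finally show ?thesis using r by simp
      qed
      finally show "norm ((F (x + sm t d) - F x) / t - ip G d) < r" by simp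
    qed
  qed
  then show ?thesis using zero by (simp add: has_field_derivative_iff)
qed

text \<open>Both gradients are tested on their own difference. \<open>ip_diff_eq0\<close> expresses
  definiteness without a zero vector, which would depend on the dimension. Uniqueness is what gives
  the definite descriptions \<open>vgrad\<close> and \<open>mgrad\<close> their values.\<close>

lemma has_gradient_unique:
  assumes "has_gradient V ip F G x" "has_gradient V ip F G' x"
    and "\<And>d. d \<in> V \<Longrightarrow> x + sm 0 d = x"
  shows "G = G'"
proof (rule ip_diff_eq0)
  show G: "G \<in> V" "G' \<in> V" using assms by (auto simp: has_gradient_def)
  let ?d = "G - G'"
  have d: "?d \<in> V" using G by (simp add: closed)
  have "ip G ?d = ip G' ?d"
    using has_gradient_deriv[OF assms(1) d] has_gradient_deriv[OF assms(2) d] assms(3)[OF d]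
    by (auto intro: DERIV_unique)
  then show "ip ?d ?d = 0" using d G ip_diff_left[OF G d] by simp
qed

end

section \<open>Vectors and symmetric matrices as inner product spaces\<close>

lemma scalar_prod_self_zero:
  fixes x :: "real Matrix.vec"
  assumes "x \<in> carrier_vec p" "scalar_prod x x = 0"
  shows "x = 0\<^sub>v p"
proof (rule eq_vecI)
  have "(\<Sum>i<p. (vec_index x i)\<^sup>2) = 0"
    using assms by (simp add: scalar_prod_def power2_eq_square lessThan_atLeast0)
  then have "\<forall>i<p. vec_index x i = 0" by (subst (asm) sum_nonneg_eq_0_iff) auto
  then show "vec_index x i = vec_index (0\<^sub>v p) i" if "i < dim_vec (0\<^sub>v p)" for i
    using that by simp
qed (use assms in simp)

lemma inner_carrier_vec:
  "inner_carrier (carrier_vec p) (\<cdot>\<^sub>v) (scalar_prod :: real Matrix.vec \<Rightarrow> _)"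
proof
  show "scalar_prod x y = scalar_prod y x" if "x \<in> carrier_vec p" "y \<in> carrier_vec p"
    for x y :: "real Matrix.vec" using that by (rule comm_scalar_prod)
  show "0 \<le> scalar_prod x x" for x :: "real Matrix.vec"
    by (simp add: scalar_prod_def sum_nonneg)
  show "x = y" if xy: "x \<in> carrier_vec p" "y \<in> carrier_vec p" "scalar_prod (x - y) (x - y) = 0"
    for x y :: "real Matrix.vec"
  proof -
    have d: "x - y = 0\<^sub>v p" using xy by (intro scalar_prod_self_zero) auto
    have "vec_index x i = vec_index y i" if "i < p" for i
    proof -
      have "vec_index (x - y) i = 0" unfolding d using that by simp
      then show ?thesis using that xy by simp
    qed
    then show ?thesis using xy by (intro eq_vecI) auto
  qed
qed (auto simp: add_scalar_prod_distrib minus_scalar_prod_distrib)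

lemma mtrace_add: "X \<in> carrier_mat n n \<Longrightarrow> Y \<in> carrier_mat n n \<Longrightarrow>
    mtrace (X + Y) = mtrace X + mtrace Y"
  by (auto simp: mtrace_def sum.distrib)

lemma mtrace_smult: "mtrace (r \<cdot>\<^sub>m X) = r * mtrace X" if "X \<in> carrier_mat n n"
  using that by (auto simp: mtrace_def sum_distrib_left)

lemma mtrace_mult_commute:
  assumes "A \<in> carrier_mat n m" "B \<in> carrier_mat m n"
  shows "mtrace (A * B) = mtrace (B * A)"
proof -
  have "mtrace (A * B) = (\<Sum>i<n. \<Sum>k<m. A $$ (i, k) * B $$ (k, i))"
    using assms by (auto simp: mtrace_def scalar_prod_def lessThan_atLeast0)
  also have "\<dots> = (\<Sum>k<m. \<Sum>i<n. A $$ (i, k) * B $$ (k, i))" by (rule sum.swap)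
  also have "\<dots> = mtrace (B * A)"
    using assms by (auto simp: mtrace_def scalar_prod_def lessThan_atLeast0 mult.commute)
  finally show ?thesis .
qed

lemma trace_inner_eq_sum:
  assumes "X \<in> carrier_mat n n" "Y \<in> carrier_mat n n"
  shows "trace_inner X Y = (\<Sum>i<n. \<Sum>j<n. X $$ (i, j) * Y $$ (i, j))"
proof -
  have "trace_inner X Y = (\<Sum>j<n. \<Sum>i<n. X $$ (i, j) * Y $$ (i, j))"
    using assms by (auto simp: trace_inner_def mtrace_def scalar_prod_def lessThan_atLeast0)
  then show ?thesis by (subst sum.swap)
qed

lemma sym_mats_carrier: "X \<in> sym_mats n \<Longrightarrow> X \<in> carrier_mat n n"
  by (simp add: sym_mats_def)

lemma sym_matsI:
  assumes "X \<in> carrier_mat n n" "\<And>i j. i < n \<Longrightarrow> j < n \<Longrightarrow> X $$ (i, j) = X $$ (j, i)"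
  shows "X \<in> sym_mats n"
  using assms by (auto simp: sym_mats_def intro!: eq_matI)

lemma sym_matsD: "X \<in> sym_mats n \<Longrightarrow> i < n \<Longrightarrow> j < n \<Longrightarrow> X $$ (i, j) = X $$ (j, i)"
  unfolding sym_mats_def by (metis (mono_tags, lifting) carrier_matD index_transpose_mat(1) mem_Collect_eq)

lemma inner_carrier_sym_mats: "inner_carrier (sym_mats n) (\<cdot>\<^sub>m) trace_inner"
proof
  show "X + Y \<in> sym_mats n" "X - Y \<in> sym_mats n"
    if "X \<in> sym_mats n" "Y \<in> sym_mats n" for X Y
    using that sym_mats_carrier[OF that(1)] sym_mats_carrier[OF that(2)]
    by (auto intro!: sym_matsI simp: sym_matsD)
  show "r \<cdot>\<^sub>m X \<in> sym_mats n" if "X \<in> sym_mats n" for X r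
    using that sym_mats_carrier[OF that]
    by (auto intro!: sym_matsI simp: sym_matsD)
  show "trace_inner (X + Y) Z = trace_inner X Z + trace_inner Y Z"
      "trace_inner (X - Y) Z = trace_inner X Z - trace_inner Y Z"
    if "X \<in> sym_mats n" "Y \<in> sym_mats n" "Z \<in> sym_mats n" for X Y Z
    using that[THEN sym_mats_carrier]
    by (simp_all add: trace_inner_eq_sum[of _ n] minus_carrier_mat sum.distrib
        sum_subtractf distrib_right left_diff_distrib)
  show "trace_inner X Y = trace_inner Y X" if "X \<in> sym_mats n" "Y \<in> sym_mats n" for X Y
    using that[THEN sym_mats_carrier] by (simp add: trace_inner_eq_sum[of _ n] mult.commute)
  show "trace_inner (r \<cdot>\<^sub>m X) Z = r * trace_inner X Z" if "X \<in> sym_mats n" "Z \<in> sym_mats n" for r X Z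
    using that[THEN sym_mats_carrier]
    by (simp add: trace_inner_eq_sum[of _ n] sum_distrib_left mult.assoc)
  show "0 \<le> trace_inner X X" if "X \<in> sym_mats n" for X
    using that[THEN sym_mats_carrier] by (simp add: trace_inner_eq_sum[of _ n] sum_nonneg)
  show "X = Y" if XY: "X \<in> sym_mats n" "Y \<in> sym_mats n" "trace_inner (X - Y) (X - Y) = 0" for X Y
  proof -
    note c = XY(1,2)[THEN sym_mats_carrier]
    have "(\<Sum>i<n. \<Sum>j<n. (X $$ (i, j) - Y $$ (i, j))\<^sup>2) = 0"
      using c XY(3) by (simp add: trace_inner_eq_sum[of _ n] minus_carrier_mat power2_eq_square)
    then have "(\<Sum>j<n. (X $$ (i, j) - Y $$ (i, j))\<^sup>2) = 0" if "i < n" for i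
      using that sum_nonneg_0[of "{..<n}" "\<lambda>i. \<Sum>j<n. (X $$ (i, j) - Y $$ (i, j))\<^sup>2" i]
      by (simp add: sum_nonneg)
    then have "(X $$ (i, j) - Y $$ (i, j))\<^sup>2 = 0" if "i < n" "j < n" for i j
      using that sum_nonneg_0[of "{..<n}" "\<lambda>j. (X $$ (i, j) - Y $$ (i, j))\<^sup>2" j] by simp
    then show "X = Y" using c by (intro eq_matI) auto
  qed
qed

interpretation vec: inner_carrier "carrier_vec p" "(\<cdot>\<^sub>v)" "scalar_prod :: real Matrix.vec \<Rightarrow> _" for p
  by (rule inner_carrier_vec)

interpretation mat: inner_carrier "sym_mats n" "(\<cdot>\<^sub>m)" trace_inner for n
  by (rule inner_carrier_sym_mats)

section \<open>Gradients on the two carriers\<close>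

lemma vec_gradient_unique:
  assumes "has_gradient (carrier_vec p) scalar_prod F G x" "x \<in> carrier_vec p"
  shows "vgrad p F x = G"
  unfolding vgrad_def
proof (rule the_equality)
  have "x + 0 \<cdot>\<^sub>v d = x" if "d \<in> carrier_vec p" for d
    using assms(2) that by (intro eq_vecI) auto
  then show "G' = G" if "has_gradient (carrier_vec p) scalar_prod F G' x" for G'
    using vec.has_gradient_unique[OF that assms(1)] by blast
qed (rule assms)

lemma sym_mats_add_zero_smult:
  assumes "X \<in> sym_mats n" "d \<in> sym_mats n"
  shows "X + 0 \<cdot>\<^sub>m d = (X :: real Matrix.mat)"
  using assms[THEN sym_mats_carrier] by (intro eq_matI) auto

lemma sym_gradient_unique:
  assumes "has_gradient (sym_mats n) trace_inner F G X" "X \<in> sym_mats n"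
  shows "mgrad n F X = G"
  unfolding mgrad_def
proof (rule the_equality)
  show "G' = G" if "has_gradient (sym_mats n) trace_inner F G' X" for G'
    using mat.has_gradient_unique[OF that assms(1)] sym_mats_add_zero_smult[OF assms(2)] by blast
qed (rule assms)

subsection \<open>Sequential compactness\<close>

text \<open>Bolzano-Weierstrass on finitely many coordinates. The index set is arbitrary so that it
  serves vectors and also matrices, whose entries are indexed by pairs.\<close>

lemma bounded_coordinates_subseq:
  fixes f :: "nat \<Rightarrow> 'i \<Rightarrow> real"
  assumes "finite I" "\<And>k i. i \<in> I \<Longrightarrow> \<bar>f k i\<bar> \<le> B"
  shows "\<exists>l r. strict_mono (r :: nat \<Rightarrow> nat) \<and> (\<forall>i\<in>I. (\<lambda>k. f (r k) i) \<longlonglongrightarrow> l i)"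
proof -
  have "\<forall>J\<subseteq>I. \<exists>l. \<exists>r::nat\<Rightarrow>nat. strict_mono r \<and>
      (\<forall>e>0. eventually (\<lambda>n. \<forall>i\<in>J. dist (f (r n) i) (l i) < e) sequentially)"
  proof (rule compact_lemma_general[where proj = "\<lambda>x i. x i" and unproj = "\<lambda>x. x"])
    show "bounded ((\<lambda>x. x i) ` range f)" if "i \<in> I" for i
      using assms(2)[OF that] by (auto simp: bounded_iff intro!: exI[of _ B])
  qed (use assms in auto)
  then obtain l r where r: "strict_mono (r :: nat \<Rightarrow> nat)"
    and lim: "\<And>e. e > 0 \<Longrightarrow> eventually (\<lambda>n. \<forall>i\<in>I. dist (f (r n) i) (l i) < e) sequentially"
    by blast
  have "(\<lambda>k. f (r k) i) \<longlonglongrightarrow> l i" if "i \<in> I" for i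
    unfolding tendsto_iff
  proof (intro allI impI)
    show "eventually (\<lambda>n. dist (f (r n) i) (l i) < e) sequentially" if "e > 0" for e
      using lim[OF that] by eventually_elim (use \<open>i \<in> I\<close> in blast)
  qed
  with r show ?thesis by blast
qed

text \<open>The hypothesis speaks only of values of \<open>F\<close>: it makes the image of
  \<open>S\<close> a sequentially compact set of reals. This one form serves Rayleigh quotients,
  projections and the objective.\<close>

lemma sequentially_compact_attains_inf:
  fixes F :: "'a \<Rightarrow> real"
  assumes "S \<noteq> {}"
    and subseq: "\<And>xs. (\<And>k::nat. xs k \<in> S) \<Longrightarrow>
      \<exists>l\<in>S. \<exists>r. strict_mono (r :: nat \<Rightarrow> nat) \<and> (\<lambda>k. F (xs (r k))) \<longlonglongrightarrow> F l"
  shows "\<exists>l\<in>S. \<forall>x\<in>S. F l \<le> F x"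
proof -
  have "seq_compact (F ` S)"
    unfolding seq_compact_def
  proof (intro allI impI)
    fix f :: "nat \<Rightarrow> real" assume "\<forall>k. f k \<in> F ` S"
    then have "\<forall>k. \<exists>x. x \<in> S \<and> f k = F x" by blast
    then obtain xs where xs: "\<And>k. xs k \<in> S" "\<And>k. f k = F (xs k)" by metis
    obtain l r where "l \<in> S" "strict_mono (r :: nat \<Rightarrow> nat)" "(\<lambda>k. F (xs (r k))) \<longlonglongrightarrow> F l"
      using subseq[of xs] xs by blast
    then show "\<exists>l\<in>F ` S. \<exists>r. strict_mono (r :: nat \<Rightarrow> nat) \<and> (f \<circ> r) \<longlonglongrightarrow> l"
      by (intro bexI[of _ "F l"] exI[of _ r]) (auto simp: o_def xs(2))
  qed
  then have "compact (F ` S)" by (simp add: compact_eq_seq_compact_metric)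
  then obtain s where "s \<in> F ` S" "\<forall>t\<in>F ` S. s \<le> t"
    using compact_attains_inf assms(1) by blast
  then show ?thesis by auto
qed

lemma scalar_prod_eq_sum:
  "y \<in> carrier_vec n \<Longrightarrow> scalar_prod x y = (\<Sum>i<n. vec_index x i * vec_index y i)"
  by (simp add: scalar_prod_def lessThan_atLeast0)

lemma vec_index_square_le:
  fixes x :: "real Matrix.vec"
  assumes "x \<in> carrier_vec n" "i < n"
  shows "(vec_index x i)\<^sup>2 \<le> scalar_prod x x"
  using assms member_le_sum[of i "{..<n}" "\<lambda>i. (vec_index x i)\<^sup>2"]
  by (simp add: scalar_prod_eq_sum power2_eq_square)

lemma tendsto_scalar_prod:
  fixes x y :: "nat \<Rightarrow> real Matrix.vec"
  assumes "\<And>k. y k \<in> carrier_vec n" "y' \<in> carrier_vec n"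
    and "\<And>i. i < n \<Longrightarrow> (\<lambda>k. vec_index (x k) i) \<longlonglongrightarrow> vec_index x' i"
    and "\<And>i. i < n \<Longrightarrow> (\<lambda>k. vec_index (y k) i) \<longlonglongrightarrow> vec_index y' i"
  shows "(\<lambda>k. scalar_prod (x k) (y k)) \<longlonglongrightarrow> scalar_prod x' y'"
  unfolding scalar_prod_eq_sum[OF assms(1)] scalar_prod_eq_sum[OF assms(2)]
  using assms(3,4) by (intro tendsto_sum tendsto_mult) auto

lemma tendsto_mult_mat_vec:
  fixes x :: "nat \<Rightarrow> real Matrix.vec"
  assumes "\<And>k. x k \<in> carrier_vec n" "x' \<in> carrier_vec n" "\<And>k. A k \<in> carrier_mat m n" "A' \<in> carrier_mat m n"
    and "\<And>i. i < n \<Longrightarrow> (\<lambda>k. vec_index (x k) i) \<longlonglongrightarrow> vec_index x' i"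
    and "\<And>i j. i < m \<Longrightarrow> j < n \<Longrightarrow> (\<lambda>k. A k $$ (i, j)) \<longlonglongrightarrow> A' $$ (i, j)"
    and "i < m"
  shows "(\<lambda>k. vec_index (A k *\<^sub>v x k) i) \<longlonglongrightarrow> vec_index (A' *\<^sub>v x') i"
proof -
  have "(\<lambda>k. scalar_prod (row (A k) i) (x k)) \<longlonglongrightarrow> scalar_prod (row A' i) x'"
  proof (intro tendsto_scalar_prod[of _ n])
    have "dim_row (A k) = m" "dim_col (A k) = n" "dim_row A' = m" "dim_col A' = n" for k
      using assms(3)[of k] assms(4) by auto
    then show "(\<lambda>k. vec_index (row (A k) i) j) \<longlonglongrightarrow> vec_index (row A' i) j" if "j < n" for j
      using assms(6,7) that by simp
  qed (use assms in auto)
  moreover have "dim_row (A k) = m" for k using assms(3)[of k] by auto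
  ultimately show ?thesis using assms(4,7) by simp
qed

lemma bounded_vec_subseq:
  fixes x :: "nat \<Rightarrow> real Matrix.vec"
  assumes "\<And>k i. i < n \<Longrightarrow> \<bar>vec_index (x k) i\<bar> \<le> B"
  obtains l r where "l \<in> carrier_vec n" "strict_mono (r :: nat \<Rightarrow> nat)"
    "\<And>i. i < n \<Longrightarrow> (\<lambda>k. vec_index (x (r k)) i) \<longlonglongrightarrow> vec_index l i"
proof -
  have b: "\<bar>vec_index (x k) i\<bar> \<le> B" if "i \<in> {..<n}" for k i using assms that by simp
  obtain l r where r: "strict_mono (r :: nat \<Rightarrow> nat)"
    and l: "\<And>i. i \<in> {..<n} \<Longrightarrow> (\<lambda>k. vec_index (x (r k)) i) \<longlonglongrightarrow> l i"
    using bounded_coordinates_subseq[where f = "\<lambda>k. vec_index (x k)", OF finite_lessThan b] by blast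
  show thesis
    by (rule that[of "Matrix.vec n l" r]) (use l r in auto)
qed

lemma bounded_mat_subseq:
  fixes X :: "nat \<Rightarrow> real Matrix.mat"
  assumes "\<And>k i j. i < m \<Longrightarrow> j < n \<Longrightarrow> \<bar>X k $$ (i, j)\<bar> \<le> B"
  shows "\<exists>L r. L \<in> carrier_mat m n \<and> strict_mono (r :: nat \<Rightarrow> nat) \<and>
    (\<forall>i<m. \<forall>j<n. (\<lambda>k. X (r k) $$ (i, j)) \<longlonglongrightarrow> L $$ (i, j))"
proof -
  have b: "\<bar>X k $$ i\<bar> \<le> B" if "i \<in> {..<m} \<times> {..<n}" for k i using assms that by auto
  obtain l r where "strict_mono (r :: nat \<Rightarrow> nat)"
    and "\<And>i. i \<in> {..<m} \<times> {..<n} \<Longrightarrow> (\<lambda>k. X (r k) $$ i) \<longlonglongrightarrow> l i"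
    using bounded_coordinates_subseq[where f = "\<lambda>k i. X k $$ i", OF finite_cartesian_product[OF finite_lessThan finite_lessThan] b]
    by blast
  then show ?thesis
    by (intro exI[of _ "Matrix.mat m n l"] exI[of _ r]) auto
qed

subsection \<open>The spectral theorem\<close>

lemma sym_mats_scalar_prod_swap:
  assumes "A \<in> sym_mats n" "x \<in> carrier_vec n" "y \<in> carrier_vec n"
  shows "scalar_prod x (A *\<^sub>v y) = scalar_prod y (A *\<^sub>v x)"
proof -
  have A: "A \<in> carrier_mat n n" "transpose_mat A = A" using assms(1) by (auto simp: sym_mats_def)
  have "scalar_prod x (A *\<^sub>v y) = scalar_prod (A *\<^sub>v y) x"
    using assms A by (intro comm_scalar_prod[of _ n]) auto
  also have "\<dots> = scalar_prod y (A *\<^sub>v x)"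
    using transpose_vec_mult_scalar[of A n n x y] assms A by simp
  finally show ?thesis .
qed

lemma nonneg_quadratic_linear_coeff_zero:
  fixes b c :: real
  assumes "\<And>t. 0 \<le> 2 * t * b + t\<^sup>2 * c"
  shows "b = 0"
proof (rule ccontr)
  assume b: "b \<noteq> 0"
  \<comment> \<open>At \<open>t = - b / m\<close> the linear term contributes
    \<open>- 2 * b\<^sup>2 / m\<close>, which outweighs the quadratic one because
    \<open>c < m\<close>.\<close>
  define m where "m = \<bar>c\<bar> + 1"
  have m: "m > 0" "c < m" by (auto simp: m_def)
  have "0 \<le> 2 * (- b / m) * b + (- b / m)\<^sup>2 * c" by (rule assms)
  also have "\<dots> = b\<^sup>2 / m\<^sup>2 * (c - 2 * m)"
    using m by (simp add: field_simps power2_eq_square)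
  finally have "0 \<le> b\<^sup>2 / m\<^sup>2 * (c - 2 * m)" .
  moreover have "b\<^sup>2 / m\<^sup>2 * (c - 2 * m) < 0" using b m by (intro mult_pos_neg) auto
  ultimately show False by simp
qed

text \<open>Taken as rows and padded with zero rows, the vectors form a square matrix whose row
  \<open>k\<close> vanishes. It is singular, and a kernel vector is orthogonal to all of
  them.\<close>

lemma exists_orthogonal_vec:
  fixes u :: "nat \<Rightarrow> real Matrix.vec"
  assumes "k < n" "\<And>i. i < k \<Longrightarrow> u i \<in> carrier_vec n"
  obtains v where "v \<in> carrier_vec n" "v \<noteq> 0\<^sub>v n" "\<And>i. i < k \<Longrightarrow> scalar_prod (u i) v = 0"
proof -
  define M where "M = mat_of_rows n (map (\<lambda>i. if i < k then u i else 0\<^sub>v n) [0..<n])"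
  have M: "M \<in> carrier_mat n n" unfolding M_def by (rule carrier_matI) auto
  have row: "row M i = (if i < k then u i else 0\<^sub>v n)" if "i < n" for i
    using that assms by (auto simp: M_def)
  have "transpose_mat M *\<^sub>v unit_vec n k = 0\<^sub>v n"
  proof (rule eq_vecI)
    fix i assume i: "i < dim_vec (0\<^sub>v n :: real Matrix.vec)"
    then have "vec_index (row M k) i = 0" using row[OF assms(1)] by simp
    then show "vec_index (transpose_mat M *\<^sub>v unit_vec n k) i = vec_index (0\<^sub>v n) i"
      using M assms(1) i by simp
  qed (use M in simp)
  moreover have "unit_vec n k \<noteq> (0\<^sub>v n :: real Matrix.vec)"
    using arg_cong[of "unit_vec n k" "0\<^sub>v n :: real Matrix.vec" "\<lambda>v. vec_index v k"] assms(1) by auto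
  ultimately have "det (transpose_mat M) = 0"
    using det_0_iff_vec_prod_zero[of "transpose_mat M" n] M unit_vec_carrier[of n k] by fastforce
  then obtain v where v: "v \<in> carrier_vec n" "v \<noteq> 0\<^sub>v n" "M *\<^sub>v v = 0\<^sub>v n"
    using det_transpose[OF M] det_0_iff_vec_prod_zero[OF M] by auto
  have "scalar_prod (u i) v = 0" if "i < k" for i
  proof -
    have "vec_index (M *\<^sub>v v) i = 0" using v(3) that assms(1) by simp
    then show ?thesis using M that assms(1) row[of i] by simp
  qed
  with v show thesis by (intro that)
qed

text \<open>The eigenvector minimizes the Rayleigh quotient over the unit vectors orthogonal to
  the given eigenvectors.\<close>

lemma exists_orthogonal_eigenvector:
  assumes A: "A \<in> sym_mats n" and k: "k < n"
    and u: "\<And>i. i < k \<Longrightarrow> u i \<in> carrier_vec n" "\<And>i. i < k \<Longrightarrow> A *\<^sub>v u i = d i \<cdot>\<^sub>v u i"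
  obtains w \<mu> where "w \<in> carrier_vec n" "scalar_prod w w = 1" "A *\<^sub>v w = \<mu> \<cdot>\<^sub>v w"
    "\<And>i. i < k \<Longrightarrow> scalar_prod (u i) w = 0"
proof -
  have Ac: "A \<in> carrier_mat n n" using A by (rule sym_mats_carrier)
  define W where "W = {w \<in> carrier_vec n. \<forall>i<k. scalar_prod (u i) w = 0}"
  define q where "q w = scalar_prod w (A *\<^sub>v w)" for w
  have W_smult: "r \<cdot>\<^sub>v w \<in> W" if "w \<in> W" for r w
    using that u(1) by (auto simp: W_def)
  have W_add: "v + w \<in> W" if "v \<in> W" "w \<in> W" for v w
    using that u(1) by (auto simp: W_def scalar_prod_add_distrib[of _ n])
  have W_diff: "v - w \<in> W" if "v \<in> W" "w \<in> W" for v w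
    using that u(1) by (auto simp: W_def scalar_prod_minus_distrib[of _ n])
  \<comment> \<open>Symmetry moves \<open>A\<close> onto the eigenvector \<open>u i\<close>, so the
    orthogonal complement is invariant.\<close>
  have W_A: "A *\<^sub>v w \<in> W" if "w \<in> W" for w
  proof -
    have wc: "w \<in> carrier_vec n" using that by (simp add: W_def)
    have "scalar_prod (u i) (A *\<^sub>v w) = 0" if i: "i < k" for i
      using sym_mats_scalar_prod_swap[OF A u(1)[OF i] wc] u[OF i] wc i \<open>w \<in> W\<close>
        comm_scalar_prod[OF wc u(1)[OF i]] by (simp add: W_def)
    then show ?thesis using wc Ac by (simp add: W_def)
  qed
  have q_smult: "q (r \<cdot>\<^sub>v w) = r\<^sup>2 * q w" if "w \<in> W" for r w
    using that Ac by (auto simp: q_def W_def mult_mat_vec power2_eq_square)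
  define S where "S = {w \<in> W. scalar_prod w w = 1}"
  have normalize: "(1 / sqrt (scalar_prod w w)) \<cdot>\<^sub>v w \<in> S" and pos: "scalar_prod w w > 0"
    if w: "w \<in> W" "w \<noteq> 0\<^sub>v n" for w
  proof -
    have wc: "w \<in> carrier_vec n" using w by (simp add: W_def)
    have "scalar_prod w w \<noteq> 0" using w scalar_prod_self_zero[OF wc] by auto
    then show p: "scalar_prod w w > 0" using vec.ip_ge0[OF wc] by simp
    show "(1 / sqrt (scalar_prod w w)) \<cdot>\<^sub>v w \<in> S"
      using W_smult[OF w(1)] p wc by (simp add: S_def)
  qed
  have "S \<noteq> {}"
  proof -
    obtain v where "v \<in> carrier_vec n" "v \<noteq> 0\<^sub>v n" "\<And>i. i < k \<Longrightarrow> scalar_prod (u i) v = 0"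
      using exists_orthogonal_vec[OF k] u(1) by blast
    then show ?thesis using normalize[of v] by (auto simp: W_def)
  qed
  then have "\<exists>w\<in>S. \<forall>x\<in>S. q w \<le> q x"
  proof (rule sequentially_compact_attains_inf[where F = q])
    fix xs :: "nat \<Rightarrow> real Matrix.vec" assume xs: "\<And>k. xs k \<in> S"
    then have xc: "\<And>k. xs k \<in> carrier_vec n" by (simp add: S_def W_def)
    have "\<bar>vec_index (xs k) i\<bar> \<le> 1" if "i < n" for k i
      using vec_index_square_le[OF xc that, of k] xs[of k] by (simp add: S_def abs_square_le_1)
    then obtain l r where l: "l \<in> carrier_vec n" "strict_mono (r :: nat \<Rightarrow> nat)"
      and lim: "\<And>i. i < n \<Longrightarrow> (\<lambda>k. vec_index (xs (r k)) i) \<longlonglongrightarrow> vec_index l i"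
      using bounded_vec_subseq[of n xs 1] by blast
    have "(\<lambda>k. scalar_prod (xs (r k)) (xs (r k))) \<longlonglongrightarrow> scalar_prod l l"
      using l xc lim by (intro tendsto_scalar_prod[of _ n])
    moreover have "scalar_prod (xs (r k)) (xs (r k)) = 1" for k using xs by (simp add: S_def)
    ultimately have "scalar_prod l l = 1" by (simp add: LIMSEQ_const_iff)
    moreover have "scalar_prod (u i) l = 0" if "i < k" for i
    proof -
      have "(\<lambda>k. scalar_prod (u i) (xs (r k))) \<longlonglongrightarrow> scalar_prod (u i) l"
        using l xc lim by (intro tendsto_scalar_prod[of _ n]) auto
      moreover have "scalar_prod (u i) (xs (r k)) = 0" for k
        using xs[of "r k"] that by (simp add: S_def W_def)
      ultimately show ?thesis by (simp add: LIMSEQ_const_iff)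
    qed
    ultimately have "l \<in> S" using l by (simp add: S_def W_def)
    moreover have "(\<lambda>k. q (xs (r k))) \<longlonglongrightarrow> q l"
      unfolding q_def using l xc lim Ac
      by (intro tendsto_scalar_prod[of _ n] tendsto_mult_mat_vec[of _ n]) auto
    ultimately show "\<exists>l\<in>S. \<exists>r. strict_mono (r :: nat \<Rightarrow> nat) \<and> (\<lambda>k. q (xs (r k))) \<longlonglongrightarrow> q l"
      using l(2) by blast
  qed
  then obtain w where w: "w \<in> S" and min: "\<And>x. x \<in> S \<Longrightarrow> q w \<le> q x" by blast
  have wW: "w \<in> W" and ww: "scalar_prod w w = 1" using w by (auto simp: S_def)
  have q_ge: "q w * scalar_prod x x \<le> q x" if x: "x \<in> W" for x
  proof (cases "x = 0\<^sub>v n")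
    case True
    then show ?thesis using Ac by (simp add: q_def)
  next
    case False
    note p = pos[OF x False]
    have "q w \<le> q x / scalar_prod x x"
      using min[OF normalize[OF x False]] q_smult[OF x] p by (simp add: power_divide)
    then show ?thesis using p by (simp add: field_simps)
  qed
  \<comment> \<open>The eigenvalue residual lies in \<open>W\<close> and is therefore an admissible
    variation of \<open>w\<close>. Along it the first-order coefficient of the Rayleigh inequality
    is \<open>scalar_prod r r\<close>, so minimality forces it to vanish.\<close>
  define r where "r = A *\<^sub>v w - q w \<cdot>\<^sub>v w"
  have rW: "r \<in> W" unfolding r_def using W_diff W_A W_smult wW by blast
  have c: "w \<in> carrier_vec n" "r \<in> carrier_vec n" using wW rW by (auto simp: W_def)
  have rr: "scalar_prod r r = scalar_prod r (A *\<^sub>v w) - q w * scalar_prod r w"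
    using c Ac unfolding r_def by (simp add: scalar_prod_minus_distrib[of _ n])
  have "0 \<le> 2 * t * scalar_prod r r + t\<^sup>2 * (q r - q w * scalar_prod r r)" for t
  proof -
    have "q (w + t \<cdot>\<^sub>v r) = q w + 2 * t * scalar_prod r (A *\<^sub>v w) + t\<^sup>2 * q r"
      using c Ac sym_mats_scalar_prod_swap[OF A c]
      by (simp add: q_def mult_add_distrib_mat_vec[of _ n n] mult_mat_vec[of _ n n]
          add_scalar_prod_distrib[of _ n] scalar_prod_add_distrib[of _ n] power2_eq_square
          algebra_simps)
    moreover have "scalar_prod (w + t \<cdot>\<^sub>v r) (w + t \<cdot>\<^sub>v r)
        = 1 + 2 * t * scalar_prod r w + t\<^sup>2 * scalar_prod r r"
      using c ww comm_scalar_prod[OF c]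
      by (simp add: add_scalar_prod_distrib[of _ n] scalar_prod_add_distrib[of _ n]
          power2_eq_square algebra_simps)
    ultimately have "q w * (1 + 2 * t * scalar_prod r w + t\<^sup>2 * scalar_prod r r)
        \<le> q w + 2 * t * scalar_prod r (A *\<^sub>v w) + t\<^sup>2 * q r"
      using q_ge[OF W_add[OF wW W_smult[OF rW]], of t] by simp
    moreover have "2 * t * scalar_prod r r
        = 2 * t * scalar_prod r (A *\<^sub>v w) - 2 * t * (q w * scalar_prod r w)"
      by (simp only: rr right_diff_distrib)
    ultimately show ?thesis by (simp add: algebra_simps)
  qed
  then have "scalar_prod r r = 0" by (rule nonneg_quadratic_linear_coeff_zero)
  then have "A *\<^sub>v w = q w \<cdot>\<^sub>v w"
    using c Ac unfolding r_def by (intro vec.ip_diff_eq0[of _ n]) auto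
  then show thesis using wW ww by (intro that) (auto simp: W_def)
qed

lemma orthonormal_eigenvectors:
  assumes A: "A \<in> sym_mats n" and "k \<le> n"
  shows "\<exists>u d. \<forall>i<k. u i \<in> carrier_vec n \<and> A *\<^sub>v u i = d i \<cdot>\<^sub>v u i \<and>
    (\<forall>j<k. scalar_prod (u i) (u j) = (if i = j then 1 else 0 :: real))"
  using assms(2)
proof (induction k)
  case (Suc k)
  then obtain u d where IH: "\<And>i. i < k \<Longrightarrow> u i \<in> carrier_vec n"
    "\<And>i. i < k \<Longrightarrow> A *\<^sub>v u i = d i \<cdot>\<^sub>v u i"
    "\<And>i j. i < k \<Longrightarrow> j < k \<Longrightarrow> scalar_prod (u i) (u j) = (if i = j then 1 else 0)"
    by auto
  from Suc.prems have "k < n" by simp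
  then obtain w \<mu> where w: "w \<in> carrier_vec n" "scalar_prod w w = 1" "A *\<^sub>v w = \<mu> \<cdot>\<^sub>v w"
    "\<And>i. i < k \<Longrightarrow> scalar_prod (u i) w = 0"
    using exists_orthogonal_eigenvector[OF A, of k u d] IH(1,2) by blast
  have wu: "scalar_prod w (u i) = 0" if "i < k" for i
    using w(4)[OF that] comm_scalar_prod[OF w(1) IH(1)[OF that]] by simp
  then show ?case
  proof (intro exI[of _ "u(k := w)"] exI[of _ "d(k := \<mu>)"] allI impI conjI)
    fix i assume i: "i < Suc k"
    show "(u(k := w)) i \<in> carrier_vec n" using i IH(1)[of i] w(1) by auto
    show "A *\<^sub>v (u(k := w)) i = (d(k := \<mu>)) i \<cdot>\<^sub>v (u(k := w)) i" using i IH(2)[of i] w(3) by auto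
    fix j assume j: "j < Suc k"
    show "scalar_prod ((u(k := w)) i) ((u(k := w)) j) = (if i = j then 1 else 0)"
      using i j IH(3)[of i j] w(2) w(4)[of i] wu[of j]
      by (cases "i = k"; cases "j = k") auto
  qed
qed simp

text \<open>Stated through what the optimization uses. For \<open>X\<close> in the spectrahedron the
  numbers \<open>scalar_prod (u i) (X *\<^sub>v u i)\<close> are nonnegative weights with sum 1, so
  \<open>trace_inner A X\<close> is an average of the eigenvalues \<open>d i\<close>. The equation
  for \<open>proots\<close> links the \<open>d i\<close>, with multiplicity, to
  \<open>eigval\<close>.\<close>

lemma spectral_theorem:
  assumes A: "A \<in> sym_mats n"
  shows "\<exists>u d. (\<forall>i<n. u i \<in> carrier_vec n \<and> scalar_prod (u i) (u i) = 1 \<and> A *\<^sub>v u i = d i \<cdot>\<^sub>v u i) \<and>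
    proots (char_poly A) = mset (map d [0..<n]) \<and>
    (\<forall>X\<in>carrier_mat n n. mtrace X = (\<Sum>i<n. scalar_prod (u i) (X *\<^sub>v u i)) \<and>
      trace_inner A X = (\<Sum>i<n. d i * scalar_prod (u i) (X *\<^sub>v u i)))"
proof -
  have Ac: "A \<in> carrier_mat n n" "transpose_mat A = A" using A by (auto simp: sym_mats_def)
  obtain u d where u: "\<And>i. i < n \<Longrightarrow> u i \<in> carrier_vec n"
    "\<And>i. i < n \<Longrightarrow> A *\<^sub>v u i = d i \<cdot>\<^sub>v u i"
    "\<And>i j. i < n \<Longrightarrow> j < n \<Longrightarrow> scalar_prod (u i) (u j) = (if i = j then 1 else 0)"
    using orthonormal_eigenvectors[OF A order_refl] by auto
  define U where "U = mat_of_cols n (map u [0..<n])"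
  define D where "D = Matrix.mat n n (\<lambda>(i, j). if i = j then d i else 0)"
  have U: "U \<in> carrier_mat n n" unfolding U_def by (rule carrier_matI) auto
  have D: "D \<in> carrier_mat n n" by (simp add: D_def)
  have col: "col U i = u i" if "i < n" for i using that u(1) by (simp add: U_def)
  have UU: "transpose_mat U * U = 1\<^sub>m n"
    using U u(3) by (intro eq_matI) (auto simp: col)
  then have UU': "U * transpose_mat U = 1\<^sub>m n"
    using U mat_mult_left_right_inverse[of "transpose_mat U" n U] by simp
  have entry: "(transpose_mat U * (X * U)) $$ (i, i) = scalar_prod (u i) (X *\<^sub>v u i)"
    if "X \<in> carrier_mat n n" "i < n" for X i
    using that U by (simp add: col col_mult2[of _ n n] mult_mat_vec_def)
  have tr: "mtrace X = (\<Sum>i<n. scalar_prod (u i) (X *\<^sub>v u i))" if X: "X \<in> carrier_mat n n" for X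
  proof -
    have "mtrace X = mtrace (X * U * transpose_mat U)"
      using X U UU' by (simp add: assoc_mult_mat[of _ n n _ n _ n])
    also have "\<dots> = mtrace (transpose_mat U * (X * U))"
      using X U by (intro mtrace_mult_commute[of _ n n]) auto
    also have "\<dots> = (\<Sum>i<n. scalar_prod (u i) (X *\<^sub>v u i))"
      using X U entry[OF X] by (simp add: mtrace_def)
    finally show ?thesis .
  qed
  moreover have "trace_inner A X = (\<Sum>i<n. d i * scalar_prod (u i) (X *\<^sub>v u i))"
    if X: "X \<in> carrier_mat n n" for X
  proof -
    have "trace_inner A X = mtrace (X * A)"
      using X Ac mtrace_mult_commute[of A n n X] by (simp add: trace_inner_def)
    also have "\<dots> = (\<Sum>i<n. scalar_prod (u i) ((X * A) *\<^sub>v u i))" using X Ac by (intro tr) auto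
    also have "\<dots> = (\<Sum>i<n. d i * scalar_prod (u i) (X *\<^sub>v u i))"
      using X Ac u by (intro sum.cong) (auto simp: assoc_mult_mat_vec[of _ n n _ n] mult_mat_vec[of _ n n])
    finally show ?thesis .
  qed
  moreover have "proots (char_poly A) = mset (map d [0..<n])"
  proof -
    \<comment> \<open>Column by column this is the eigenvector equation. With \<open>U\<close>
      orthogonal it makes \<open>A\<close> similar to the diagonal \<open>D\<close>, whose
      characteristic polynomial is already factored.\<close>
    have "A * U = U * D"
    proof (rule eq_matI)
      show "dim_row (A * U) = dim_row (U * D)" "dim_col (A * U) = dim_col (U * D)"
        using Ac U D by auto
      fix i j assume "i < dim_row (U * D)" "j < dim_col (U * D)"
      then have ij: "i < n" "j < n" using U D by auto
      have "(U * D) $$ (i, j) = (\<Sum>l<n. U $$ (i, l) * (if l = j then d l else 0))"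
        using U ij by (simp add: D_def scalar_prod_eq_sum[of _ n])
      also have "\<dots> = (\<Sum>l<n. if l = j then d l * U $$ (i, l) else 0)" by (intro sum.cong) auto
      also have "\<dots> = d j * U $$ (i, j)" using ij by simp
      also have "\<dots> = vec_index (A *\<^sub>v u j) i"
        using ij u(1)[OF ij(2)] u(2)[OF ij(2)] U
        by (simp add: U_def mat_of_cols_index)
      finally show "(A * U) $$ (i, j) = (U * D) $$ (i, j)" using ij Ac U by (simp add: col)
    qed
    then have "A = U * D * transpose_mat U"
      using assoc_mult_mat[OF Ac(1) U transpose_carrier_mat[THEN iffD2, OF U]] UU' Ac by simp
    then have "similar_mat_wit A D U (transpose_mat U)"
      using UU UU' Ac U D by (intro similar_mat_witI) auto
    then have "char_poly A = char_poly D"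
      by (intro char_poly_similar) (auto simp: similar_mat_def)
    also have "\<dots> = (\<Prod>a\<leftarrow>diag_mat D. [:- a, 1:])"
      by (rule char_poly_upper_triangular[OF D]) (auto simp: D_def)
    also have "diag_mat D = map d [0..<n]" by (auto simp: diag_mat_def D_def)
    finally have cp: "char_poly A = (\<Prod>a\<leftarrow>map d [0..<n]. [:- a, 1:])" .
    have "proots (\<Prod>a\<leftarrow>as. [:- a, 1:]) = mset as" for as :: "real list"
    proof (induction as)
      case (Cons a as)
      have "(\<Prod>a\<leftarrow>as. [:- a, 1:]) \<noteq> (0 :: real poly)" by (auto simp: prod_list_zero_iff)
      then show ?case using Cons by (simp add: proots_mult del: mult_pCons_left)
    qed simp
    then show ?thesis unfolding cp .
  qed
  ultimately show ?thesis using u by (intro exI[of _ u] exI[of _ d]) auto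
qed

subsection \<open>The spectrahedron\<close>

lemma outer_sym: "v \<in> carrier_vec n \<Longrightarrow> outer v \<in> sym_mats n"
  by (auto simp: outer_def mult.commute intro!: sym_matsI)

lemma trace_inner_outer:
  assumes "X \<in> carrier_mat n n" "v \<in> carrier_vec n"
  shows "trace_inner X (outer v) = scalar_prod v (X *\<^sub>v v)"
proof -
  have "trace_inner X (outer v) = (\<Sum>i<n. \<Sum>j<n. X $$ (i, j) * (vec_index v i * vec_index v j))"
    using assms by (subst trace_inner_eq_sum[of _ n]) (auto simp: outer_def)
  also have "\<dots> = scalar_prod v (X *\<^sub>v v)"
    using assms by (simp add: scalar_prod_eq_sum[of _ n] sum_distrib_left mult_ac)
  finally show ?thesis .
qed

lemma spectrahedronD:
  assumes "X \<in> spectrahedron n"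
  shows "X \<in> sym_mats n" "X \<in> carrier_mat n n" "mtrace X = 1"
    "v \<in> carrier_vec n \<Longrightarrow> 0 \<le> scalar_prod v (X *\<^sub>v v)"
  using assms by (auto simp: spectrahedron_def psd_def dest: sym_mats_carrier)

lemma spectrahedronI:
  assumes "X \<in> sym_mats n" "mtrace X = 1" "\<And>v. v \<in> carrier_vec n \<Longrightarrow> 0 \<le> scalar_prod v (X *\<^sub>v v)"
  shows "X \<in> spectrahedron n"
  using assms sym_mats_carrier[OF assms(1)] by (auto simp: spectrahedron_def psd_def)

lemma outer_mult_vec:
  assumes "v \<in> carrier_vec n" "w \<in> carrier_vec n"
  shows "outer v *\<^sub>v w = scalar_prod v w \<cdot>\<^sub>v v"
  using assms by (intro eq_vecI)
    (auto simp: outer_def scalar_prod_def sum_distrib_left sum_distrib_right mult_ac intro!: sum.cong)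

lemma outer_spectrahedron:
  assumes "v \<in> carrier_vec n" "scalar_prod v v = 1"
  shows "outer v \<in> spectrahedron n"
proof (rule spectrahedronI)
  show "outer v \<in> sym_mats n" using assms by (simp add: outer_sym)
  show "mtrace (outer v) = 1"
    using assms by (simp add: mtrace_def outer_def scalar_prod_eq_sum[of _ n])
  show "0 \<le> scalar_prod w (outer v *\<^sub>v w)" if "w \<in> carrier_vec n" for w
    using that assms comm_scalar_prod[OF that assms(1)] by (simp add: outer_mult_vec)
qed

lemma spectrahedron_convex:
  assumes "X \<in> spectrahedron n" "Y \<in> spectrahedron n" "0 \<le> s" "s \<le> 1"
  shows "(1 - s) \<cdot>\<^sub>m X + s \<cdot>\<^sub>m Y \<in> spectrahedron n"
proof (rule spectrahedronI)
  note X = spectrahedronD[OF assms(1)] and Y = spectrahedronD[OF assms(2)]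
  show "(1 - s) \<cdot>\<^sub>m X + s \<cdot>\<^sub>m Y \<in> sym_mats n" using X Y by (simp add: mat.closed)
  show "mtrace ((1 - s) \<cdot>\<^sub>m X + s \<cdot>\<^sub>m Y) = 1"
    using X Y by (simp add: mtrace_add[of _ n] mtrace_smult[of _ n])
  fix v :: "real Matrix.vec" assume v: "v \<in> carrier_vec n"
  \<comment> \<open>As an inner product with \<open>outer v\<close>, the quadratic form is linear in
    the matrix.\<close>
  have "scalar_prod v (((1 - s) \<cdot>\<^sub>m X + s \<cdot>\<^sub>m Y) *\<^sub>v v)
      = (1 - s) * scalar_prod v (X *\<^sub>v v) + s * scalar_prod v (Y *\<^sub>v v)"
    using X(1,2) Y(1,2) v outer_sym[OF v]
    by (simp add: trace_inner_outer[of _ n, symmetric] mat.ip_simps[of _ n] mat.closed)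
  then show "0 \<le> scalar_prod v (((1 - s) \<cdot>\<^sub>m X + s \<cdot>\<^sub>m Y) *\<^sub>v v)"
    using X(4)[OF v] Y(4)[OF v] assms(3,4) by simp
qed

text \<open>The eigenvalues lie in [0, 1] and sum to 1, so their squares sum to at most 1.\<close>

lemma spectrahedron_inner_self_le_1:
  assumes X: "X \<in> spectrahedron n"
  shows "trace_inner X X \<le> 1"
proof -
  note XD = spectrahedronD[OF X]
  obtain u d where u: "\<And>i. i < n \<Longrightarrow> u i \<in> carrier_vec n"
    "\<And>i. i < n \<Longrightarrow> scalar_prod (u i) (u i) = 1"
    "\<And>i. i < n \<Longrightarrow> X *\<^sub>v u i = d i \<cdot>\<^sub>v u i"
    and roots: "proots (char_poly X) = mset (map d [0..<n])"
    and tr: "\<And>Y. Y \<in> carrier_mat n n \<Longrightarrow> mtrace Y = (\<Sum>i<n. scalar_prod (u i) (Y *\<^sub>v u i))"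
    and inner: "\<And>Y. Y \<in> carrier_mat n n \<Longrightarrow>
      trace_inner X Y = (\<Sum>i<n. d i * scalar_prod (u i) (Y *\<^sub>v u i))"
    using spectral_theorem[OF XD(1)] by auto
  have d: "scalar_prod (u i) (X *\<^sub>v u i) = d i" if "i < n" for i using u that by simp
  have d0: "0 \<le> d i" if "i < n" for i using d[OF that] XD(4)[OF u(1)[OF that]] by simp
  have sum1: "(\<Sum>i<n. d i) = 1" using tr[OF XD(2)] XD(3) d by simp
  have "d i \<le> 1" if "i < n" for i
    using that d0 sum1 member_le_sum[of i "{..<n}" d] by simp
  then have "(\<Sum>i<n. d i * d i) \<le> (\<Sum>i<n. d i)"
    using d0 by (intro sum_mono) (simp add: mult_left_le)
  then show ?thesis using inner[OF XD(2)] d sum1 by simp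
qed

text \<open>Translates the sorted-list encoding of \<open>eigval\<close> into one smallest root and
  the remaining ones. Only a single copy of \<open>m\<close> is split off: a repeated minimum stays
  in \<open>M\<close> and makes the gap zero.\<close>

lemma mset_proots_min_first:
  assumes "proots (char_poly B) = add_mset (m :: real) M" "\<And>x. x \<in># M \<Longrightarrow> m \<le> x" "size M = n - 1" "2 \<le> n"
  shows "eigval B n = m" "\<And>x. x \<in># M \<Longrightarrow> eigval B (n - 1) \<le> x"
proof -
  define l where "l = sorted_list_of_multiset M"
  have l: "length l = n - 1" "sorted l" "set l = set_mset M"
    using assms(3) by (auto simp: l_def simp flip: size_mset)
  have "sorted_list_of_multiset (proots (char_poly B)) = insort m l"
    by (simp add: assms(1) l_def)
  also have "insort m l = m # l" using l assms(2) by (intro insort_is_Cons) auto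
  finally have s: "sorted_list_of_multiset (proots (char_poly B)) = m # l" .
  show "eigval B n = m" using l assms(4) unfolding eigval_def s by (simp add: nth_append)
  fix x assume "x \<in># M"
  then obtain i where i: "i < n - 1" "x = l ! i" using l by (metis in_set_conv_nth)
  \<comment> \<open>\<open>eigval\<close> counts from 1, so this reads position \<open>n - 2\<close>
    of the reversed list, just before its last entry \<open>m\<close>.\<close>
  have "eigval B (n - 1) = l ! 0"
  proof -
    have "n - 2 < length (rev l)" using l assms(4) by simp
    then have "rev (m # l) ! (n - 2) = rev l ! (n - 2)" by (simp only: rev.simps nth_append if_True)
    also have "\<dots> = l ! 0" using l assms(4) by (simp add: rev_nth)
    finally show ?thesis unfolding eigval_def s by (simp add: numeral_2_eq_2)
  qed
  also have "\<dots> \<le> x" using l i sorted_nth_mono[of l 0 i] by simp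
  finally show "eigval B (n - 1) \<le> x" .
qed

section \<open>Extremal values of linear functionals on the spectrahedron\<close>

lemma eigval_1_ge:
  assumes "x \<in># proots (char_poly B)"
  shows "x \<le> eigval B 1"
proof -
  define l where "l = sorted_list_of_multiset (proots (char_poly B))"
  have l: "sorted l" "x \<in> set l" using assms by (auto simp: l_def)
  then obtain i where i: "i < length l" "x = l ! i" by (metis in_set_conv_nth)
  have "eigval B 1 = l ! (length l - 1)"
    using i rev_nth[of 0 l] by (cases l) (simp_all add: eigval_def l_def[symmetric])
  then show ?thesis using i l sorted_nth_mono[of l i "length l - 1"] by simp
qed

text \<open>The left side averages eigenvalues of \<open>B\<close>, and the right side is the
  largest of them.\<close>

lemma trace_inner_le_top_eigenvector:
  assumes B: "B \<in> sym_mats n" and v: "v \<in> carrier_vec n" "scalar_prod v v = 1"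
    and ev: "B *\<^sub>v v = eigval B 1 \<cdot>\<^sub>v v" and X: "X \<in> spectrahedron n"
  shows "trace_inner B X \<le> trace_inner B (outer v)"
proof -
  note XD = spectrahedronD[OF X]
  obtain u d where u: "\<And>i. i < n \<Longrightarrow> u i \<in> carrier_vec n"
    "\<And>i. i < n \<Longrightarrow> scalar_prod (u i) (u i) = 1"
    "\<And>i. i < n \<Longrightarrow> B *\<^sub>v u i = d i \<cdot>\<^sub>v u i"
    and roots: "proots (char_poly B) = mset (map d [0..<n])"
    and tr: "\<And>X. X \<in> carrier_mat n n \<Longrightarrow> mtrace X = (\<Sum>i<n. scalar_prod (u i) (X *\<^sub>v u i))"
    and inner: "\<And>X. X \<in> carrier_mat n n \<Longrightarrow>
      trace_inner B X = (\<Sum>i<n. d i * scalar_prod (u i) (X *\<^sub>v u i))"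
    using spectral_theorem[OF B] by auto
  have "trace_inner B X \<le> (\<Sum>i<n. eigval B 1 * scalar_prod (u i) (X *\<^sub>v u i))"
    unfolding inner[OF XD(2)] using eigval_1_ge[of _ B] roots XD(4)[OF u(1)]
    by (intro sum_mono mult_right_mono) auto
  also have "\<dots> = eigval B 1" using tr[OF XD(2)] XD(3) by (simp flip: sum_distrib_left)
  also have "\<dots> = trace_inner B (outer v)"
    using trace_inner_outer[OF sym_mats_carrier[OF B] v(1)] v ev by simp
  finally show ?thesis .
qed

text \<open>In the eigenvalue average, the weight that \<open>X\<close> places off the bottom
  eigenvector \<open>w\<close> is \<open>1 - trace_inner (outer w) X\<close>, and each unit of it
  costs at least the gap.\<close>

lemma trace_inner_ge_bottom_eigenvector:
  assumes B: "B \<in> sym_mats n" and n: "2 \<le> n"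
  shows "\<exists>w\<in>carrier_vec n. scalar_prod w w = 1 \<and>
    (\<forall>X\<in>spectrahedron n. trace_inner B (outer w)
      + (eigval B (n - 1) - eigval B n) * (1 - trace_inner (outer w) X) \<le> trace_inner B X)"
proof -
  obtain u d where u: "\<And>i. i < n \<Longrightarrow> u i \<in> carrier_vec n"
    "\<And>i. i < n \<Longrightarrow> scalar_prod (u i) (u i) = 1"
    "\<And>i. i < n \<Longrightarrow> B *\<^sub>v u i = d i \<cdot>\<^sub>v u i"
    and roots: "proots (char_poly B) = mset (map d [0..<n])"
    and tr: "\<And>X. X \<in> carrier_mat n n \<Longrightarrow> mtrace X = (\<Sum>i<n. scalar_prod (u i) (X *\<^sub>v u i))"
    and inner: "\<And>X. X \<in> carrier_mat n n \<Longrightarrow>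
      trace_inner B X = (\<Sum>i<n. d i * scalar_prod (u i) (X *\<^sub>v u i))"
    using spectral_theorem[OF B] by auto
  have "Min (d ` {..<n}) \<in> d ` {..<n}" using n by (intro Min_in) (auto simp: lessThan_empty_iff)
  then obtain k where k: "k < n" and "d k = Min (d ` {..<n})" by auto
  then have dk: "d k \<le> d i" if "i < n" for i using that by simp
  \<comment> \<open>One index is removed, not one value: other eigenvectors with the same minimal
    eigenvalue remain in \<open>M\<close>.\<close>
  define M where "M = image_mset d (mset_set ({..<n} - {k}))"
  have "proots (char_poly B) = image_mset d (mset_set {..<n})"
    by (simp add: roots lessThan_atLeast0 mset_map)
  also have "mset_set {..<n} = add_mset k (mset_set ({..<n} - {k}))"
    using k mset_set.remove[of "{..<n}" k] by simp
  finally have pM: "proots (char_poly B) = add_mset (d k) M" by (simp add: M_def)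
  have M: "\<And>x. x \<in># M \<Longrightarrow> d k \<le> x" "size M = n - 1" using dk k by (auto simp: M_def)
  note ev = mset_proots_min_first[OF pM M n]
  have ge: "eigval B (n - 1) \<le> d i" if "i < n" "i \<noteq> k" for i
    using that by (intro ev(2)) (auto simp: M_def)
  show ?thesis
  proof (intro bexI[of _ "u k"] conjI ballI)
    show "u k \<in> carrier_vec n" "scalar_prod (u k) (u k) = 1" using u k by auto
    fix X assume X: "X \<in> spectrahedron n"
    note XD = spectrahedronD[OF X]
    define w where "w i = scalar_prod (u i) (X *\<^sub>v u i)" for i
    have w0: "0 \<le> w i" if "i < n" for i using that u(1) XD(4) by (simp add: w_def)
    have split: "(\<Sum>i<n. h i) = h k + (\<Sum>i\<in>{..<n} - {k}. h i)" for h :: "nat \<Rightarrow> real"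
      using k by (simp add: sum.remove)
    have rest: "(\<Sum>i\<in>{..<n} - {k}. w i) = 1 - w k"
      using tr[OF XD(2)] XD(3) split[of w] by (simp add: w_def)
    have "eigval B (n - 1) * (1 - w k) = (\<Sum>i\<in>{..<n} - {k}. eigval B (n - 1) * w i)"
      by (simp flip: rest sum_distrib_left)
    also have "\<dots> \<le> (\<Sum>i\<in>{..<n} - {k}. d i * w i)"
      using ge w0 by (intro sum_mono mult_right_mono) auto
    also have "\<dots> = trace_inner B X - d k * w k"
      using inner[OF XD(2)] split[of "\<lambda>i. d i * w i"] by (simp add: w_def)
    finally have "eigval B (n - 1) * (1 - w k) + d k * w k \<le> trace_inner B X" by simp
    moreover have "trace_inner B (outer (u k)) = d k"
      using trace_inner_outer[OF sym_mats_carrier[OF B]] u k by simp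
    moreover have "trace_inner (outer (u k)) X = w k"
      using trace_inner_outer[OF XD(2)] u k mat.ip_commute[OF outer_sym XD(1)] by (simp add: w_def)
    ultimately show "trace_inner B (outer (u k))
      + (eigval B (n - 1) - eigval B n) * (1 - trace_inner (outer (u k)) X) \<le> trace_inner B X"
      using ev(1) by (simp add: algebra_simps)
  qed
qed

lemma vdist_square:
  assumes "x \<in> carrier_vec p" "y \<in> carrier_vec p"
  shows "(vdist p x y)\<^sup>2 = scalar_prod (x - y) (x - y)"
  using assms vec.ip_ge0[of "x - y" p] by (simp add: vdist_eq_vnorm vnorm_def)

lemma vec_combination_diff:
  fixes x y :: "real Matrix.vec"
  assumes "x \<in> carrier_vec p" "y \<in> carrier_vec p"
  shows "(1 - s) \<cdot>\<^sub>v x + s \<cdot>\<^sub>v y - x = s \<cdot>\<^sub>v (y - x)"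
  using assms by (intro eq_vecI) (auto simp: algebra_simps)

lemma mat_combination_diff:
  fixes X Y :: "real Matrix.mat"
  assumes "X \<in> carrier_mat n n" "Y \<in> carrier_mat n n"
  shows "(1 - s) \<cdot>\<^sub>m X + s \<cdot>\<^sub>m Y - X = s \<cdot>\<^sub>m (Y - X)"
  using assms by (intro eq_matI) (auto simp: algebra_simps)

subsection \<open>Smooth strongly convex functions\<close>

lemma smooth_has_gradient:
  assumes "smooth p \<beta> g" "x \<in> carrier_vec p"
  shows "has_gradient (carrier_vec p) scalar_prod g (vgrad p g x) x"
proof -
  obtain G where G: "has_gradient (carrier_vec p) scalar_prod g G x"
    using assms unfolding smooth_def by blast
  then show ?thesis using vec_gradient_unique[OF G assms(2)] by simp
qed

lemma smooth_vgrad_closed: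
  "smooth p \<beta> g \<Longrightarrow> x \<in> carrier_vec p \<Longrightarrow> vgrad p g x \<in> carrier_vec p"
  using smooth_has_gradient unfolding has_gradient_def by blast

lemma smooth_line_derivative:
  assumes g: "smooth p \<beta> g" and z: "z \<in> carrier_vec p" "d \<in> carrier_vec p"
  shows "((\<lambda>t. g (z + t \<cdot>\<^sub>v d)) has_real_derivative
    scalar_prod (vgrad p g (z + t \<cdot>\<^sub>v d)) d) (at t)"
proof -
  have eq: "z + t \<cdot>\<^sub>v d + s \<cdot>\<^sub>v d = z + (s + t) \<cdot>\<^sub>v d" for s
    using z by (intro eq_vecI) (auto simp: algebra_simps)
  have "((\<lambda>s. g (z + t \<cdot>\<^sub>v d + s \<cdot>\<^sub>v d)) has_real_derivative
      scalar_prod (vgrad p g (z + t \<cdot>\<^sub>v d)) d) (at 0)"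
    using z by (intro vec.has_gradient_deriv[OF smooth_has_gradient[OF g]]) (auto simp: eq)
  then show ?thesis using DERIV_shift[of "\<lambda>t. g (z + t \<cdot>\<^sub>v d)" _ 0 t] by (simp add: eq)
qed

text \<open>The descent lemma. \<open>\<psi>\<close> is \<open>g\<close> along the segment minus the
  linear and quadratic terms of the bound; Cauchy-Schwarz and the Lipschitz gradient make its
  derivative nonpositive.\<close>

lemma smooth_upper_bound:
  assumes g: "smooth p \<beta> g" and z: "z \<in> carrier_vec p" "d \<in> carrier_vec p"
  shows "g (z + d) \<le> g z + scalar_prod (vgrad p g z) d + \<beta> / 2 * scalar_prod d d"
proof -
  let ?G = "vgrad p g"
  define \<psi> where "\<psi> t = g (z + t \<cdot>\<^sub>v d) - t * scalar_prod (?G z) d - \<beta> / 2 * t\<^sup>2 * scalar_prod d d" for t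
  have "\<psi> 1 \<le> \<psi> 0"
  proof (rule DERIV_nonpos_imp_nonincreasing[of 0 1 \<psi>])
    fix t :: real assume t: "0 \<le> t" "t \<le> 1"
    let ?w = "z + t \<cdot>\<^sub>v d"
    have w: "?w \<in> carrier_vec p" using z by simp
    have c: "?G z \<in> carrier_vec p" "?G ?w \<in> carrier_vec p"
      using smooth_vgrad_closed[OF g] z w by auto
    have "?w - z = t \<cdot>\<^sub>v d" using z by (intro eq_vecI) auto
    then have dist: "vdist p ?w z = t * sqrt (scalar_prod d d)"
      using z w t vec.nrm_sm[OF z(2), of t] by (simp only: vdist_eq_vnorm vnorm_def abs_of_nonneg)
    have "scalar_prod (?G ?w - ?G z) d \<le> sqrt (scalar_prod (?G ?w - ?G z) (?G ?w - ?G z)) * sqrt (scalar_prod d d)"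
      using vec.Cauchy_Schwarz[of "?G ?w - ?G z" p d] c z by simp
    also have "sqrt (scalar_prod (?G ?w - ?G z) (?G ?w - ?G z)) = vdist p (?G ?w) (?G z)"
      using c by (simp add: vdist_eq_vnorm vnorm_def)
    also have "vdist p (?G ?w) (?G z) * sqrt (scalar_prod d d)
        \<le> (\<beta> * (t * sqrt (scalar_prod d d))) * sqrt (scalar_prod d d)"
      using g z(1) w vec.ip_ge0[OF z(2)] unfolding smooth_def dist[symmetric]
      by (intro mult_right_mono) auto
    also have "\<dots> = \<beta> * t * scalar_prod d d"
      using vec.ip_ge0[OF z(2)] by (simp add: mult.assoc)
    finally have le: "scalar_prod (?G ?w) d - scalar_prod (?G z) d - \<beta> * t * scalar_prod d d \<le> 0"
      using c z by (simp add: minus_scalar_prod_distrib[of _ p])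
    have "(\<psi> has_real_derivative
        scalar_prod (?G ?w) d - scalar_prod (?G z) d - \<beta> * t * scalar_prod d d) (at t)"
      unfolding \<psi>_def by (auto intro!: derivative_eq_intros smooth_line_derivative[OF g z])
    with le show "\<exists>y. (\<psi> has_real_derivative y) (at t) \<and> y \<le> 0" by blast
  qed simp
  moreover have "z + 0 \<cdot>\<^sub>v d = z" using z by (intro eq_vecI) auto
  ultimately show ?thesis by (simp add: \<psi>_def)
qed

text \<open>Divide the convexity inequality by \<open>u\<close> and let \<open>u\<close> tend to 0
  from the right, the only side on which it is available. The factor \<open>1 - u\<close> of the
  quadratic term disappears in the limit.\<close>

lemma strongly_convex_lower_bound:
  assumes g: "smooth p \<beta> g" and sc: "strongly_convex p \<alpha> g"
    and z: "z \<in> carrier_vec p" "d \<in> carrier_vec p"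
  shows "g z + scalar_prod (vgrad p g z) d + \<alpha> / 2 * scalar_prod d d \<le> g (z + d)"
proof -
  define \<phi> where "\<phi> t = g (z + t \<cdot>\<^sub>v d)" for t
  have z0: "z + 0 \<cdot>\<^sub>v d = z" using z by (intro eq_vecI) auto
  have "(\<phi> has_real_derivative scalar_prod (vgrad p g z) d) (at 0)"
    using smooth_line_derivative[OF g z, of 0] by (simp add: \<phi>_def[abs_def] z0)
  then have "((\<lambda>u. (\<phi> u - \<phi> 0) / (u - 0)) \<longlongrightarrow> scalar_prod (vgrad p g z) d) (at 0)"
    by (simp add: has_field_derivative_iff)
  then have lim: "((\<lambda>u. (\<phi> u - \<phi> 0) / u) \<longlongrightarrow> scalar_prod (vgrad p g z) d) (at_right 0)"
    by (auto intro: tendsto_mono[OF at_le])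
  have lim2: "((\<lambda>u. g (z + d) - g z - \<alpha> / 2 * (1 - u) * scalar_prod d d) \<longlongrightarrow>
      g (z + d) - g z - \<alpha> / 2 * (1 - 0) * scalar_prod d d) (at_right 0)"
    by (intro tendsto_intros)
  have "eventually (\<lambda>u::real. 0 < u \<and> u < 1) (at_right 0)"
    using eventually_at_right_less[of 0] eventually_at_right_field[of "\<lambda>u. u < 1" "0::real"]
    by (auto intro!: eventually_conj exI[of _ 1])
  then have ev: "eventually (\<lambda>u. (\<phi> u - \<phi> 0) / u
      \<le> g (z + d) - g z - \<alpha> / 2 * (1 - u) * scalar_prod d d) (at_right 0)"
  proof eventually_elim
    fix u :: real assume u: "0 < u \<and> u < 1"
    have zd: "z + d \<in> carrier_vec p" using z by simp
    have comb: "(1 - u) \<cdot>\<^sub>v z + u \<cdot>\<^sub>v (z + d) = z + u \<cdot>\<^sub>v d"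
      using z by (intro eq_vecI) (auto simp: algebra_simps)
    have "z - (z + d) = (-1) \<cdot>\<^sub>v d" using z by (intro eq_vecI) auto
    then have dist: "(vdist p z (z + d))\<^sup>2 = scalar_prod d d"
      using z zd by (simp add: vdist_square)
    have "\<phi> u \<le> (1 - u) * g z + u * g (z + d) - \<alpha> / 2 * u * (1 - u) * scalar_prod d d"
      using sc z(1) zd u unfolding strongly_convex_def
      by (auto simp: \<phi>_def comb[symmetric] dist[symmetric] simp del: smult_add_distrib_vec)
    then have "\<phi> u - \<phi> 0 \<le> u * (g (z + d) - g z - \<alpha> / 2 * (1 - u) * scalar_prod d d)"
      by (simp add: \<phi>_def z0 algebra_simps)
    then show "(\<phi> u - \<phi> 0) / u \<le> g (z + d) - g z - \<alpha> / 2 * (1 - u) * scalar_prod d d"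
      using u by (simp add: divide_le_eq mult.commute)
  qed
  show ?thesis
    using tendsto_le[OF _ lim2 lim ev] by simp
qed

subsection \<open>Linear maps on symmetric matrices\<close>

text \<open>Symmetrized matrix units. The halves off the diagonal let a symmetric \<open>X\<close>
  be expanded over all ordered index pairs with its own entries as coefficients.\<close>

definition sym_unit :: "nat \<Rightarrow> nat \<Rightarrow> nat \<Rightarrow> real Matrix.mat" where
  "sym_unit n k l = Matrix.mat n n (\<lambda>(i, j).
    if i = k \<and> j = l \<or> i = l \<and> j = k then if k = l then 1 else 1 / 2 else 0)"

lemma sym_unit_carrier: "sym_unit n k l \<in> carrier_mat n n"
  by (simp add: sym_unit_def)

lemma sym_unit_index:
  "i < n \<Longrightarrow> j < n \<Longrightarrow> sym_unit n k l $$ (i, j) =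
    (if i = k \<and> j = l \<or> i = l \<and> j = k then if k = l then 1 else 1 / 2 else 0)"
  by (simp add: sym_unit_def)

lemma sym_unit_sym: "sym_unit n k l \<in> sym_mats n"
  by (rule sym_matsI[OF sym_unit_carrier]) (auto simp: sym_unit_index)

lemma sym_unit_swap: "sym_unit n k l = sym_unit n l k"
proof (rule eq_matI)
  show "sym_unit n k l $$ (i, j) = sym_unit n l k $$ (i, j)"
    if "i < dim_row (sym_unit n l k)" "j < dim_col (sym_unit n l k)" for i j
  proof -
    have "i < n" "j < n" using that sym_unit_carrier[of n l k] by auto
    then show ?thesis by (auto simp: sym_unit_index)
  qed
qed (use sym_unit_carrier in \<open>simp_all add: sym_unit_def\<close>)

lemma sym_mats_riesz:
  assumes add: "\<And>X Y. X \<in> sym_mats n \<Longrightarrow> Y \<in> sym_mats n \<Longrightarrow> \<phi> (X + Y) = \<phi> X + \<phi> Y"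
    and smult: "\<And>r X. X \<in> sym_mats n \<Longrightarrow> \<phi> (r \<cdot>\<^sub>m X) = r * \<phi> X"
  shows "\<exists>S\<in>sym_mats n. \<forall>X\<in>sym_mats n. trace_inner S X = (\<phi> X :: real)"
proof -
  let ?E = "\<lambda>kl. sym_unit n (fst kl) (snd kl)"
  define S where "S = Matrix.mat n n (\<lambda>kl. \<phi> (?E kl))"
  have Sc: "S \<in> carrier_mat n n" by (simp add: S_def)
  have "S \<in> sym_mats n" by (rule sym_matsI[OF Sc]) (simp add: S_def sym_unit_swap[of n])
  moreover have "trace_inner S X = \<phi> X" if X: "X \<in> sym_mats n" for X
  proof -
    \<comment> \<open>Partial sums of the expansion of \<open>X\<close>, formed entrywise because
      the zero matrix to start from depends on \<open>n\<close>.\<close>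
    define M where "M I = Matrix.mat n n (\<lambda>ij. \<Sum>kl\<in>I. X $$ kl * ?E kl $$ ij)" for I
    have Mc: "M I \<in> carrier_mat n n" for I by (simp add: M_def)
    have Ms: "M I \<in> sym_mats n" for I
      by (rule sym_matsI[OF Mc]) (simp add: M_def sym_matsD[OF sym_unit_sym])
    have phi_M: "\<phi> (M I) = (\<Sum>kl\<in>I. X $$ kl * \<phi> (?E kl))" if "finite I" for I
      using that
    proof (induction I)
      case empty
      have "M {} = 0 \<cdot>\<^sub>m M {}" by (rule eq_matI) (auto simp: M_def)
      then show ?case using smult[OF Ms, of 0 "{}"] by simp
    next
      case (insert kl I)
      have Ec: "?E kl \<in> carrier_mat n n" using sym_unit_sym by (rule sym_mats_carrier)
      have "M (insert kl I) = X $$ kl \<cdot>\<^sub>m ?E kl + M I"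
        using insert.hyps Ec by (intro eq_matI) (auto simp: M_def)
      then show ?case
        using insert add[OF mat.sm_closed[OF sym_unit_sym] Ms] smult[OF sym_unit_sym] by simp
    qed
    have "M ({..<n} \<times> {..<n}) = X"
    proof (rule eq_matI)
      fix i j assume "i < dim_row X" "j < dim_col X"
      then have ij: "i < n" "j < n" using sym_mats_carrier[OF X] by auto
      have "M ({..<n} \<times> {..<n}) $$ (i, j) = (\<Sum>k<n. \<Sum>l<n. X $$ (k, l) * sym_unit n k l $$ (i, j))"
        using ij by (simp add: M_def sum.cartesian_product case_prod_beta)
      \<comment> \<open>Each position is hit by the pairs \<open>(i, j)\<close> and
        \<open>(j, i)\<close> with weight one half; for \<open>i = j\<close> both halves come from
        the same pair.\<close>
      also have "\<dots> = (\<Sum>k<n. \<Sum>l<n. (if l = j then if k = i then X $$ (k, l) / 2 else 0 else 0)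
          + (if l = i then if k = j then X $$ (k, l) / 2 else 0 else 0))"
        using ij by (intro sum.cong refl) (auto simp: sym_unit_index)
      also have "\<dots> = X $$ (i, j) / 2 + X $$ (j, i) / 2"
        using ij by (simp add: sum.distrib)
      finally show "M ({..<n} \<times> {..<n}) $$ (i, j) = X $$ (i, j)"
        using sym_matsD[OF X ij] by simp
    qed (use Mc sym_mats_carrier[OF X] in auto)
    then have "\<phi> X = (\<Sum>kl\<in>{..<n} \<times> {..<n}. X $$ kl * \<phi> (?E kl))"
      using phi_M[of "{..<n} \<times> {..<n}"] by simp
    also have "\<dots> = (\<Sum>k<n. \<Sum>l<n. X $$ (k, l) * \<phi> (sym_unit n k l))"
      by (simp add: sum.cartesian_product case_prod_beta)
    also have "\<dots> = trace_inner S X"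
      by (subst trace_inner_eq_sum[OF Sc sym_mats_carrier[OF X]]) (simp add: S_def mult.commute)
    finally show ?thesis by simp
  qed
  ultimately show ?thesis by blast
qed

locale sym_linear_map =
  fixes n p :: nat and A :: "real Matrix.mat \<Rightarrow> real Matrix.vec"
  assumes sym_linear: "sym_linear n p A" and p_pos: "0 < p"
begin

lemma map_closed: "X \<in> sym_mats n \<Longrightarrow> A X \<in> carrier_vec p"
  and map_add: "X \<in> sym_mats n \<Longrightarrow> Y \<in> sym_mats n \<Longrightarrow> A (X + Y) = A X + A Y"
  and map_smult: "X \<in> sym_mats n \<Longrightarrow> A (r \<cdot>\<^sub>m X) = r \<cdot>\<^sub>v A X"
  using sym_linear by (auto simp: sym_linear_def)

lemma map_diff:
  assumes "X \<in> sym_mats n" "Y \<in> sym_mats n"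
  shows "A (X - Y) = A X - A Y"
proof -
  have "X - Y + Y = X" using assms[THEN sym_mats_carrier] by (intro eq_matI) auto
  then have "A X = A (X - Y) + A Y" using map_add[of "X - Y" Y] assms mat.diff_closed by simp
  then show ?thesis
    using map_closed[OF mat.diff_closed[OF assms]] map_closed[OF assms(2)] by (intro eq_vecI) auto
qed

text \<open>\<open>adj\<close> is a definite description: the Riesz representation gives existence,
  and testing two candidates on their difference gives uniqueness.\<close>

lemma adj_sym: "x \<in> carrier_vec p \<Longrightarrow> adj n A x \<in> sym_mats n"
  and trace_inner_adj: "x \<in> carrier_vec p \<Longrightarrow> X \<in> sym_mats n \<Longrightarrow>
    trace_inner (adj n A x) X = scalar_prod x (A X)"
proof -
  have "adj n A x \<in> sym_mats n \<and> (\<forall>X\<in>sym_mats n. trace_inner (adj n A x) X = scalar_prod x (A X))"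
    if x: "x \<in> carrier_vec p" for x
    unfolding adj_def
  proof (rule theI')
    obtain S where S: "S \<in> sym_mats n" "\<forall>X\<in>sym_mats n. trace_inner S X = scalar_prod x (A X)"
      using sym_mats_riesz[of n "\<lambda>X. scalar_prod x (A X)"] x
      by (auto simp: map_add map_smult map_closed scalar_prod_add_distrib[of _ p])
    moreover have "T = S" if T: "T \<in> sym_mats n" "\<forall>X\<in>sym_mats n. trace_inner T X = scalar_prod x (A X)" for T
      using T S mat.diff_closed[OF T(1) S(1)]
      by (intro mat.ip_diff_eq0[OF T(1) S(1)]) (simp add: mat.ip_diff_left)
    ultimately show "\<exists>!S. S \<in> sym_mats n \<and> (\<forall>X\<in>sym_mats n. trace_inner S X = scalar_prod x (A X))"
      by blast
  qed
  then show "x \<in> carrier_vec p \<Longrightarrow> adj n A x \<in> sym_mats n"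
    "x \<in> carrier_vec p \<Longrightarrow> X \<in> sym_mats n \<Longrightarrow> trace_inner (adj n A x) X = scalar_prod x (A X)"
    by auto
qed

text \<open>A crude bound from the coordinate functionals. It makes the set under the supremum in
  \<open>op_norm\<close> bounded above; before that, \<open>op_norm\<close> cannot be compared with
  anything.\<close>

lemma map_bounded:
  "\<exists>B\<ge>0. \<forall>X\<in>sym_mats n. scalar_prod (A X) (A X) \<le> B * trace_inner X X"
proof -
  define S where "S i = adj n A (unit_vec p i)" for i
  have S: "S i \<in> sym_mats n" "X \<in> sym_mats n \<Longrightarrow> trace_inner (S i) X = vec_index (A X) i" if "i < p" for i X
    using that adj_sym[of "unit_vec p i"] trace_inner_adj[of "unit_vec p i" X] map_closed[of X]
    by (auto simp: S_def)
  show ?thesis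
  proof (intro exI[of _ "\<Sum>i<p. trace_inner (S i) (S i)"] conjI ballI)
    show "0 \<le> (\<Sum>i<p. trace_inner (S i) (S i))" using S(1) mat.ip_ge0 by (intro sum_nonneg) auto
    fix X assume X: "X \<in> sym_mats n"
    have "scalar_prod (A X) (A X) = (\<Sum>i<p. (trace_inner (S i) X)\<^sup>2)"
      using X S(2) map_closed[OF X] by (simp add: scalar_prod_eq_sum[of _ p] power2_eq_square)
    also have "\<dots> \<le> (\<Sum>i<p. trace_inner (S i) (S i) * trace_inner X X)"
      using S(1) X by (intro sum_mono mat.Cauchy_Schwarz_square) auto
    finally show "scalar_prod (A X) (A X) \<le> (\<Sum>i<p. trace_inner (S i) (S i)) * trace_inner X X"
      by (simp add: sum_distrib_right)
  qed
qed

lemma fnorm_adj_le_op_norm: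
  assumes u: "u \<in> carrier_vec p" "vnorm u = 1"
  shows "fnorm (adj n A u) \<le> op_norm n p A"
  unfolding op_norm_def
proof (rule cSUP_upper)
  obtain B where B: "0 \<le> B" "\<And>X. X \<in> sym_mats n \<Longrightarrow> scalar_prod (A X) (A X) \<le> B * trace_inner X X"
    using map_bounded by blast
  have "fnorm (adj n A x) \<le> sqrt B" if x: "x \<in> carrier_vec p" "vnorm x = 1" for x
  proof -
    let ?S = "adj n A x"
    have xx: "scalar_prod x x = 1" using x by (simp add: vnorm_def)
    have S: "?S \<in> sym_mats n" using x by (simp add: adj_sym)
    define s where "s = trace_inner ?S ?S"
    have s0: "0 \<le> s" using mat.ip_ge0[OF S] by (simp add: s_def)
    \<comment> \<open>Here \<open>s\<close> equals the pairing of \<open>x\<close> with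
      \<open>A ?S\<close>, so Cauchy-Schwarz and the crude bound give
      \<open>s\<^sup>2 \<le> B * s\<close>.\<close>
    have "s\<^sup>2 = (scalar_prod x (A ?S))\<^sup>2" using trace_inner_adj[OF x(1) S] by (simp add: s_def)
    also have "\<dots> \<le> 1 * scalar_prod (A ?S) (A ?S)"
      using vec.Cauchy_Schwarz_square[OF x(1) map_closed[OF S]] xx by simp
    also have "\<dots> \<le> B * s" using B(2)[OF S] by (simp add: s_def)
    finally have "s \<le> B" using s0 B(1) by (cases "s = 0") (auto simp: power2_eq_square)
    then show ?thesis by (simp add: fnorm_def s_def)
  qed
  then show "bdd_above ((\<lambda>x. fnorm (adj n A x)) ` {x \<in> carrier_vec p. vnorm x = 1})"
    by (intro bdd_aboveI[of _ "sqrt B"]) auto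
qed (use u in simp)

lemma op_norm_nonneg: "0 \<le> op_norm n p A"
proof -
  \<comment> \<open>Since \<open>p\<close> is positive the unit sphere is nonempty, and any one of
    its points bounds the supremum from below.\<close>
  have "0 \<le> fnorm (adj n A (unit_vec p 0))"
    using mat.ip_ge0[OF adj_sym] by (simp add: fnorm_def)
  also have "\<dots> \<le> op_norm n p A"
    using p_pos by (intro fnorm_adj_le_op_norm) (auto simp: vnorm_def)
  finally show ?thesis .
qed

text \<open>\<open>op_norm\<close> measures the adjoint; testing the adjoint on the normalized image
  of \<open>X\<close> transfers the bound to \<open>A\<close>.\<close>

lemma map_norm_le:
  assumes X: "X \<in> sym_mats n"
  shows "scalar_prod (A X) (A X) \<le> (op_norm n p A)\<^sup>2 * trace_inner X X"
proof (cases "scalar_prod (A X) (A X) = 0")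
  case True
  then show ?thesis using mat.ip_ge0[OF X] by simp
next
  case False
  define a where "a = sqrt (scalar_prod (A X) (A X))"
  have aa: "a * a = scalar_prod (A X) (A X)" "0 < a"
    using False vec.ip_ge0[OF map_closed[OF X]] by (auto simp: a_def)
  define u where "u = (1 / a) \<cdot>\<^sub>v A X"
  have u: "u \<in> carrier_vec p" using map_closed[OF X] by (simp add: u_def)
  have "scalar_prod u u = 1" using aa map_closed[OF X] by (simp add: u_def aa(1)[symmetric])
  then have u1: "vnorm u = 1" by (simp add: vnorm_def)
  have "a = scalar_prod u (A X)" using aa map_closed[OF X] by (simp add: u_def aa(1)[symmetric])
  also have "\<dots> = trace_inner (adj n A u) X" using trace_inner_adj[OF u X] by simp
  also have "\<dots> \<le> fnorm (adj n A u) * sqrt (trace_inner X X)"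
    using mat.Cauchy_Schwarz[OF adj_sym[OF u] X] by (simp add: fnorm_def)
  also have "\<dots> \<le> op_norm n p A * sqrt (trace_inner X X)"
    using fnorm_adj_le_op_norm[OF u u1] mat.ip_ge0[OF X] by (simp add: mult_right_mono)
  finally have "a\<^sup>2 \<le> (op_norm n p A * sqrt (trace_inner X X))\<^sup>2"
    using aa(2) by (intro power_mono) auto
  also have "\<dots> = (op_norm n p A)\<^sup>2 * trace_inner X X"
    using mat.ip_ge0[OF X] by (simp add: power_mult_distrib)
  finally show ?thesis using aa(1) by (simp add: power2_eq_square)
qed

end

subsection \<open>The optimization problem\<close>

locale fw_problem =
  fixes n p :: nat and \<alpha> \<beta> :: real and g A C c K
  assumes data: "problem_data n p \<alpha> \<beta> g A C c K"
begin

lemma data_simps: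
  "0 < n" "0 < p" "0 < \<alpha>" "0 < \<beta>" "strongly_convex p \<alpha> g" "smooth p \<beta> g"
  "C \<in> sym_mats n" "c \<in> carrier_vec p" "K \<subseteq> carrier_vec p" "vconvex K" "vcompact p K"
  using data by (auto simp: problem_data_def)

lemma K_carrier: "y \<in> K \<Longrightarrow> y \<in> carrier_vec p"
  using data_simps(9) by blast

sublocale sym_linear_map n p A
  using data by unfold_locales (auto simp: problem_data_def)

abbreviation f where "f \<equiv> objective g A C c"
abbreviation N where "N \<equiv> op_norm n p A"
abbreviation GX where "GX \<equiv> grad_X n f"
abbreviation Gy where "Gy \<equiv> grad_y p f"
abbreviation res where "res X y \<equiv> A X + y"
abbreviation msq where "msq X \<equiv> trace_inner X X"
abbreviation vsq :: "real Matrix.vec \<Rightarrow> real" where "vsq x \<equiv> scalar_prod x x"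

lemma res_closed: "X \<in> sym_mats n \<Longrightarrow> y \<in> carrier_vec p \<Longrightarrow> res X y \<in> carrier_vec p"
  by (simp add: map_closed)

lemma dg_closed: "z \<in> carrier_vec p \<Longrightarrow> vgrad p g z \<in> carrier_vec p"
  using smooth_vgrad_closed[OF data_simps(6)] .

lemma GX_eq:
  assumes X: "X \<in> sym_mats n" and y: "y \<in> carrier_vec p"
  shows "GX X y = adj n A (vgrad p g (res X y)) + C"
proof (rule sym_gradient_unique[OF _ X])
  let ?z = "res X y" and ?G = "adj n A (vgrad p g (res X y)) + C"
  have z: "?z \<in> carrier_vec p" using res_closed[OF X y] .
  note dz = dg_closed[OF z]
  show "has_gradient (sym_mats n) trace_inner (\<lambda>Z. f Z y) ?G X"
    unfolding has_gradient_def
  proof (intro conjI allI impI)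
    show "?G \<in> sym_mats n" using adj_sym[OF dz] data_simps(7) by (rule mat.add_closed)
    fix e :: real assume e: "0 < e"
    \<comment> \<open>Dividing by \<open>N + 1\<close> rather than \<open>N\<close> includes the
      case \<open>A = 0\<close>.\<close>
    have N1: "0 < N + 1" using op_norm_nonneg by simp
    then have "0 < e / (N + 1)" using e by simp
    then obtain s where s: "0 < s" and bound: "\<And>h. h \<in> carrier_vec p \<Longrightarrow> sqrt (vsq h) < s \<Longrightarrow>
        \<bar>g (?z + h) - g ?z - scalar_prod (vgrad p g ?z) h\<bar> \<le> e / (N + 1) * sqrt (vsq h)"
      using smooth_has_gradient[OF data_simps(6) z] unfolding has_gradient_def by blast
    show "\<exists>d>0. \<forall>h\<in>sym_mats n. sqrt (msq h) < d \<longrightarrow>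
        \<bar>f (X + h) y - f X y - trace_inner ?G h\<bar> \<le> e * sqrt (msq h)"
    proof (intro exI[of _ "s / (N + 1)"] conjI ballI impI)
      show "0 < s / (N + 1)" using s N1 by simp
      fix h assume h: "h \<in> sym_mats n" and small: "sqrt (msq h) < s / (N + 1)"
      define m where "m = sqrt (msq h)"
      have m0: "0 \<le> m" using mat.ip_ge0[OF h] by (simp add: m_def)
      have "sqrt (vsq (A h)) \<le> sqrt (N\<^sup>2 * msq h)" using map_norm_le[OF h] by (rule real_sqrt_le_mono)
      also have "\<dots> = N * m" using op_norm_nonneg by (simp add: m_def real_sqrt_mult)
      finally have Ah: "sqrt (vsq (A h)) \<le> N * m" .
      also have "N * m \<le> (N + 1) * m" using m0 by (simp add: distrib_right)
      also have "\<dots> < s" using small N1 by (simp add: m_def[symmetric] field_simps)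
      finally have As: "sqrt (vsq (A h)) < s" .
      have "A (X + h) + y = ?z + A h"
        using map_add[OF X h] map_closed[OF X] map_closed[OF h] y by (intro eq_vecI) auto
      then have "f (X + h) y - f X y - trace_inner ?G h
          = g (?z + A h) - g ?z - scalar_prod (vgrad p g ?z) (A h)"
        using X h data_simps(7) adj_sym[OF dz] trace_inner_adj[OF dz h]
        by (simp add: objective_def mat.ip_add_left mat.ip_add_right)
      then have "\<bar>f (X + h) y - f X y - trace_inner ?G h\<bar> \<le> e / (N + 1) * sqrt (vsq (A h))"
        using bound[OF map_closed[OF h] As] by simp
      also have "\<dots> \<le> e / (N + 1) * ((N + 1) * m)"
        using Ah \<open>N * m \<le> (N + 1) * m\<close> e N1 by (intro mult_left_mono) auto
      also have "\<dots> = e * sqrt (msq h)" using N1 by (simp add: m_def)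
      finally show "\<bar>f (X + h) y - f X y - trace_inner ?G h\<bar> \<le> e * sqrt (msq h)" .
    qed
  qed
qed

lemma Gy_eq:
  assumes X: "X \<in> sym_mats n" and y: "y \<in> carrier_vec p"
  shows "Gy X y = vgrad p g (res X y) + c"
proof (rule vec_gradient_unique[OF _ y])
  let ?z = "res X y"
  have z: "?z \<in> carrier_vec p" using res_closed[OF X y] .
  note dz = dg_closed[OF z]
  have "f X (y + h) - f X y - scalar_prod (vgrad p g ?z + c) h
      = g (?z + h) - g ?z - scalar_prod (vgrad p g ?z) h" if h: "h \<in> carrier_vec p" for h
  proof -
    have "A X + (y + h) = ?z + h" using map_closed[OF X] y h by (intro eq_vecI) auto
    then show ?thesis
      using y h dz data_simps(8)
      by (simp add: objective_def add_scalar_prod_distrib[of _ p] scalar_prod_add_distrib[of _ p])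
  qed
  then show "has_gradient (carrier_vec p) scalar_prod (f X) (vgrad p g ?z + c) y"
    using smooth_has_gradient[OF data_simps(6) z] data_simps(8)
    unfolding has_gradient_def by (simp cong: ball_cong)
qed

lemma GX_closed: "X \<in> sym_mats n \<Longrightarrow> y \<in> carrier_vec p \<Longrightarrow> GX X y \<in> sym_mats n"
  using GX_eq adj_sym[OF dg_closed[OF res_closed]] data_simps(7) mat.add_closed by simp

lemma Gy_closed: "X \<in> sym_mats n \<Longrightarrow> y \<in> carrier_vec p \<Longrightarrow> Gy X y \<in> carrier_vec p"
  using Gy_eq dg_closed[OF res_closed] data_simps(8) by simp

lemma trace_inner_GX:
  assumes "X \<in> sym_mats n" "y \<in> carrier_vec p" "H \<in> sym_mats n"
  shows "trace_inner (GX X y) H = scalar_prod (vgrad p g (res X y)) (A H) + trace_inner C H"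
  using assms GX_eq[OF assms(1,2)] dg_closed[OF res_closed[OF assms(1,2)]] data_simps(7)
  by (simp add: mat.ip_add_left[of _ n] adj_sym trace_inner_adj)

text \<open>\<open>C\<close> cancels, so the two gradients differ only through the residuals.
  Pairing with \<open>A H\<close> costs one factor \<open>N\<close>.\<close>

lemma GX_difference_bound:
  assumes X: "X \<in> sym_mats n" "y \<in> carrier_vec p" and U: "U \<in> sym_mats n" "u \<in> carrier_vec p"
    and H: "H \<in> sym_mats n"
  shows "trace_inner (GX X y) H - trace_inner (GX U u) H
    \<le> \<beta> * vdist p (res X y) (res U u) * (N * sqrt (msq H))"
proof -
  let ?z = "res X y" and ?w = "res U u"
  note z = res_closed[OF X] and w = res_closed[OF U]
  note c = dg_closed[OF z] dg_closed[OF w]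
  let ?d = "vgrad p g ?z - vgrad p g ?w"
  have "trace_inner (GX X y) H - trace_inner (GX U u) H = scalar_prod ?d (A H)"
    using trace_inner_GX[OF X H] trace_inner_GX[OF U H] c map_closed[OF H]
    by (simp add: minus_scalar_prod_distrib[of _ p])
  also have "\<dots> \<le> sqrt (vsq ?d) * sqrt (vsq (A H))"
    using vec.Cauchy_Schwarz[of ?d p "A H"] c map_closed[OF H] by simp
  also have "\<dots> \<le> (\<beta> * vdist p ?z ?w) * (N * sqrt (msq H))"
  proof (rule mult_mono)
    have "sqrt (vsq ?d) = vdist p (vgrad p g ?z) (vgrad p g ?w)"
      using c by (simp add: vdist_eq_vnorm vnorm_def)
    then show "sqrt (vsq ?d) \<le> \<beta> * vdist p ?z ?w"
      using data_simps(6) z w unfolding smooth_def by simp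
    have "sqrt (vsq (A H)) \<le> sqrt (N\<^sup>2 * msq H)" using map_norm_le[OF H] by (rule real_sqrt_le_mono)
    then show "sqrt (vsq (A H)) \<le> N * sqrt (msq H)" using op_norm_nonneg by (simp add: real_sqrt_mult)
    show "0 \<le> \<beta> * vdist p ?z ?w" using data_simps(4) by (simp add: vdist_def)
    show "0 \<le> sqrt (vsq (A H))" using vec.ip_ge0[OF map_closed[OF H]] by simp
  qed
  finally show ?thesis .
qed

section \<open>First-order expansion of the objective in both blocks\<close>

definition lin where
  "lin X y U u = trace_inner (GX X y) (U - X) + scalar_prod (Gy X y) (u - y)"

text \<open>Written as the image of a displacement, which scales under convex combinations and
  splits into its two blocks; by \<open>rdiff_eq\<close> it is the change of the argument of
  \<open>g\<close>.\<close>

definition rdiff where "rdiff X y U u = A (U - X) + (u - y)"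

lemma rdiff_closed:
  assumes "X \<in> sym_mats n" "y \<in> carrier_vec p" "U \<in> sym_mats n" "u \<in> carrier_vec p"
  shows "rdiff X y U u \<in> carrier_vec p"
  using assms map_closed[OF mat.diff_closed[OF assms(3,1)]] by (simp add: rdiff_def)

lemma rdiff_eq:
  assumes "X \<in> sym_mats n" "y \<in> carrier_vec p" "U \<in> sym_mats n" "u \<in> carrier_vec p"
  shows "rdiff X y U u = res U u - res X y"
  using assms map_diff[OF assms(3,1)] map_closed[OF assms(1)] map_closed[OF assms(3)]
  unfolding rdiff_def by (intro eq_vecI) auto

lemma vdist_res:
  assumes "X \<in> sym_mats n" "y \<in> carrier_vec p" "U \<in> sym_mats n" "u \<in> carrier_vec p"
  shows "vdist p (res U u) (res X y) = sqrt (vsq (rdiff X y U u))"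
  using assms res_closed by (simp add: rdiff_eq vdist_eq_vnorm vnorm_def)

text \<open>The linear terms of \<open>f\<close> cancel against their share of \<open>lin\<close>;
  what remains is the first-order error of \<open>g\<close> at the residual, so all curvature of
  \<open>f\<close> is seen through \<open>rdiff\<close>.\<close>

lemma objective_expansion:
  assumes X: "X \<in> sym_mats n" "y \<in> carrier_vec p" and U: "U \<in> sym_mats n" "u \<in> carrier_vec p"
  shows "f U u \<le> f X y + lin X y U u + \<beta> / 2 * vsq (rdiff X y U u)"
    and "f X y + lin X y U u + \<alpha> / 2 * vsq (rdiff X y U u) \<le> f U u"
proof -
  let ?z = "res X y" and ?d = "rdiff X y U u"
  note z = res_closed[OF X] and d = rdiff_closed[OF X U]
  note UX = mat.diff_closed[OF U(1) X(1)]
  have zd: "?z + ?d = res U u"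
  proof -
    have "a + (b - a) = b" if "a \<in> carrier_vec p" "b \<in> carrier_vec p" for a b :: "real Matrix.vec"
      using that by (intro eq_vecI) auto
    then show ?thesis unfolding rdiff_eq[OF X U] using z res_closed[OF U] by blast
  qed
  have "lin X y U u = scalar_prod (vgrad p g ?z) ?d + (trace_inner C U - trace_inner C X)
      + (scalar_prod c u - scalar_prod c y)"
    using trace_inner_GX[OF X UX] Gy_eq[OF X] dg_closed[OF z] map_closed[OF UX] X U data_simps(7,8)
    by (simp add: lin_def rdiff_def mat.ip_diff_right add_scalar_prod_distrib[of _ p]
        scalar_prod_add_distrib[of _ p] scalar_prod_minus_distrib[of _ p])
  then have eq: "f U u - f X y - lin X y U u = g (?z + ?d) - g ?z - scalar_prod (vgrad p g ?z) ?d"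
    by (simp add: objective_def zd)
  show "f U u \<le> f X y + lin X y U u + \<beta> / 2 * vsq ?d"
    using eq smooth_upper_bound[OF data_simps(6) z d] by simp
  show "f X y + lin X y U u + \<alpha> / 2 * vsq ?d \<le> f U u"
    using eq strongly_convex_lower_bound[OF data_simps(6,5) z d] by simp
qed

text \<open>Compare the lower and upper bounds along one unit vector. This later keeps the step size
  of the linear rate within [0, 1].\<close>

lemma strong_convexity_le_smoothness: "\<alpha> \<le> \<beta>"
proof -
  let ?z = "0\<^sub>v p :: real Matrix.vec" and ?d = "unit_vec p 0 :: real Matrix.vec"
  have "vsq ?d = 1" using data_simps(2) by simp
  then show ?thesis
    using smooth_upper_bound[OF data_simps(6), of ?z ?d]
      strongly_convex_lower_bound[OF data_simps(6,5), of ?z ?d] by simp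
qed

lemma rdiff_square_le:
  assumes X: "X \<in> sym_mats n" "y \<in> carrier_vec p" and U: "U \<in> sym_mats n" "u \<in> carrier_vec p"
  shows "vsq (rdiff X y U u) \<le> 2 * N\<^sup>2 * msq (U - X) + 2 * vsq (u - y)"
proof -
  note UX = mat.diff_closed[OF U(1) X(1)]
  have "vsq (rdiff X y U u) \<le> 2 * vsq (A (U - X)) + 2 * vsq (u - y)"
    unfolding rdiff_def using map_closed[OF UX] X U by (intro vec.ip_add_self_le) auto
  then show ?thesis using map_norm_le[OF UX] by simp
qed

subsection \<open>Compactness of the feasible set\<close>

lemma K_subseq:
  assumes "\<And>k. ys k \<in> K"
  obtains l r where "l \<in> K" "strict_mono (r :: nat \<Rightarrow> nat)" "(\<lambda>k. vdist p (ys (r k)) l) \<longlonglongrightarrow> 0"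
proof -
  interpret M: Metric_space "carrier_vec p" "vdist p" by (rule Metric_space_vdist)
  have "range ys \<subseteq> K" using assms by auto
  then obtain l r where lr: "l \<in> K" "strict_mono (r :: nat \<Rightarrow> nat)"
    and lim: "limitin M.mtopology (ys \<circ> r) l sequentially"
    using data_simps(11) M.compactin_sequentially[of K] unfolding vcompact_def by blast
  have "(\<lambda>k. vdist p (ys (r k)) l) \<longlonglongrightarrow> 0"
    unfolding tendsto_iff
  proof (intro allI impI)
    fix e :: real assume "0 < e"
    then have "eventually (\<lambda>k. (ys \<circ> r) k \<in> carrier_vec p \<and> vdist p ((ys \<circ> r) k) l < e) sequentially"
      using lim unfolding M.limitin_metric by blast
    then show "eventually (\<lambda>k. dist (vdist p (ys (r k)) l) 0 < e) sequentially"
      by eventually_elim (simp add: dist_real_def)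
  qed
  with lr show thesis by (rule that)
qed

lemma vdist_le_diameter:
  assumes "x \<in> K" "y \<in> K"
  shows "vdist p x y \<le> vdiameter p K"
proof -
  interpret M: Metric_space "carrier_vec p" "vdist p" by (rule Metric_space_vdist)
  have "M.mbounded K"
    using data_simps(11) unfolding vcompact_def by (rule M.compactin_imp_mbounded)
  then obtain B where B: "\<And>x y. x \<in> K \<Longrightarrow> y \<in> K \<Longrightarrow> vdist p x y \<le> B"
    unfolding M.mbounded_alt by blast
  have "(case (x, y) of (x, y) \<Rightarrow> vdist p x y) \<le> (SUP (x, y) \<in> K \<times> K. vdist p x y)"
    using assms B by (intro cSUP_upper) (auto intro!: bdd_aboveI[of _ B])
  then show ?thesis by (simp add: vdiameter_def)
qed

lemma vdist_attains_inf:
  assumes z: "z \<in> carrier_vec p" and ne: "K \<noteq> {}"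
  shows "\<exists>l\<in>K. \<forall>x\<in>K. vdist p z l \<le> vdist p z x"
proof (rule sequentially_compact_attains_inf[OF ne])
  interpret M: Metric_space "carrier_vec p" "vdist p" by (rule Metric_space_vdist)
  fix xs :: "nat \<Rightarrow> real Matrix.vec" assume xs: "\<And>k. xs k \<in> K"
  obtain l r where lr: "l \<in> K" "strict_mono (r :: nat \<Rightarrow> nat)" "(\<lambda>k. vdist p (xs (r k)) l) \<longlonglongrightarrow> 0"
    using K_subseq[of xs] xs by metis
  have "\<bar>vdist p z (xs (r k)) - vdist p z l\<bar> \<le> vdist p (xs (r k)) l" for k
    using M.triangle[of z l "xs (r k)"] M.triangle[of z "xs (r k)" l] z K_carrier[OF xs]
      K_carrier[OF lr(1)] M.commute[of l "xs (r k)"] by (simp add: abs_le_iff)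
  then have "(\<lambda>k. vdist p z (xs (r k)) - vdist p z l) \<longlonglongrightarrow> 0"
    using lr(3) by (intro Lim_null_comparison[OF _ lr(3)]) auto
  then have "(\<lambda>k. vdist p z (xs (r k))) \<longlonglongrightarrow> vdist p z l" by (simp add: LIM_zero_iff)
  with lr show "\<exists>l\<in>K. \<exists>r. strict_mono (r :: nat \<Rightarrow> nat) \<and> (\<lambda>k. vdist p z (xs (r k))) \<longlonglongrightarrow> vdist p z l"
    by blast
qed

text \<open>\<open>arg_min_on\<close> merely chooses; it has the expected property once the distance
  is known to attain its minimum.\<close>

lemma vproj_closest:
  assumes z: "z \<in> carrier_vec p" and ne: "K \<noteq> {}"
  shows "vproj p K z \<in> K" "x \<in> K \<Longrightarrow> vdist p z (vproj p K z) \<le> vdist p z x"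
proof -
  obtain l where "l \<in> K" "\<forall>x\<in>K. vdist p z l \<le> vdist p z x" using vdist_attains_inf[OF assms] by blast
  then have "is_arg_min (vdist p z) (\<lambda>u. u \<in> K) l" by (auto simp: is_arg_min_linorder)
  then have "is_arg_min (vdist p z) (\<lambda>u. u \<in> K) (vproj p K z)"
    unfolding vproj_def arg_min_on_def arg_min_def by (rule someI)
  then show "vproj p K z \<in> K" "x \<in> K \<Longrightarrow> vdist p z (vproj p K z) \<le> vdist p z x"
    by (auto simp: is_arg_min_linorder)
qed

end

text \<open>The Frobenius norm bounds every entry, and symmetry, trace and nonnegative quadratic
  forms pass to entrywise limits. Convergence is then restated in the squared norm that occurs in
  the bounds on \<open>f\<close>.\<close>

lemma spectrahedron_subseq:
  assumes Xs: "\<And>k. Xs k \<in> spectrahedron n"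
  obtains L r where "L \<in> spectrahedron n" "strict_mono (r :: nat \<Rightarrow> nat)"
    "(\<lambda>k. trace_inner (Xs (r k) - L) (Xs (r k) - L)) \<longlonglongrightarrow> 0"
proof -
  note Xc = spectrahedronD(2)[OF Xs]
  have "\<bar>Xs k $$ (i, j)\<bar> \<le> 1" if ij: "i < n" "j < n" for k i j
  proof -
    have "(Xs k $$ (i, j))\<^sup>2 \<le> (\<Sum>j<n. (Xs k $$ (i, j))\<^sup>2)"
      using ij by (intro member_le_sum) auto
    also have "\<dots> \<le> (\<Sum>i<n. \<Sum>j<n. (Xs k $$ (i, j))\<^sup>2)"
      using ij by (intro member_le_sum[of i "{..<n}" "\<lambda>i. \<Sum>j<n. (Xs k $$ (i, j))\<^sup>2"])
        (auto intro: sum_nonneg)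
    also have "\<dots> = trace_inner (Xs k) (Xs k)"
      using Xc by (simp add: trace_inner_eq_sum[of _ n] power2_eq_square)
    also have "\<dots> \<le> 1" using spectrahedron_inner_self_le_1[OF Xs] .
    finally show ?thesis by (simp add: abs_square_le_1)
  qed
  then obtain L r where L: "L \<in> carrier_mat n n" "strict_mono (r :: nat \<Rightarrow> nat)"
    and lim: "\<And>i j. i < n \<Longrightarrow> j < n \<Longrightarrow> (\<lambda>k. Xs (r k) $$ (i, j)) \<longlonglongrightarrow> L $$ (i, j)"
    using bounded_mat_subseq[of n n Xs 1] by auto
  have "L \<in> spectrahedron n"
  proof (rule spectrahedronI)
    show "L \<in> sym_mats n"
    proof (rule sym_matsI[OF L(1)])
      fix i j assume ij: "i < n" "j < n"
      have "(\<lambda>k. Xs (r k) $$ (j, i)) \<longlonglongrightarrow> L $$ (i, j)"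
        using lim[OF ij] sym_matsD[OF spectrahedronD(1)[OF Xs] ij] by simp
      then show "L $$ (i, j) = L $$ (j, i)" using lim[OF ij(2,1)] by (rule LIMSEQ_unique)
    qed
    have "(\<lambda>k. \<Sum>i<n. Xs (r k) $$ (i, i)) \<longlonglongrightarrow> (\<Sum>i<n. L $$ (i, i))"
      by (intro tendsto_sum lim) auto
    moreover have "(\<Sum>i<n. Xs (r k) $$ (i, i)) = 1" for k
      using spectrahedronD(3)[OF Xs[of "r k"]] Xc[of "r k"] by (simp add: mtrace_def)
    ultimately show "mtrace L = 1" using L(1) by (simp add: mtrace_def LIMSEQ_const_iff)
    fix v :: "real Matrix.vec" assume v: "v \<in> carrier_vec n"
    have "(\<lambda>k. scalar_prod v (Xs (r k) *\<^sub>v v)) \<longlonglongrightarrow> scalar_prod v (L *\<^sub>v v)"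
    proof (rule tendsto_scalar_prod[of _ n])
      show "(\<lambda>k. vec_index (Xs (r k) *\<^sub>v v) i) \<longlonglongrightarrow> vec_index (L *\<^sub>v v) i" if "i < n" for i
        using v Xc L(1) lim that by (intro tendsto_mult_mat_vec[of _ n _ _ n]) auto
    qed (use v mult_mat_vec_carrier[OF Xc v] mult_mat_vec_carrier[OF L(1) v] in auto)
    then show "0 \<le> scalar_prod v (L *\<^sub>v v)"
      using spectrahedronD(4)[OF Xs v] by (intro LIMSEQ_le_const) auto
  qed
  moreover have "(\<lambda>k. trace_inner (Xs (r k) - L) (Xs (r k) - L)) \<longlonglongrightarrow> 0"
  proof -
    have "(\<lambda>k. \<Sum>i<n. \<Sum>j<n. (Xs (r k) $$ (i, j) - L $$ (i, j)) * (Xs (r k) $$ (i, j) - L $$ (i, j)))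
        \<longlonglongrightarrow> (\<Sum>i<n. \<Sum>j<n. (L $$ (i, j) - L $$ (i, j)) * (L $$ (i, j) - L $$ (i, j)))"
      by (intro tendsto_intros lim) auto
    moreover have "trace_inner (Xs (r k) - L) (Xs (r k) - L) = (\<Sum>i<n. \<Sum>j<n.
        (Xs (r k) $$ (i, j) - L $$ (i, j)) * (Xs (r k) $$ (i, j) - L $$ (i, j)))" for k
      using Xc[of "r k"] L(1) by (simp add: trace_inner_eq_sum[of _ n] minus_carrier_mat)
    ultimately show ?thesis by simp
  qed
  ultimately show thesis using L(2) that by blast
qed

context fw_problem
begin

abbreviation feasible where "feasible X y \<equiv> X \<in> spectrahedron n \<and> y \<in> K"

lemma feasible_carrier: "feasible X y \<Longrightarrow> X \<in> sym_mats n \<and> y \<in> carrier_vec p"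
  using spectrahedronD(1) K_carrier by blast

lemma spectrahedron_nonempty: "spectrahedron n \<noteq> {}"
  using outer_spectrahedron[of "unit_vec n 0" n] data_simps(1) by auto

lemma lin_bound:
  assumes "X \<in> sym_mats n" "y \<in> carrier_vec p" "U \<in> sym_mats n" "u \<in> carrier_vec p"
  shows "\<bar>lin X y U u\<bar> \<le> sqrt (msq (GX X y)) * sqrt (msq (U - X)) + sqrt (vsq (Gy X y)) * sqrt (vsq (u - y))"
  using mat.Cauchy_Schwarz[OF GX_closed[OF assms(1,2)] mat.diff_closed[OF assms(3,1)]]
    vec.Cauchy_Schwarz[OF Gy_closed[OF assms(1,2)] vec.diff_closed[OF assms(4,2)]]
  unfolding lin_def by linarith

text \<open>Continuity of \<open>f\<close> at the limit point comes from
  \<open>objective_expansion\<close>: its lower and upper bounds sandwich the values, and both tend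
  to the limit value because the linear and quadratic terms vanish. Thus the infimum in
  \<open>opt_value\<close> is attained.\<close>

lemma minimizer_exists:
  assumes "K \<noteq> {}"
  shows "\<exists>X y. minimizer n K f X y"
proof -
  let ?S = "spectrahedron n \<times> K"
  have "\<exists>l\<in>?S. \<forall>x\<in>?S. (\<lambda>(X, y). f X y) l \<le> (\<lambda>(X, y). f X y) x"
  proof (rule sequentially_compact_attains_inf)
    show "?S \<noteq> {}" using assms spectrahedron_nonempty by auto
    fix xs :: "nat \<Rightarrow> real Matrix.mat \<times> real Matrix.vec" assume xs: "\<And>k. xs k \<in> ?S"
    define Xs ys where "Xs k = fst (xs k)" and "ys k = snd (xs k)" for k
    have Xs: "Xs k \<in> spectrahedron n" and ys: "ys k \<in> K" for k
      using xs[of k] by (auto simp: Xs_def ys_def)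
    obtain L r where L: "L \<in> spectrahedron n" "strict_mono (r :: nat \<Rightarrow> nat)"
      "(\<lambda>k. msq (Xs (r k) - L)) \<longlonglongrightarrow> 0"
      by (rule spectrahedron_subseq[of Xs n, OF Xs])
    obtain l q where l: "l \<in> K" "strict_mono (q :: nat \<Rightarrow> nat)"
      "(\<lambda>k. vdist p (ys (r (q k))) l) \<longlonglongrightarrow> 0"
      by (rule K_subseq[of "\<lambda>k. ys (r k)", OF ys])
    define a b where "a k = Xs (r (q k))" and "b k = ys (r (q k))" for k
    have Lc: "L \<in> sym_mats n" "l \<in> carrier_vec p" using feasible_carrier L l by auto
    have c: "a k \<in> sym_mats n" "b k \<in> carrier_vec p" for k
      using feasible_carrier Xs ys by (auto simp: a_def b_def)
    have a0: "(\<lambda>k. msq (a k - L)) \<longlonglongrightarrow> 0"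
      using LIMSEQ_subseq_LIMSEQ[OF L(3) l(2)] by (simp add: a_def o_def)
    have b_eq: "sqrt (vsq (b k - l)) = vdist p (b k) l" for k
      using c(2)[of k] Lc by (simp add: vdist_eq_vnorm vnorm_def)
    have b0': "(\<lambda>k. sqrt (vsq (b k - l))) \<longlonglongrightarrow> 0" unfolding b_eq using l(3) by (simp add: b_def)
    have b0: "(\<lambda>k. vsq (b k - l)) \<longlonglongrightarrow> 0"
    proof -
      have "(\<lambda>k. (sqrt (vsq (b k - l)))\<^sup>2) \<longlonglongrightarrow> 0\<^sup>2" using b0' by (rule tendsto_power)
      moreover have "(sqrt (vsq (b k - l)))\<^sup>2 = vsq (b k - l)" for k
        using c(2)[of k] Lc by (intro vec.nrm_square[of _ p]) auto
      ultimately show ?thesis by simp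
    qed
    have lin0: "(\<lambda>k. lin L l (a k) (b k)) \<longlonglongrightarrow> 0"
    proof (rule Lim_null_comparison)
      show "eventually (\<lambda>k. norm (lin L l (a k) (b k)) \<le> sqrt (msq (GX L l)) * sqrt (msq (a k - L))
          + sqrt (vsq (Gy L l)) * sqrt (vsq (b k - l))) sequentially"
        using lin_bound[OF Lc c] by (intro always_eventually) (simp add: real_norm_def)
      have "(\<lambda>k. sqrt (msq (GX L l)) * sqrt (msq (a k - L))
          + sqrt (vsq (Gy L l)) * sqrt (vsq (b k - l))) \<longlonglongrightarrow>
          sqrt (msq (GX L l)) * sqrt 0 + sqrt (vsq (Gy L l)) * 0"
        by (intro tendsto_intros tendsto_real_sqrt a0 b0')
      then show "(\<lambda>k. sqrt (msq (GX L l)) * sqrt (msq (a k - L))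
          + sqrt (vsq (Gy L l)) * sqrt (vsq (b k - l))) \<longlonglongrightarrow> 0" by simp
    qed
    have "(\<lambda>k. f (a k) (b k)) \<longlonglongrightarrow> f L l"
    proof (rule tendsto_sandwich)
      show "eventually (\<lambda>k. f L l + lin L l (a k) (b k) \<le> f (a k) (b k)) sequentially"
      proof (intro always_eventually allI)
        fix k
        have "0 \<le> \<alpha> / 2 * vsq (rdiff L l (a k) (b k))"
          using data_simps(3) vec.ip_ge0[OF rdiff_closed[OF Lc c]] by simp
        then show "f L l + lin L l (a k) (b k) \<le> f (a k) (b k)"
          using objective_expansion(2)[OF Lc c, of k k] by linarith
      qed
      show "eventually (\<lambda>k. f (a k) (b k) \<le> f L l + lin L l (a k) (b k)
          + \<beta> / 2 * (2 * N\<^sup>2 * msq (a k - L) + 2 * vsq (b k - l))) sequentially"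
      proof (intro always_eventually allI)
        fix k
        have "\<beta> / 2 * vsq (rdiff L l (a k) (b k)) \<le> \<beta> / 2 * (2 * N\<^sup>2 * msq (a k - L) + 2 * vsq (b k - l))"
          using rdiff_square_le[OF Lc c, of k k] data_simps(4) by (intro mult_left_mono) auto
        then show "f (a k) (b k) \<le> f L l + lin L l (a k) (b k)
          + \<beta> / 2 * (2 * N\<^sup>2 * msq (a k - L) + 2 * vsq (b k - l))"
          using objective_expansion(1)[OF Lc c, of k k] by linarith
      qed
      have "(\<lambda>k. f L l + lin L l (a k) (b k)) \<longlonglongrightarrow> f L l + 0" by (intro tendsto_intros lin0)
      then show "(\<lambda>k. f L l + lin L l (a k) (b k)) \<longlonglongrightarrow> f L l" by simp
      have "(\<lambda>k. f L l + lin L l (a k) (b k) + \<beta> / 2 * (2 * N\<^sup>2 * msq (a k - L) + 2 * vsq (b k - l)))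
          \<longlonglongrightarrow> f L l + 0 + \<beta> / 2 * (2 * N\<^sup>2 * 0 + 2 * 0)"
        by (intro tendsto_intros lin0 a0 b0)
      then show "(\<lambda>k. f L l + lin L l (a k) (b k) + \<beta> / 2 * (2 * N\<^sup>2 * msq (a k - L) + 2 * vsq (b k - l)))
          \<longlonglongrightarrow> f L l" by simp
    qed
    moreover have "strict_mono (r \<circ> q)" using L(2) l(2) by (rule strict_mono_o)
    ultimately show "\<exists>l\<in>?S. \<exists>r. strict_mono (r :: nat \<Rightarrow> nat) \<and>
        (\<lambda>k. (\<lambda>(X, y). f X y) (xs (r k))) \<longlonglongrightarrow> (\<lambda>(X, y). f X y) l"
      using L(1) l(1)
      by (intro bexI[of _ "(L, l)"] exI[of _ "r \<circ> q"])
        (auto simp: a_def b_def Xs_def ys_def case_prod_beta)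
  qed
  then obtain X y where "(X, y) \<in> ?S" "\<forall>x\<in>?S. f X y \<le> (\<lambda>(X, y). f X y) x" by auto
  then have "minimizer n K f X y"
    unfolding minimizer_def is_arg_min_linorder by auto
  then show ?thesis by blast
qed

lemma minimizerD:
  assumes "minimizer n K f X y"
  shows "feasible X y" "feasible U u \<Longrightarrow> f X y \<le> f U u" "opt_value n K f = f X y"
proof -
  show F: "feasible X y" and le: "feasible U u \<Longrightarrow> f X y \<le> f U u" for U u
    using assms by (auto simp: minimizer_def is_arg_min_linorder)
  show "opt_value n K f = f X y"
    unfolding opt_value_def by (rule cInf_eq_minimum) (use F le in force)+
qed

section \<open>First-order optimality\<close>

lemma lin_combination:
  assumes X: "X \<in> sym_mats n" "y \<in> carrier_vec p" and U: "U \<in> sym_mats n" "u \<in> carrier_vec p"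
  shows "lin X y ((1 - s) \<cdot>\<^sub>m X + s \<cdot>\<^sub>m U) ((1 - s) \<cdot>\<^sub>v y + s \<cdot>\<^sub>v u) = s * lin X y U u"
    and "vsq (rdiff X y ((1 - s) \<cdot>\<^sub>m X + s \<cdot>\<^sub>m U) ((1 - s) \<cdot>\<^sub>v y + s \<cdot>\<^sub>v u)) = s\<^sup>2 * vsq (rdiff X y U u)"
proof -
  note UX = mat.diff_closed[OF U(1) X(1)] and uy = vec.diff_closed[OF U(2) X(2)]
  note m = mat_combination_diff[OF X(1)[THEN sym_mats_carrier] U(1)[THEN sym_mats_carrier], of s]
  note v = vec_combination_diff[OF X(2) U(2), of s]
  show "lin X y ((1 - s) \<cdot>\<^sub>m X + s \<cdot>\<^sub>m U) ((1 - s) \<cdot>\<^sub>v y + s \<cdot>\<^sub>v u) = s * lin X y U u"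
    unfolding lin_def m v mat.ip_sm_right[OF UX GX_closed[OF X]] vec.ip_sm_right[OF uy Gy_closed[OF X]]
    by (simp add: distrib_left)
  have "s \<cdot>\<^sub>v A (U - X) + s \<cdot>\<^sub>v (u - y) = s \<cdot>\<^sub>v rdiff X y U u"
    unfolding rdiff_def using map_closed[OF UX] uy by (simp add: smult_add_distrib_vec[of _ p])
  then show "vsq (rdiff X y ((1 - s) \<cdot>\<^sub>m X + s \<cdot>\<^sub>m U) ((1 - s) \<cdot>\<^sub>v y + s \<cdot>\<^sub>v u)) = s\<^sup>2 * vsq (rdiff X y U u)"
    unfolding rdiff_def[of X y "(1 - s) \<cdot>\<^sub>m X + s \<cdot>\<^sub>m U"] m v map_smult[OF UX]
    using rdiff_closed[OF X U] by (simp add: power2_eq_square)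
qed

lemma feasible_combination:
  assumes "feasible X y" "feasible U u" "0 \<le> s" "s \<le> 1"
  shows "feasible ((1 - s) \<cdot>\<^sub>m X + s \<cdot>\<^sub>m U) ((1 - s) \<cdot>\<^sub>v y + s \<cdot>\<^sub>v u)"
  using assms spectrahedron_convex data_simps(10) unfolding vconvex_def by blast

text \<open>Towards \<open>(U, u)\<close> the objective changes by at most
  \<open>s * lin X y U u + s\<^sup>2 * q\<close>, which a negative slope would make negative for
  small \<open>s\<close>.\<close>

lemma minimizer_first_order:
  assumes min: "minimizer n K f X y" and U: "feasible U u"
  shows "0 \<le> lin X y U u"
proof (rule ccontr)
  assume "\<not> 0 \<le> lin X y U u"
  then have neg: "lin X y U u < 0" by simp
  note F = minimizerD(1)[OF min]
  have c: "X \<in> sym_mats n" "y \<in> carrier_vec p" "U \<in> sym_mats n" "u \<in> carrier_vec p"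
    using feasible_carrier[OF F] feasible_carrier[OF U] by auto
  define q where "q = \<beta> / 2 * vsq (rdiff X y U u)"
  have q0: "0 \<le> q" using data_simps(4) vec.ip_ge0[OF rdiff_closed[OF c]] by (simp add: q_def)
  have le: "0 \<le> s * lin X y U u + s\<^sup>2 * q" if s: "0 \<le> s" "s \<le> 1" for s
  proof -
    note G = feasible_combination[OF F U s]
    have "f X y \<le> f ((1 - s) \<cdot>\<^sub>m X + s \<cdot>\<^sub>m U) ((1 - s) \<cdot>\<^sub>v y + s \<cdot>\<^sub>v u)"
      by (rule minimizerD(2)[OF min G])
    also have "\<dots> \<le> f X y + s * lin X y U u + \<beta> / 2 * (s\<^sup>2 * vsq (rdiff X y U u))"
      using objective_expansion(1)[OF c(1,2) feasible_carrier[OF G, THEN conjunct1]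
          feasible_carrier[OF G, THEN conjunct2]] lin_combination[OF c, of s] by simp
    finally show ?thesis by (simp add: q_def algebra_simps)
  qed
  \<comment> \<open>Small enough that the quadratic term uses up at most half of the slope; the
    added 1 covers \<open>q = 0\<close>.\<close>
  define s where "s = min 1 (- lin X y U u / (2 * (q + 1)))"
  have "0 < - lin X y U u / (2 * (q + 1))" using neg q0 by (intro divide_pos_pos) auto
  then have s: "0 < s" "s \<le> 1" by (auto simp: s_def)
  have "s * (q + 1) \<le> (- lin X y U u / (2 * (q + 1))) * (q + 1)"
    using q0 by (intro mult_right_mono) (auto simp: s_def)
  also have "\<dots> = - lin X y U u / 2" using q0 by (simp add: field_simps)
  finally have "s * q < - lin X y U u" using neg s by (simp add: algebra_simps)
  then have "s * (lin X y U u + s * q) < 0" using s by (intro mult_pos_neg) auto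
  then show False using le[of s] s by (simp add: power2_eq_square algebra_simps)
qed

end

section \<open>Consequences of the eigengap at a minimizer\<close>

locale fw_gap = fw_problem +
  fixes Xs ys \<delta>
  assumes n2: "2 \<le> n" and min: "minimizer n K f Xs ys" and \<delta>: "0 < \<delta>"
    and gap: "eigval (GX Xs ys) (n - 1) - eigval (GX Xs ys) n = \<delta>"
begin

lemma Xs: "Xs \<in> spectrahedron n" "Xs \<in> sym_mats n" and ys: "ys \<in> K" "ys \<in> carrier_vec p"
  using minimizerD(1)[OF min] feasible_carrier by auto

lemma square_diff_le:
  assumes "X \<in> spectrahedron n" "Y \<in> spectrahedron n"
  shows "msq (X - Y) \<le> 2 * (1 - trace_inner Y X)"
  using assms[THEN spectrahedronD(1)] assms[THEN spectrahedron_inner_self_le_1]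
  by (simp add: mat.ip_simps[of _ n] mat.diff_closed mat.ip_commute[of X n Y])

text \<open>By first-order optimality \<open>Xs\<close> minimizes the linear functional given by
  \<open>?B\<close> over the spectrahedron, and a positive gap leaves the bottom eigenprojection as
  the only such point. The gap inequality at \<open>X\<close> then measures the weight off
  \<open>Xs\<close>, and \<open>square_diff_le\<close> turns that weight into a squared
  distance.\<close>

lemma gradient_gap:
  assumes X: "X \<in> spectrahedron n"
  shows "\<delta> / 2 * msq (X - Xs) \<le> trace_inner (GX Xs ys) (X - Xs)"
proof -
  let ?B = "GX Xs ys"
  note B = GX_closed[OF Xs(2) ys(2)]
  obtain w where w: "w \<in> carrier_vec n" "scalar_prod w w = 1"
    and ge: "\<And>X. X \<in> spectrahedron n \<Longrightarrow> trace_inner ?B (outer w)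
      + (eigval ?B (n - 1) - eigval ?B n) * (1 - trace_inner (outer w) X) \<le> trace_inner ?B X"
    using trace_inner_ge_bottom_eigenvector[OF B n2] by blast
  note W = outer_spectrahedron[OF w]
  \<comment> \<open>Keeping the second block at \<open>ys\<close> removes the \<open>y\<close>
    gradient from the optimality condition.\<close>
  have lin_eq: "lin Xs ys X ys = trace_inner ?B X - trace_inner ?B Xs" if "X \<in> spectrahedron n" for X
  proof -
    have "scalar_prod (Gy Xs ys) (ys - ys) = 0"
      using vec.ip_diff_right[OF ys(2) ys(2) Gy_closed[OF Xs(2) ys(2)]] by simp
    then show ?thesis
      unfolding lin_def using mat.ip_diff_right[OF spectrahedronD(1)[OF that] Xs(2) B] by simp
  qed
  have opt: "trace_inner ?B Xs \<le> trace_inner ?B (outer w)"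
  proof -
    have "0 \<le> lin Xs ys (outer w) ys" using W ys by (intro minimizer_first_order[OF min]) blast
    then show ?thesis using lin_eq[OF W] by simp
  qed
  then have "\<delta> * (1 - trace_inner (outer w) Xs) \<le> 0" using ge[OF Xs(1)] gap by simp
  then have "1 - trace_inner (outer w) Xs \<le> 0" using \<delta> by (simp add: mult_le_0_iff)
  then have "msq (Xs - outer w) \<le> 0" using square_diff_le[OF Xs(1) W] by simp
  then have Xw: "Xs = outer w"
    using mat.ip_ge0[OF mat.diff_closed[OF Xs(2) spectrahedronD(1)[OF W]]] Xs spectrahedronD(1)[OF W]
    by (intro mat.ip_diff_eq0[of _ n]) auto
  have "\<delta> / 2 * msq (X - Xs) \<le> \<delta> * (1 - trace_inner Xs X)"
    using mult_left_mono[OF square_diff_le[OF X Xs(1)], of "\<delta> / 2"] \<delta> by simp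
  also have "\<dots> \<le> trace_inner ?B X - trace_inner ?B Xs"
    using ge[OF X] gap by (simp add: Xw[symmetric])
  also have "\<dots> = trace_inner ?B (X - Xs)"
    using mat.ip_diff_right[OF spectrahedronD(1)[OF X] Xs(2) B] by simp
  finally show ?thesis .
qed

text \<open>Moving only \<open>y\<close> in the optimality condition shows that the \<open>y\<close>
  part of \<open>lin\<close> is nonnegative. The \<open>X\<close> part contributes the gap term, and
  strong convexity the residual term.\<close>

lemma quadratic_growth:
  assumes F: "feasible X y"
  shows "\<delta> / 2 * msq (X - Xs) + \<alpha> / 2 * vsq (rdiff Xs ys X y) \<le> f X y - opt_value n K f"
proof -
  have c: "X \<in> sym_mats n" "y \<in> carrier_vec p" using feasible_carrier[OF F] by auto
  have "0 \<le> lin Xs ys Xs y" using F Xs by (intro minimizer_first_order[OF min]) auto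
  moreover have "trace_inner (GX Xs ys) (Xs - Xs) = 0"
    using mat.ip_diff_right[OF Xs(2) Xs(2) GX_closed[OF Xs(2) ys(2)]] by simp
  ultimately have "0 \<le> scalar_prod (Gy Xs ys) (y - ys)" by (simp add: lin_def)
  then have "\<delta> / 2 * msq (X - Xs) \<le> lin Xs ys X y" using gradient_gap[of X] F by (simp add: lin_def)
  then show ?thesis
    using objective_expansion(2)[OF Xs(2) ys(2) c] minimizerD(3)[OF min] by simp
qed

text \<open>The displacement of \<open>y\<close> is that of the residual minus its \<open>A\<close>
  part, which brings in the distance of \<open>X\<close>.\<close>

lemma y_distance:
  assumes F: "feasible X y"
  shows "vsq (y - ys) \<le> 2 * vsq (rdiff Xs ys X y) + 2 * N\<^sup>2 * msq (X - Xs)"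
proof -
  have c: "X \<in> sym_mats n" "y \<in> carrier_vec p" using feasible_carrier[OF F] by auto
  note XX = mat.diff_closed[OF c(1) Xs(2)]
  have "y - ys = rdiff Xs ys X y + (-1) \<cdot>\<^sub>v A (X - Xs)"
    unfolding rdiff_def using map_closed[OF XX] c ys by (intro eq_vecI) auto
  then have "vsq (y - ys) \<le> 2 * vsq (rdiff Xs ys X y) + 2 * vsq ((-1) \<cdot>\<^sub>v A (X - Xs))"
    using vec.ip_add_self_le[OF rdiff_closed[OF Xs(2) ys(2) c], of "(-1) \<cdot>\<^sub>v A (X - Xs)"]
      map_closed[OF XX] by simp
  also have "vsq ((-1) \<cdot>\<^sub>v A (X - Xs)) = vsq (A (X - Xs))" using map_closed[OF XX] by simp
  finally show ?thesis using map_norm_le[OF XX] by simp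
qed

lemma gap_nonneg:
  assumes F: "feasible X y"
  shows "0 \<le> f X y - opt_value n K f"
  using minimizerD(2)[OF min F] minimizerD(3)[OF min] by simp

lemma distances_le:
  assumes F: "feasible X y"
  defines "h \<equiv> f X y - opt_value n K f"
  shows "msq (X - Xs) \<le> 2 * h / \<delta>" "vsq (rdiff Xs ys X y) \<le> 2 * h / \<alpha>"
    "vsq (y - ys) \<le> 4 * h / \<alpha> + 4 * N\<^sup>2 * h / \<delta>"
proof -
  have c: "X \<in> sym_mats n" "y \<in> carrier_vec p" using feasible_carrier[OF F] by auto
  have pos: "0 \<le> \<delta> / 2 * msq (X - Xs)" "0 \<le> \<alpha> / 2 * vsq (rdiff Xs ys X y)"
    using \<delta> data_simps(3) mat.ip_ge0[OF mat.diff_closed[OF c(1) Xs(2)]]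
      vec.ip_ge0[OF rdiff_closed[OF Xs(2) ys(2) c]] by auto
  have "\<delta> / 2 * msq (X - Xs) \<le> h" "\<alpha> / 2 * vsq (rdiff Xs ys X y) \<le> h"
    using quadratic_growth[OF F] pos unfolding h_def by linarith+
  then show 1: "msq (X - Xs) \<le> 2 * h / \<delta>" and 2: "vsq (rdiff Xs ys X y) \<le> 2 * h / \<alpha>"
    using \<delta> data_simps(3) by (simp_all add: field_simps)
  have "2 * N\<^sup>2 * msq (X - Xs) \<le> 2 * N\<^sup>2 * (2 * h / \<delta>)" using 1 by (intro mult_left_mono) auto
  then show "vsq (y - ys) \<le> 4 * h / \<alpha> + 4 * N\<^sup>2 * h / \<delta>"
    using y_distance[OF F] 2 by simp
qed

text \<open>At a second minimizer the optimality gap is 0, so every bound of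
  \<open>distances_le\<close> collapses.\<close>

lemma minimizer_unique:
  assumes "minimizer n K f X y"
  shows "X = Xs \<and> y = ys"
proof
  note F = minimizerD(1)[OF assms]
  have c: "X \<in> sym_mats n" "y \<in> carrier_vec p" using feasible_carrier[OF F] by auto
  have h0: "f X y - opt_value n K f = 0" using minimizerD(3)[OF assms] by simp
  note le = distances_le[OF F, unfolded h0]
  show "X = Xs"
    using le(1) mat.ip_ge0[OF mat.diff_closed[OF c(1) Xs(2)]]
    by (intro mat.ip_diff_eq0[OF c(1) Xs(2)]) simp
  show "y = ys"
    using le(3) vec.ip_ge0[OF vec.diff_closed[OF c(2) ys(2)]]
    by (intro vec.ip_diff_eq0[OF c(2) ys(2)]) simp
qed

text \<open>A perturbation argument of Davis-Kahan type. At the current gradient \<open>V\<close> is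
  no worse than \<open>Xs\<close>; at the optimal gradient it is worse by at least
  \<open>\<delta> / 2\<close> times the squared distance. The change of gradient must pay for this,
  and it is at most linear in that distance and in the residual error \<open>m\<close>.\<close>

lemma eigenvector_distance:
  assumes F: "feasible X y" and V: "V \<in> spectrahedron n"
    and top: "trace_inner (GX X y) V \<le> trace_inner (GX X y) Xs"
  shows "msq (V - Xs) \<le> 8 * \<beta>\<^sup>2 * N\<^sup>2 * (f X y - opt_value n K f) / (\<alpha> * \<delta>\<^sup>2)"
proof -
  define h where "h = f X y - opt_value n K f"
  have c: "X \<in> sym_mats n" "y \<in> carrier_vec p" using feasible_carrier[OF F] by auto
  note Vs = spectrahedronD(1)[OF V]
  note D = mat.diff_closed[OF Vs Xs(2)]
  define a where "a = sqrt (msq (V - Xs))"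
  define m where "m = sqrt (vsq (rdiff Xs ys X y))"
  have a0: "0 \<le> a" "a\<^sup>2 = msq (V - Xs)" using mat.ip_ge0[OF D] by (auto simp: a_def)
  have m0: "0 \<le> m" "m\<^sup>2 = vsq (rdiff Xs ys X y)"
    using vec.ip_ge0[OF rdiff_closed[OF Xs(2) ys(2) c]] by (auto simp: m_def)
  have "trace_inner (GX X y) (V - Xs) \<le> 0"
    using top mat.ip_diff_right[OF Vs Xs(2) GX_closed[OF c]] by simp
  then have "\<delta> / 2 * a\<^sup>2 \<le> trace_inner (GX Xs ys) (V - Xs) - trace_inner (GX X y) (V - Xs)"
    using gradient_gap[OF V] a0 by simp
  also have "\<dots> \<le> \<beta> * vdist p (res Xs ys) (res X y) * (N * a)"
    unfolding a_def by (rule GX_difference_bound[OF Xs(2) ys(2) c D])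
  also have "vdist p (res Xs ys) (res X y) = m"
    using vdist_res[OF Xs(2) ys(2) c] Metric_space.commute[OF Metric_space_vdist[of p]]
    by (simp add: m_def)
  finally have "\<delta> / 2 * a * a \<le> (\<beta> * m * N) * a" by (simp add: power2_eq_square mult_ac)
  \<comment> \<open>One factor \<open>a\<close> cancels, which leaves \<open>a\<close> bounded by a
    multiple of \<open>m\<close>; hence its square is of the order of the optimality gap.\<close>
  then have "\<delta> / 2 * a \<le> \<beta> * m * N"
    using a0(1) data_simps(4) m0(1) op_norm_nonneg by (cases "a = 0") (auto simp: mult_le_cancel_right)
  then have "(\<delta> * a)\<^sup>2 \<le> (2 * \<beta> * m * N)\<^sup>2" using a0 \<delta> by (intro power_mono) auto
  also have "\<dots> = 4 * \<beta>\<^sup>2 * N\<^sup>2 * m\<^sup>2" by (simp add: power_mult_distrib)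
  also have "\<dots> \<le> 4 * \<beta>\<^sup>2 * N\<^sup>2 * (2 * h / \<alpha>)"
    using distances_le(2)[OF F] m0 by (intro mult_left_mono) (auto simp: h_def)
  finally have "\<delta>\<^sup>2 * msq (V - Xs) \<le> 8 * \<beta>\<^sup>2 * N\<^sup>2 * h / \<alpha>" by (simp add: power_mult_distrib a0)
  then show ?thesis using \<delta> data_simps(3) by (simp add: h_def field_simps)
qed

end

section \<open>The iteration and its one-step inequality\<close>

locale fw_iteration = fw_problem +
  fixes X y v \<eta>
  assumes run: "fw_run n p \<beta> K f X y v \<eta>"
begin

lemma runD:
  assumes "1 \<le> t"
  shows "y (Suc t) = vproj p K (y t - (1 / (2 * \<beta>)) \<cdot>\<^sub>v Gy (X t) (y t))"
    "v t \<in> carrier_vec n" "scalar_prod (v t) (v t) = 1"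
    "(- GX (X t) (y t)) *\<^sub>v v t = eigval (- GX (X t) (y t)) 1 \<cdot>\<^sub>v v t"
    "0 \<le> \<eta> t" "\<eta> t \<le> 1"
    "0 \<le> e \<Longrightarrow> e \<le> 1 \<Longrightarrow> f (X (Suc t)) (y (Suc t)) \<le> f ((1 - e) \<cdot>\<^sub>m X t + e \<cdot>\<^sub>m outer (v t)) (y (Suc t))"
    "X (Suc t) = (1 - \<eta> t) \<cdot>\<^sub>m X t + \<eta> t \<cdot>\<^sub>m outer (v t)"
  using run assms unfolding fw_run_def
  by (auto simp: vnorm_def eigenvector_def is_arg_min_linorder)

lemma K_nonempty: "K \<noteq> {}"
  using run by (auto simp: fw_run_def)

lemma iterates_feasible: "1 \<le> t \<Longrightarrow> feasible (X t) (y t)"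
proof (induction t rule: dec_induct)
  case base
  then show ?case using run by (simp add: fw_run_def)
next
  case (step t)
  have "y t - (1 / (2 * \<beta>)) \<cdot>\<^sub>v Gy (X t) (y t) \<in> carrier_vec p"
    using feasible_carrier[OF step.IH] Gy_closed by simp
  then have "y (Suc t) \<in> K" using runD(1)[OF step.hyps(1)] vproj_closest(1)[OF _ K_nonempty] by simp
  moreover have "X (Suc t) \<in> spectrahedron n"
    using runD(2,3,5,6,8)[OF step.hyps(1)] step.IH
    by (auto intro!: spectrahedron_convex outer_spectrahedron)
  ultimately show ?case by blast
qed

lemma iterates_carrier: "1 \<le> t \<Longrightarrow> X t \<in> sym_mats n" "1 \<le> t \<Longrightarrow> y t \<in> carrier_vec p"
  using iterates_feasible feasible_carrier by blast+

text \<open>A top eigenvector of the negated gradient minimizes the gradient's own functional over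
  the spectrahedron.\<close>

lemma outer_top:
  assumes t: "1 \<le> t" and U: "U \<in> spectrahedron n"
  shows "trace_inner (GX (X t) (y t)) (outer (v t)) \<le> trace_inner (GX (X t) (y t)) U"
proof -
  let ?G = "GX (X t) (y t)"
  note G = GX_closed[OF iterates_carrier[OF t]] and V = outer_spectrahedron[OF runD(2,3)[OF t]]
  have eq: "- ?G = (-1) \<cdot>\<^sub>m ?G" by (intro eq_matI) auto
  then have mG: "- ?G \<in> sym_mats n" using mat.sm_closed[OF G] by simp
  have "trace_inner (- ?G) U \<le> trace_inner (- ?G) (outer (v t))"
    by (rule trace_inner_le_top_eigenvector[OF mG runD(2,3,4)[OF t] U])
  then show ?thesis
    unfolding eq using G spectrahedronD(1)[OF U] spectrahedronD(1)[OF V] by (simp add: mat.ip_sm_left[of _ n])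
qed

text \<open>Expanding the square shows that the projection step minimizes the quadratic model
  \<open>scalar_prod (Gy X y) (w - y) + \<beta> * vsq (w - y)\<close> over \<open>K\<close>.\<close>

lemma projection_step:
  assumes t: "1 \<le> t" and w: "w \<in> K"
  shows "scalar_prod (Gy (X t) (y t)) (y (Suc t) - y t) + \<beta> * vsq (y (Suc t) - y t)
    \<le> scalar_prod (Gy (X t) (y t)) (w - y t) + \<beta> * vsq (w - y t)"
proof -
  let ?G = "Gy (X t) (y t)"
  define z where "z = y t - (1 / (2 * \<beta>)) \<cdot>\<^sub>v ?G"
  note G = Gy_closed[OF iterates_carrier[OF t]] and yt = iterates_carrier(2)[OF t]
  have z: "z \<in> carrier_vec p" using G yt by (simp add: z_def)
  \<comment> \<open>The factor \<open>4 * \<beta> * \<beta>\<close> clears the denominator of the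
    step size. What remains is the model times \<open>4 * \<beta>\<close>, plus a term independent
    of \<open>w\<close>.\<close>
  have eq: "4 * \<beta> * \<beta> * (vdist p z w)\<^sup>2
      = scalar_prod ?G ?G + 4 * \<beta> * (scalar_prod ?G (w - y t) + \<beta> * vsq (w - y t))"
    if w: "w \<in> K" for w
  proof -
    note wc = K_carrier[OF w]
    define d where "d = w - y t"
    define k where "k = 1 / (2 * \<beta>)"
    have d: "d \<in> carrier_vec p" using wc yt by (simp add: d_def)
    have "z - w = (-1) \<cdot>\<^sub>v (d + k \<cdot>\<^sub>v ?G)"
      unfolding z_def d_def k_def using G yt wc by (intro eq_vecI) auto
    then have "(vdist p z w)\<^sup>2 = vsq ((-1) \<cdot>\<^sub>v (d + k \<cdot>\<^sub>v ?G))"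
      using vdist_square[OF z wc] by simp
    also have "\<dots> = vsq (d + k \<cdot>\<^sub>v ?G)"
      using d G by (simp add: vec.ip_sm_left[of _ p] vec.ip_sm_right[of _ p])
    also have "\<dots> = vsq d + 2 * k * scalar_prod ?G d + k\<^sup>2 * scalar_prod ?G ?G"
      using d G vec.ip_commute[OF d G]
      by (simp add: vec.ip_add_left[of _ p] vec.ip_add_right[of _ p] power2_eq_square algebra_simps)
    finally have "4 * \<beta> * \<beta> * (vdist p z w)\<^sup>2
        = 4 * \<beta> * \<beta> * vsq d + 4 * \<beta> * (2 * \<beta> * k) * scalar_prod ?G d + (2 * \<beta> * k)\<^sup>2 * scalar_prod ?G ?G"
      by (simp add: power2_eq_square algebra_simps)
    also have "2 * \<beta> * k = 1" using data_simps(4) by (simp add: k_def)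
    finally show ?thesis by (simp add: d_def distrib_left mult.assoc)
  qed
  have "y (Suc t) = vproj p K z" using runD(1)[OF t] by (simp add: z_def)
  then have "vdist p z (y (Suc t)) \<le> vdist p z w"
    using vproj_closest(2)[OF z K_nonempty w] by simp
  then have "(vdist p z (y (Suc t)))\<^sup>2 \<le> (vdist p z w)\<^sup>2"
    by (intro power_mono) (auto simp: vdist_def)
  then have "4 * \<beta> * \<beta> * (vdist p z (y (Suc t)))\<^sup>2 \<le> 4 * \<beta> * \<beta> * (vdist p z w)\<^sup>2"
    using data_simps(4) by (intro mult_left_mono) auto
  moreover have "y (Suc t) \<in> K" using iterates_feasible[of "Suc t"] by simp
  ultimately have "4 * \<beta> * (scalar_prod ?G (y (Suc t) - y t) + \<beta> * vsq (y (Suc t) - y t))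
      \<le> 4 * \<beta> * (scalar_prod ?G (w - y t) + \<beta> * vsq (w - y t))"
    using eq w by simp
  then show ?thesis using data_simps(4) by (simp add: mult_le_cancel_left)
qed

text \<open>The line search runs after the update of \<open>y\<close>, so its result is no worse
  than the point \<open>Z\<close> with the new \<open>y\<close>. The separated smoothness bound
  there is lowered block by block: the eigenvector beats \<open>U\<close> in the linear term, and
  the projection beats the feasible point \<open>w\<close> in its whole model. Convexity finally
  replaces \<open>lin\<close> by a difference of values.\<close>

lemma descent:
  assumes t: "1 \<le> t" and U: "feasible U u" and e: "0 \<le> e" "e \<le> 1"
  shows "f (X (Suc t)) (y (Suc t)) \<le> (1 - e) * f (X t) (y t) + e * f U u
    + e\<^sup>2 * (\<beta> * (N\<^sup>2 * msq (outer (v t) - X t) + vsq (u - y t)))"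
proof -
  let ?V = "outer (v t)" and ?X = "X t" and ?y = "y t" and ?y' = "y (Suc t)"
  let ?G = "GX ?X ?y" and ?g = "Gy ?X ?y"
  define Z where "Z = (1 - e) \<cdot>\<^sub>m ?X + e \<cdot>\<^sub>m ?V"
  define w where "w = (1 - e) \<cdot>\<^sub>v ?y + e \<cdot>\<^sub>v u"
  note Xc = iterates_carrier[OF t] and F = iterates_feasible[OF t]
  have y'c: "?y' \<in> carrier_vec p" using iterates_carrier(2)[of "Suc t"] by simp
  have V: "?V \<in> spectrahedron n" using runD(2,3)[OF t] by (rule outer_spectrahedron)
  note Vc = spectrahedronD(1)[OF V]
  have Uc: "U \<in> sym_mats n" "u \<in> carrier_vec p" using feasible_carrier[OF U] by auto
  note G = GX_closed[OF Xc] and g = Gy_closed[OF Xc]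
  note D = mat.diff_closed[OF Vc Xc(1)] and du = vec.diff_closed[OF Uc(2) Xc(2)]
  have Zc: "Z \<in> sym_mats n" unfolding Z_def using Xc Vc by (intro mat.add_closed mat.sm_closed)
  have ZX: "Z - ?X = e \<cdot>\<^sub>m (?V - ?X)"
    unfolding Z_def by (rule mat_combination_diff[OF sym_mats_carrier[OF Xc(1)] sym_mats_carrier[OF Vc]])
  have wy: "w - ?y = e \<cdot>\<^sub>v (u - ?y)" unfolding w_def by (rule vec_combination_diff[OF Xc(2) Uc(2)])
  have wK: "w \<in> K" using feasible_combination[OF F U e] by (simp add: w_def)
  have "f (X (Suc t)) ?y' \<le> f Z ?y'" using runD(7)[OF t e] by (simp add: Z_def)
  also have "\<dots> \<le> f ?X ?y + lin ?X ?y Z ?y' + \<beta> / 2 * vsq (rdiff ?X ?y Z ?y')"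
    by (rule objective_expansion(1)[OF Xc Zc y'c])
  \<comment> \<open>The coefficient of the \<open>y\<close> block becomes exactly
    \<open>\<beta>\<close>, as in \<open>projection_step\<close>.\<close>
  also have "\<beta> / 2 * vsq (rdiff ?X ?y Z ?y') \<le> \<beta> / 2 * (2 * N\<^sup>2 * msq (Z - ?X) + 2 * vsq (?y' - ?y))"
    using rdiff_square_le[OF Xc Zc y'c] data_simps(4) by (intro mult_left_mono) auto
  also have "msq (Z - ?X) = e\<^sup>2 * msq (?V - ?X)"
    unfolding ZX using D mat.sm_closed[OF D] by (simp add: mat.ip_simps[of _ n] power2_eq_square)
  also have "lin ?X ?y Z ?y' = e * trace_inner ?G (?V - ?X) + scalar_prod ?g (?y' - ?y)"
    unfolding lin_def ZX mat.ip_sm_right[OF D G] ..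
  finally have "f (X (Suc t)) ?y' \<le> f ?X ?y + e * trace_inner ?G (?V - ?X) + \<beta> * N\<^sup>2 * (e\<^sup>2 * msq (?V - ?X))
      + (scalar_prod ?g (?y' - ?y) + \<beta> * vsq (?y' - ?y))"
    by (simp add: algebra_simps)
  also have "scalar_prod ?g (?y' - ?y) + \<beta> * vsq (?y' - ?y) \<le> scalar_prod ?g (w - ?y) + \<beta> * vsq (w - ?y)"
    by (rule projection_step[OF t wK])
  also have "\<dots> = e * scalar_prod ?g (u - ?y) + \<beta> * (e\<^sup>2 * vsq (u - ?y))"
    unfolding wy using du g by (simp add: power2_eq_square)
  also have "e * trace_inner ?G (?V - ?X) \<le> e * trace_inner ?G (U - ?X)"
    using outer_top[OF t, of U] U e G Vc Uc Xc
    by (intro mult_left_mono) (simp_all add: mat.ip_diff_right[of _ n])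
  finally have "f (X (Suc t)) ?y' \<le> f ?X ?y + e * lin ?X ?y U u
      + e\<^sup>2 * (\<beta> * (N\<^sup>2 * msq (?V - ?X) + vsq (u - ?y)))"
    by (simp add: lin_def algebra_simps)
  moreover have "lin ?X ?y U u \<le> f U u - f ?X ?y"
    using objective_expansion(2)[OF Xc Uc] data_simps(3) vec.ip_ge0[OF rdiff_closed[OF Xc Uc]]
      mult_nonneg_nonneg[of "\<alpha> / 2" "vsq (rdiff ?X ?y U u)"] by linarith
  ultimately show ?thesis
    using mult_left_mono[OF _ e(1), of "lin ?X ?y U u" "f U u - f ?X ?y"] by (simp add: algebra_simps)
qed

text \<open>The bound starts at 2: the initial gap depends on \<open>C\<close> and \<open>c\<close>,
  which do not occur on the right. One full step removes this dependence.\<close>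

lemma sublinear_rate:
  assumes t: "2 \<le> t"
  shows "f (X t) (y t) - opt_value n K f \<le> 8 * (\<beta> * (N\<^sup>2 + (vdiameter p K)\<^sup>2) / real t)"
proof -
  define D where "D = vdiameter p K"
  define h where "h t = f (X t) (y t) - opt_value n K f" for t
  define B where "B = \<beta> * (2 * N\<^sup>2 + D\<^sup>2)"
  have B0: "0 \<le> B" using data_simps(4) by (simp add: B_def)
  obtain U u where min: "minimizer n K f U u" using minimizer_exists[OF K_nonempty] by blast
  note Um = minimizerD(1)[OF min]
  have step: "h (Suc t) \<le> (1 - e) * h t + e\<^sup>2 * B" if t: "1 \<le> t" and e: "0 \<le> e" "e \<le> 1" for t e
  proof -
    note F = iterates_feasible[OF t] and V = outer_spectrahedron[OF runD(2,3)[OF t]]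
    \<comment> \<open>Both matrices have norm at most 1 and a nonnegative inner product, so their
      squared distance is at most 2.\<close>
    have "msq (outer (v t) - X t) \<le> 2 * (1 - trace_inner (X t) (outer (v t)))"
    proof -
      have "msq (outer (v t) - X t) = msq (outer (v t)) - 2 * trace_inner (X t) (outer (v t)) + msq (X t)"
        using spectrahedronD(1)[OF V] iterates_carrier(1)[OF t]
        by (simp add: mat.ip_simps[of _ n] mat.diff_closed mat.ip_commute[of "outer (v t)" n "X t"])
      then show ?thesis
        using spectrahedron_inner_self_le_1[OF V] spectrahedron_inner_self_le_1[of "X t" n] F by simp
    qed
    moreover have "0 \<le> trace_inner (X t) (outer (v t))"
      using trace_inner_outer[of "X t" n "v t"] spectrahedronD(2,4)[of "X t" n] F runD(2)[OF t] by simp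
    ultimately have "msq (outer (v t) - X t) \<le> 2" by simp
    then have "N\<^sup>2 * msq (outer (v t) - X t) \<le> N\<^sup>2 * 2" by (rule mult_left_mono) simp
    moreover have "vsq (u - y t) \<le> D\<^sup>2"
      using vdist_square[of u p "y t"] vdist_le_diameter[of u "y t"] F Um K_carrier
        power_mono[of "vdist p u (y t)" D 2] by (simp add: D_def vdist_def)
    ultimately have "\<beta> * (N\<^sup>2 * msq (outer (v t) - X t) + vsq (u - y t)) \<le> B"
      unfolding B_def using data_simps(4) by (intro mult_left_mono) auto
    then have "e\<^sup>2 * (\<beta> * (N\<^sup>2 * msq (outer (v t) - X t) + vsq (u - y t))) \<le> e\<^sup>2 * B"
      by (rule mult_left_mono) simp
    then show ?thesis
      using descent[OF t Um e] minimizerD(3)[OF min] by (simp add: h_def algebra_simps)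
  qed
  have "h t \<le> 4 * B / (real t + 1)"
    using t
  proof (induction t rule: dec_induct)
    case base
    \<comment> \<open>With \<open>e = 1\<close> the old gap receives the coefficient 0.\<close>
    have "h 2 \<le> B" using step[of 1 1] by (simp add: numeral_2_eq_2)
    then show ?case using B0 by simp
  next
    case (step t)
    define s where "s = real t + 1"
    have s: "3 \<le> s" using step.hyps(1) by (simp add: s_def)
    \<comment> \<open>The usual Frank-Wolfe weight \<open>2 / (t + 1)\<close>, which is at most 1
      here.\<close>
    have "h (Suc t) \<le> (1 - 2 / s) * h t + (2 / s)\<^sup>2 * B"
      using step.hyps(1) s by (intro \<open>\<And>t e. 1 \<le> t \<Longrightarrow> 0 \<le> e \<Longrightarrow> e \<le> 1 \<Longrightarrow> h (Suc t) \<le> (1 - e) * h t + e\<^sup>2 * B\<close>) auto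
    also have "\<dots> \<le> (1 - 2 / s) * (4 * B / s) + (2 / s)\<^sup>2 * B"
      using step.IH s by (intro add_right_mono mult_left_mono) (auto simp: s_def)
    also have "\<dots> = 4 * B * ((s - 1) / s\<^sup>2)"
      using s by (simp add: field_simps power2_eq_square)
    \<comment> \<open>Equivalent to \<open>(s - 1) * (s + 1) \<le> s\<^sup>2\<close>.\<close>
    also have "\<dots> \<le> 4 * B * (1 / (s + 1))"
      using s B0 by (intro mult_left_mono) (simp_all add: field_simps power2_eq_square)
    finally show ?case by (simp add: s_def)
  qed
  also have "\<dots> \<le> 4 * B / real t" using t B0 by (intro divide_left_mono) auto
  \<comment> \<open>The 8 is 4 times the 2 in front of \<open>N\<^sup>2\<close> in
    \<open>B\<close>.\<close>
  also have "\<dots> \<le> 8 * (\<beta> * (N\<^sup>2 + D\<^sup>2)) / real t"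
    using t data_simps(4) by (intro divide_right_mono) (simp_all add: B_def algebra_simps)
  finally show ?thesis by (simp add: h_def D_def)
qed

end

section \<open>Rates under the eigengap\<close>

locale fw_gap_iteration = fw_gap + fw_iteration
begin

lemma eigenvector_rate:
  assumes t: "1 \<le> t"
  shows "msq (outer (v t) - Xs) \<le> 8 * (\<beta>\<^sup>2 * N\<^sup>2 / (\<alpha> * \<delta>\<^sup>2) * (f (X t) (y t) - opt_value n K f))"
  using eigenvector_distance[OF iterates_feasible[OF t] outer_spectrahedron[OF runD(2,3)[OF t]]
      outer_top[OF t Xs(1)]] by (simp add: field_simps)

text \<open>Both \<open>v t\<close> and \<open>X t\<close> approach \<open>Xs\<close>, so the quadratic term of the step is itself at most
  a multiple \<open>M\<close> of the current gap; the step size \<open>1 / (2 * M)\<close> balances the two terms.\<close>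

lemma linear_rate:
  assumes t: "1 \<le> t"
  defines "h \<equiv> \<lambda>t. f (X t) (y t) - opt_value n K f"
  shows "h (t + 1) \<le> h t * (1 - fw_rate \<alpha> \<beta> \<delta> N)"
proof -
  \<comment> \<open>Twice the eigenvector bound gives \<open>16 * N ^ 4 * \<beta>\<^sup>2\<close>.
    The distances of \<open>X t\<close> and \<open>y t\<close> give
    \<open>4 * \<alpha> * \<delta> * N\<^sup>2\<close> each, and the residual inside the bound on
    \<open>y t\<close> gives \<open>4 * \<delta>\<^sup>2\<close>, all over the common denominator
    \<open>\<alpha> * \<delta>\<^sup>2\<close>.\<close>
  define M where "M = \<beta> * (16 * N ^ 4 * \<beta>\<^sup>2 + 8 * \<alpha> * \<delta> * N\<^sup>2 + 4 * \<delta>\<^sup>2) / (\<alpha> * \<delta>\<^sup>2)"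
  note F = iterates_feasible[OF t] and V = outer_spectrahedron[OF runD(2,3)[OF t]]
  note \<alpha> = data_simps(3) and \<beta> = data_simps(4)
  have h0: "0 \<le> h t" using gap_nonneg[OF F] by (simp add: h_def)
  have "msq (outer (v t) - X t) \<le> 2 * msq (outer (v t) - Xs) + 2 * msq (Xs - X t)"
    using spectrahedronD(1)[OF V] iterates_carrier(1)[OF t] Xs(2) by (intro mat.ip_diff_self_le[of _ n])
  also have "msq (Xs - X t) = msq (X t - Xs)"
    using iterates_carrier(1)[OF t] Xs(2)
    by (simp add: mat.ip_simps[of _ n] mat.diff_closed)
  finally have triangle: "msq (outer (v t) - X t) \<le> 2 * msq (outer (v t) - Xs) + 2 * msq (X t - Xs)" .
  have m1: "msq (outer (v t) - X t)
      \<le> 2 * (8 * (\<beta>\<^sup>2 * N\<^sup>2 / (\<alpha> * \<delta>\<^sup>2) * h t)) + 2 * (2 * h t / \<delta>)"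
  proof -
    have "msq (outer (v t) - Xs) \<le> 8 * (\<beta>\<^sup>2 * N\<^sup>2 / (\<alpha> * \<delta>\<^sup>2) * h t)"
      using eigenvector_rate[OF t] unfolding h_def .
    moreover have "msq (X t - Xs) \<le> 2 * h t / \<delta>"
      using distances_le(1)[OF F] unfolding h_def .
    ultimately show ?thesis using triangle by linarith
  qed
  have v1: "vsq (ys - y t) \<le> 4 * h t / \<alpha> + 4 * N\<^sup>2 * h t / \<delta>"
  proof -
    have "vsq (ys - y t) = vsq (y t - ys)"
      using iterates_carrier(2)[OF t] ys(2)
      by (simp add: vec.ip_diff_left[of _ p] vec.ip_diff_right[of _ p])
    then show ?thesis using distances_le(3)[OF F] by (simp add: h_def)
  qed
  have "\<beta> * (N\<^sup>2 * msq (outer (v t) - X t) + vsq (ys - y t))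
      \<le> \<beta> * (N\<^sup>2 * (2 * (8 * (\<beta>\<^sup>2 * N\<^sup>2 / (\<alpha> * \<delta>\<^sup>2) * h t)) + 2 * (2 * h t / \<delta>))
        + (4 * h t / \<alpha> + 4 * N\<^sup>2 * h t / \<delta>))"
    using \<beta> m1 v1 by (intro mult_left_mono add_mono) auto
  also have "\<dots> = M * h t"
    using \<alpha> \<delta> by (simp add: M_def field_simps power2_eq_square power4_eq_xxxx)
  finally have quad: "\<beta> * (N\<^sup>2 * msq (outer (v t) - X t) + vsq (ys - y t)) \<le> M * h t" .
  have step: "h (t + 1) \<le> (1 - e) * h t + e\<^sup>2 * (M * h t)" if e: "0 \<le> e" "e \<le> 1" for e
  proof -
    have "e\<^sup>2 * (\<beta> * (N\<^sup>2 * msq (outer (v t) - X t) + vsq (ys - y t))) \<le> e\<^sup>2 * (M * h t)"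
      using quad by (rule mult_left_mono) simp
    then show ?thesis
      using descent[OF t minimizerD(1)[OF min] e] minimizerD(3)[OF min] by (simp add: h_def algebra_simps)
  qed
  define b where "b = \<alpha> * \<delta>\<^sup>2 / (4 * \<beta> * (10 * \<alpha> * \<delta> * N\<^sup>2 + 4 * \<delta>\<^sup>2 + 64 * N ^ 4 * \<beta>\<^sup>2))"
  have "\<alpha> \<le> \<beta>" by (rule strong_convexity_le_smoothness)
  \<comment> \<open>This makes \<open>1 / (2 * M)\<close> an admissible \<open>e\<close>; it rests
    on \<open>\<alpha> \<le> \<beta>\<close> and the term
    \<open>4 * \<delta>\<^sup>2\<close>.\<close>
  have M_pos: "1 \<le> M"
  proof -
    have "\<alpha> * \<delta>\<^sup>2 \<le> \<beta> * \<delta>\<^sup>2" using \<open>\<alpha> \<le> \<beta>\<close> by (rule mult_right_mono) simp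
    also have "\<dots> \<le> \<beta> * (16 * N ^ 4 * \<beta>\<^sup>2 + 8 * \<alpha> * \<delta> * N\<^sup>2 + 4 * \<delta>\<^sup>2)"
    proof (rule mult_left_mono)
      have "0 \<le> 16 * N ^ 4 * \<beta>\<^sup>2" "0 \<le> 8 * \<alpha> * \<delta> * N\<^sup>2" "0 \<le> \<delta>\<^sup>2" using \<alpha> \<delta> by auto
      then show "\<delta>\<^sup>2 \<le> 16 * N ^ 4 * \<beta>\<^sup>2 + 8 * \<alpha> * \<delta> * N\<^sup>2 + 4 * \<delta>\<^sup>2" by linarith
    qed (use \<beta> in simp)
    finally show ?thesis using \<alpha> \<delta> by (simp add: M_def)
  qed
  have "h (t + 1) \<le> (1 - 1 / (2 * M)) * h t + (1 / (2 * M))\<^sup>2 * (M * h t)"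
    using M_pos by (intro step) auto
  also have "\<dots> = h t * (1 - 1 / (4 * M))"
    using M_pos by (simp add: field_simps power2_eq_square)
  also have "\<dots> \<le> h t * (1 - fw_rate \<alpha> \<beta> \<delta> N)"
  proof (rule mult_left_mono[OF _ h0])
    \<comment> \<open>In both cases of \<open>fw_rate\<close> the minimum is at most
      \<open>b\<close>, and \<open>b\<close> is at most \<open>1 / (4 * M)\<close> because its
      coefficients 64 and 10 dominate 16 and 8.\<close>
    have "fw_rate \<alpha> \<beta> \<delta> N \<le> b" by (simp add: fw_rate_def b_def[symmetric] Let_def min_le_iff_disj)
    also have "b \<le> \<alpha> * \<delta>\<^sup>2 / (4 * \<beta> * (16 * N ^ 4 * \<beta>\<^sup>2 + 8 * \<alpha> * \<delta> * N\<^sup>2 + 4 * \<delta>\<^sup>2))"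
      unfolding b_def
    proof (rule divide_left_mono)
      have nn: "0 \<le> N ^ 4 * \<beta>\<^sup>2" "0 \<le> \<alpha> * \<delta> * N\<^sup>2" "0 < \<delta>\<^sup>2" using \<alpha> \<delta> by auto
      then show "4 * \<beta> * (16 * N ^ 4 * \<beta>\<^sup>2 + 8 * \<alpha> * \<delta> * N\<^sup>2 + 4 * \<delta>\<^sup>2)
          \<le> 4 * \<beta> * (10 * \<alpha> * \<delta> * N\<^sup>2 + 4 * \<delta>\<^sup>2 + 64 * N ^ 4 * \<beta>\<^sup>2)"
        using \<beta> by (intro mult_left_mono) auto
      have "0 < 16 * N ^ 4 * \<beta>\<^sup>2 + 8 * \<alpha> * \<delta> * N\<^sup>2 + 4 * \<delta>\<^sup>2"
        "0 < 10 * \<alpha> * \<delta> * N\<^sup>2 + 4 * \<delta>\<^sup>2 + 64 * N ^ 4 * \<beta>\<^sup>2" using nn by linarith+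
      then show "0 < 4 * \<beta> * (10 * \<alpha> * \<delta> * N\<^sup>2 + 4 * \<delta>\<^sup>2 + 64 * N ^ 4 * \<beta>\<^sup>2)
          * (4 * \<beta> * (16 * N ^ 4 * \<beta>\<^sup>2 + 8 * \<alpha> * \<delta> * N\<^sup>2 + 4 * \<delta>\<^sup>2))"
        using \<beta> by simp
    qed (use \<alpha> in simp)
    also have "\<dots> = 1 / (4 * M)" using \<alpha> \<beta> \<delta> by (simp add: M_def)
    finally show "1 - 1 / (4 * M) \<le> 1 - fw_rate \<alpha> \<beta> \<delta> N" by simp
  qed
  finally show ?thesis .
qed

end

theorem theorem6:
  shows "\<exists>c1>0. \<exists>c2>0. \<exists>c3>0. \<forall>n p \<alpha> \<beta> g A C c K X y v \<eta>.
    problem_data n p \<alpha> \<beta> g A C c K \<longrightarrow>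
    fw_run n p \<beta> K (objective g A C c) X y v \<eta> \<longrightarrow>
    (let f = objective g A C c;
         h = (\<lambda>t. f (X t) (y t) - opt_value n K f);
         N = op_norm n p A;
         D = vdiameter p K
     in
       (\<forall>t\<ge>2. h t \<le> c1 * (\<beta> * (N\<^sup>2 + D\<^sup>2) / real t)) \<and>
       (\<forall>\<delta>>0.
          2 \<le> n \<longrightarrow>
          (\<forall>Xs ys. minimizer n K f Xs ys \<longrightarrow>
             eigval (grad_X n f Xs ys) (n - 1) - eigval (grad_X n f Xs ys) n = \<delta>) \<longrightarrow>
          (\<exists>T0::nat. real T0 \<le> c2 * (N\<^sup>2 * \<beta> ^ 3 * (N\<^sup>2 + D\<^sup>2) / (\<alpha> * \<delta>\<^sup>2)) \<and>
             (\<forall>t\<ge>1. t \<ge> T0 \<longrightarrow> h (t + 1) \<le> h t * (1 - fw_rate \<alpha> \<beta> \<delta> N))) \<and>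
          (\<exists>!(Xs, ys). minimizer n K f Xs ys) \<and>
          (\<forall>Xs ys. minimizer n K f Xs ys \<longrightarrow>
             (\<forall>t\<ge>1. (fnorm (outer (v t) - Xs))\<^sup>2
                \<le> c3 * (\<beta>\<^sup>2 * N\<^sup>2 / (\<alpha> * \<delta>\<^sup>2) * h t)))))"
proof (rule exI[of _ 8], rule conjI, simp, rule exI[of _ 1], rule conjI, simp, rule exI[of _ 8],
    rule conjI, simp, intro allI impI, unfold Let_def, intro conjI allI impI)
  fix n p \<alpha> \<beta> g A C c K X y v \<eta>
  assume data: "problem_data n p \<alpha> \<beta> g A C c K"
    and run: "fw_run n p \<beta> K (objective g A C c) X y v \<eta>"
  interpret it: fw_iteration n p \<alpha> \<beta> g A C c K X y v \<eta>
    using data run by unfold_locales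
  show "it.f (X t) (y t) - opt_value n K it.f \<le> 8 * (\<beta> * ((op_norm n p A)\<^sup>2 + (vdiameter p K)\<^sup>2) / real t)"
    if "2 \<le> t" for t using it.sublinear_rate[OF that] .
  fix \<delta> :: real
  assume \<delta>: "0 < \<delta>" and n2: "2 \<le> n"
    and gap: "\<forall>Xs ys. minimizer n K it.f Xs ys \<longrightarrow>
      eigval (grad_X n it.f Xs ys) (n - 1) - eigval (grad_X n it.f Xs ys) n = \<delta>"
  \<comment> \<open>The gap is assumed at every minimizer, so any one of them, once shown to exist,
    can serve as the reference point.\<close>
  have gap_it: "fw_gap_iteration n p \<alpha> \<beta> g A C c K Xs ys \<delta> X y v \<eta>" if "minimizer n K it.f Xs ys" for Xs ys
    using that \<delta> n2 gap by unfold_locales auto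
  obtain Xs ys where min: "minimizer n K it.f Xs ys" using it.minimizer_exists[OF it.K_nonempty] by blast
  interpret gi: fw_gap_iteration n p \<alpha> \<beta> g A C c K Xs ys \<delta> X y v \<eta> by (rule gap_it[OF min])
  show "\<exists>T0::nat. real T0 \<le> 1 * ((op_norm n p A)\<^sup>2 * \<beta> ^ 3 * ((op_norm n p A)\<^sup>2 + (vdiameter p K)\<^sup>2) / (\<alpha> * \<delta>\<^sup>2)) \<and>
      (\<forall>t\<ge>1. t \<ge> T0 \<longrightarrow> it.f (X (t + 1)) (y (t + 1)) - opt_value n K it.f
        \<le> (it.f (X t) (y t) - opt_value n K it.f) * (1 - fw_rate \<alpha> \<beta> \<delta> (op_norm n p A)))"
  \<comment> \<open>The permitted bound on \<open>T0\<close> is 0 when \<open>N = 0\<close>, so a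
    witness valid in every case has to vanish there; 0 works throughout.\<close>
  proof (intro exI[of _ 0] conjI allI impI)
    show "real 0 \<le> 1 * ((op_norm n p A)\<^sup>2 * \<beta> ^ 3 * ((op_norm n p A)\<^sup>2 + (vdiameter p K)\<^sup>2) / (\<alpha> * \<delta>\<^sup>2))"
      using it.data_simps(3,4) by simp
  qed (rule gi.linear_rate)
  show "\<exists>!(Xs, ys). minimizer n K it.f Xs ys"
  proof (rule ex1I[of _ "(Xs, ys)"])
    show "case (Xs, ys) of (Xs, ys) \<Rightarrow> minimizer n K it.f Xs ys" using min by simp
    show "q = (Xs, ys)" if "case q of (Xs, ys) \<Rightarrow> minimizer n K it.f Xs ys" for q
    proof (cases q)
      case (Pair Xs' ys')
      then have "minimizer n K it.f Xs' ys'" using that by simp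
      then show ?thesis using gi.minimizer_unique Pair by blast
    qed
  qed
  show "(fnorm (outer (v t) - Xs'))\<^sup>2
      \<le> 8 * (\<beta>\<^sup>2 * (op_norm n p A)\<^sup>2 / (\<alpha> * \<delta>\<^sup>2) * (it.f (X t) (y t) - opt_value n K it.f))"
    if min': "minimizer n K it.f Xs' ys'" and t: "1 \<le> t" for Xs' ys' t
  proof -
    have "outer (v t) - Xs \<in> sym_mats n"
      using outer_sym[OF it.runD(2)[OF t]] gi.Xs(2) by (rule mat.diff_closed)
    then have "(fnorm (outer (v t) - Xs))\<^sup>2 = trace_inner (outer (v t) - Xs) (outer (v t) - Xs)"
      unfolding fnorm_def by (rule mat.nrm_square)
    then show ?thesis using gi.minimizer_unique[OF min'] gi.eigenvector_rate[OF t] by simp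
  qed
qed

end
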